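(* Let $k\neq 0$ be a commutative ring and $\lambda\in k^\Xi$. With $H^0$, $A(\lambda)$, $E$, and the maps $e(\lambda):E\to A(\lambda)$, $e=e(0):E\to H^0$ defined in the context: (1) The maps $e(\lambda)$ and $e$ are bijective. (2) The composite $\phi(\lambda):=e(\lambda)\circ e^{-1}:H^0\to A(\lambda)$ is a section. (3) $A(\lambda)$ is an $H^0$-cleft object.
   Context: Cleft objects. For a Hopf algebra $H$ over $k$ and a left $H$-comodule algebra $A$ (coaction $\rho$), a section is a convolution-invertible left $H$-colinear map $\phi:H\to A$ with $\phi(1)=1$. $A$ is an $H$-cleft object if a section exists and $\{a\mid\rho(a)=1\otimes a\}=k$. Setting. $\Gamma$ is an abelian group, $I$ a non-empty finite set; $g_i\in\Gamma$, $\chi_i\in\mathrm{Hom}(\Gamma,k^\times)$, $q_{ij}:=\chi_j(g_i)$. $V=\bigoplus_{i\in I}kx_i$ is free, a Yetter–Drinfeld module over $k\Gamma$ with $x_i$ of degree $g_i$ and $gx_i=\chi_i(g)x_i$; its braiding $c(x_i\otimes x_j)=q_{ij}x_j\otimes x_i$ makes $T^lV$ a $kB_l$-module ($B_l$ the braid group). $TV$ is a graded braided Hopf algebra with $V$ primitive; $F=TV\rtimes\Gamma$ is its bosonization: $TV\otimes k\Gamma$ with $gx_i=\chi_i(g)x_ig$, $\Delta(g)=g\otimes g$, $\Delta(x_i)=x_i\otimes1+g_i\otimes x_i$. Put $(\mathrm{ad}_c\,x_i)(x_j)=x_i\otimes x_j-q_{ij}x_j\otimes x_i$. Fix a partition $I=I_1\sqcup\cdots\sqcup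 I_N$ into non-empty subsets; $|i|=r$ if $i\in I_r$; assume $q_{ij}q_{ji}=1$ whenever $|i|\ne|j|$. $\Theta=\{(i,j)\mid|i|>|j|\}$, $\Xi=\{(i,j)\in\Theta\mid\chi_i\chi_j=1\}$. $\mathcal R\subset TV$ is a set of elements $\xi(x_{i_1}\otimes\cdots\otimes x_{i_l})$ ($l\ge2$, $\xi\in kB_l$, $|i_1|=\cdots=|i_l|$), with a finite chain $\emptyset=\mathcal R_{(0)}\subset\cdots\subset\mathcal R_{(L)}=\mathcal R$ such that every element of $\mathcal R_{(h)}$ ($0<h\le L$) is primitive in $TV$ modulo the ideal $(\mathcal R_{(h-1)})$. For $\lambda\in k^\Xi$ set $\lambda_{ij}=0$ on $\Theta\setminus\Xi$. Define $H^0=F/(\mathcal R\cup\{(\mathrm{ad}_c\,x_i)(x_j)\mid(i,j)\in\Theta\})$, a graded quotient Hopf algebra, and the quotient algebra $A(\lambda)=F/(\mathcal R\cup\{(\mathrm{ad}_c\,x_i)(x_j)-\lambda_{ij}g_ig_j\mid(i,j)\in\Theta\})$, so $A(0)=H^0$. The coproduct of $F$ induces an algebra map $A(\lambda)\to H^0\otimes A(\lambda)$ making $A(\lambda)$ a left $H^0$-comodule algebra. The map $e(\lambda)$. Let $V_r=\bigoplus_{i\in I_r}kx_i$ and let $\mathcal R_r\subset\mathcal R$ be the subset of elements $\xi(x_{i_1}\otimes\cdots\otimes x_{i_l})$ with $|i_1|=r$. Put $E=\frac{TV_1}{(\mathcal R_1)}\otimes\cdots\otimes\frac{TV_N}{(\mathcal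 R_N)}\otimes k\Gamma$. The map $e(\lambda):E\to A(\lambda)$ is the right $k\Gamma$-linear map $y_1\otimes\cdots\otimes y_N\otimes g\mapsto y_1\cdots y_Ng$ obtained from the canonical algebra maps $TV_r/(\mathcal R_r)\to A(\lambda)$, $k\Gamma\to A(\lambda)$ and multiplication. *)

theory Defs
  imports
    "HOL-Algebra.QuotRing"
    "HOL-Algebra.Module"
    "HOL-Algebra.Algebraic_Closure_Type"
    "HOL-Library.Poly_Mapping"
begin

text \<open>
  The ground ring \<open>k\<close> is a type \<open>'k :: comm_ring_1\<close> (so \<open>0 \<noteq> 1\<close>), viewed as a record by
  \<^const>\<open>ring_of_type_algebra\<close> where HOL-Algebra wants one; \<open>\<Gamma>\<close> is a type of class
  \<open>ab_group_add\<close>, hence written additively.  Modules and algebras over \<open>k\<close> are records of type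
  \<open>('k, 'a) module\<close>; for a mere module the ring multiplication is ignored.
\<close>

section \<open>Linear algebra over a commutative ring\<close>

definition k_algebra :: "('k::comm_ring_1, 'a) module \<Rightarrow> bool" where
  "k_algebra A \<longleftrightarrow> ring A \<and> module ring_of_type_algebra A \<and>
     (\<forall>c. \<forall>x\<in>carrier A. \<forall>y\<in>carrier A.
        (c \<odot>\<^bsub>A\<^esub> x) \<otimes>\<^bsub>A\<^esub> y = c \<odot>\<^bsub>A\<^esub> (x \<otimes>\<^bsub>A\<^esub> y) \<and>
        x \<otimes>\<^bsub>A\<^esub> (c \<odot>\<^bsub>A\<^esub> y) = c \<odot>\<^bsub>A\<^esub> (x \<otimes>\<^bsub>A\<^esub> y))"

definition linear_maps :: "('k, 'a) module \<Rightarrow> ('k, 'b) module \<Rightarrow> ('a \<Rightarrow> 'b) set" where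
  "linear_maps M P = {f \<in> carrier M \<rightarrow> carrier P.
     (\<forall>x\<in>carrier M. \<forall>y\<in>carrier M. f (x \<oplus>\<^bsub>M\<^esub> y) = f x \<oplus>\<^bsub>P\<^esub> f y) \<and>
     (\<forall>c. \<forall>x\<in>carrier M. f (c \<odot>\<^bsub>M\<^esub> x) = c \<odot>\<^bsub>P\<^esub> f x)}"

text \<open>
  The free module on a set \<open>B\<close> of basis elements, with the product
  \<open>b \<cdot> c = t b c (m b c)\<close> of basis elements and unit \<open>e\<close>.
\<close>

definition twisted_algebra ::
  "'b set \<Rightarrow> ('b \<Rightarrow> 'b \<Rightarrow> 'b) \<Rightarrow> ('b \<Rightarrow> 'b \<Rightarrow> 'k) \<Rightarrow> 'b \<Rightarrow> ('k::comm_ring_1, 'b \<Rightarrow>\<^sub>0 'k) module" where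
  "twisted_algebra B m t e =
     \<lparr>carrier = {f. Poly_Mapping.keys f \<subseteq> B},
      monoid.mult = (\<lambda>f h. \<Sum>b\<in>Poly_Mapping.keys f. \<Sum>c\<in>Poly_Mapping.keys h.
        Poly_Mapping.single (m b c) (Poly_Mapping.lookup f b * Poly_Mapping.lookup h c * t b c)),
      one = Poly_Mapping.single e 1,
      zero = 0,
      add = (+),
      module.smult = (\<lambda>c. Poly_Mapping.map ((*) c))\<rparr>"

definition monoid_algebra ::
  "'b set \<Rightarrow> ('b \<Rightarrow> 'b \<Rightarrow> 'b) \<Rightarrow> 'b \<Rightarrow> ('k::comm_ring_1, 'b \<Rightarrow>\<^sub>0 'k) module" where
  "monoid_algebra B m e = twisted_algebra B m (\<lambda>_ _. 1) e"

definition free_lift :: "('k::comm_ring_1, 'p) module \<Rightarrow> ('b \<Rightarrow> 'p) \<Rightarrow> ('b \<Rightarrow>\<^sub>0 'k) \<Rightarrow> 'p" where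
  "free_lift P \<beta> f =
     (\<Oplus>\<^bsub>P\<^esub>b\<in>Poly_Mapping.keys f. Poly_Mapping.lookup f b \<odot>\<^bsub>P\<^esub> \<beta> b)"

text \<open>
  The quotient by a submodule (a two-sided ideal, if the algebra structure is of interest):
  \<^const>\<open>FactRing\<close> together with the induced scalar multiplication.
\<close>

definition quotient :: "('k, 'a) module \<Rightarrow> 'a set \<Rightarrow> ('k, 'a set) module" where
  "quotient M N =
     \<lparr>carrier = a_rcosets\<^bsub>M\<^esub> N,
      monoid.mult = rcoset_mult M N,
      one = N +>\<^bsub>M\<^esub> \<one>\<^bsub>M\<^esub>,
      zero = N,
      add = set_add M,
      module.smult = (\<lambda>c C. \<Union>x\<in>C. N +>\<^bsub>M\<^esub> (c \<odot>\<^bsub>M\<^esub> x))\<rparr>"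

definition gen_submodule :: "('k::comm_ring_1, 'a) module \<Rightarrow> 'a set \<Rightarrow> 'a set" where
  "gen_submodule M S = \<Inter>{N. submodule N ring_of_type_algebra M \<and> S \<subseteq> N}"

text \<open>The map on a quotient induced by a map \<open>f\<close> that is constant on cosets.\<close>

definition induced :: "('a \<Rightarrow> 'b) \<Rightarrow> 'a set \<Rightarrow> 'b" where
  "induced f C = the_elem (f ` C)"

definition tensor_relations ::
  "('k::comm_ring_1, 'a) module \<Rightarrow> ('k, 'b) module \<Rightarrow> ('a \<times> 'b \<Rightarrow>\<^sub>0 'k) set" where
  "tensor_relations M P =
     {Poly_Mapping.single (a \<oplus>\<^bsub>M\<^esub> a', b) 1 - Poly_Mapping.single (a, b) 1
        - Poly_Mapping.single (a', b) 1 | a a' b. a \<in> carrier M \<and> a' \<in> carrier M \<and> b \<in> carrier P}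
   \<union> {Poly_Mapping.single (a, b \<oplus>\<^bsub>P\<^esub> b') 1 - Poly_Mapping.single (a, b) 1
        - Poly_Mapping.single (a, b') 1 | a b b'. a \<in> carrier M \<and> b \<in> carrier P \<and> b' \<in> carrier P}
   \<union> {Poly_Mapping.single (c \<odot>\<^bsub>M\<^esub> a, b) 1 - Poly_Mapping.single (a, b) c
        | c a b. a \<in> carrier M \<and> b \<in> carrier P}
   \<union> {Poly_Mapping.single (a, c \<odot>\<^bsub>P\<^esub> b) 1 - Poly_Mapping.single (a, b) c
        | c a b. a \<in> carrier M \<and> b \<in> carrier P}"

definition free_on_pairs ::
  "('k::comm_ring_1, 'a) module \<Rightarrow> ('k, 'b) module \<Rightarrow> ('k, 'a \<times> 'b \<Rightarrow>\<^sub>0 'k) module" where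
  "free_on_pairs M P = monoid_algebra (carrier M \<times> carrier P)
     (\<lambda>(a, b) (a', b'). (a \<otimes>\<^bsub>M\<^esub> a', b \<otimes>\<^bsub>P\<^esub> b')) (\<one>\<^bsub>M\<^esub>, \<one>\<^bsub>P\<^esub>)"

definition tensor ::
  "('k::comm_ring_1, 'a) module \<Rightarrow> ('k, 'b) module \<Rightarrow> ('k, ('a \<times> 'b \<Rightarrow>\<^sub>0 'k) set) module" where
  "tensor M P = quotient (free_on_pairs M P)
     (gen_submodule (free_on_pairs M P) (tensor_relations M P))"

definition pure_tensor ::
  "('k::comm_ring_1, 'a) module \<Rightarrow> ('k, 'b) module \<Rightarrow> 'a \<Rightarrow> 'b \<Rightarrow> ('a \<times> 'b \<Rightarrow>\<^sub>0 'k) set" where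
  "pure_tensor M P a b =
     gen_submodule (free_on_pairs M P) (tensor_relations M P)
       +>\<^bsub>free_on_pairs M P\<^esub> Poly_Mapping.single (a, b) 1"

text \<open>
  Tensor product of a family indexed by \<open>J\<close>: the free module on families, modulo the relations
  making \<open>y \<mapsto> \<Otimes>\<^sub>j y j\<close> multilinear.
\<close>

definition multi_relations ::
  "'j set \<Rightarrow> ('j \<Rightarrow> ('k::comm_ring_1, 'a) module) \<Rightarrow> (('j \<Rightarrow> 'a) \<Rightarrow>\<^sub>0 'k) set" where
  "multi_relations J M =
     {Poly_Mapping.single (y(j := a \<oplus>\<^bsub>M j\<^esub> a')) 1 - Poly_Mapping.single (y(j := a)) 1
        - Poly_Mapping.single (y(j := a')) 1
        | y j a a'. y \<in> (\<Pi>\<^sub>E i\<in>J. carrier (M i)) \<and> j \<in> J \<and> a \<in> carrier (M j) \<and> a' \<in> carrier (M j)}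
   \<union> {Poly_Mapping.single (y(j := c \<odot>\<^bsub>M j\<^esub> a)) 1 - Poly_Mapping.single (y(j := a)) c
        | y j c a. y \<in> (\<Pi>\<^sub>E i\<in>J. carrier (M i)) \<and> j \<in> J \<and> a \<in> carrier (M j)}"

definition free_on_families ::
  "'j set \<Rightarrow> ('j \<Rightarrow> ('k::comm_ring_1, 'a) module) \<Rightarrow> ('k, ('j \<Rightarrow> 'a) \<Rightarrow>\<^sub>0 'k) module" where
  "free_on_families J M = monoid_algebra (\<Pi>\<^sub>E i\<in>J. carrier (M i))
     (\<lambda>y z. \<lambda>i\<in>J. y i \<otimes>\<^bsub>M i\<^esub> z i) (\<lambda>i\<in>J. \<one>\<^bsub>M i\<^esub>)"

definition multi_tensor ::
  "'j set \<Rightarrow> ('j \<Rightarrow> ('k::comm_ring_1, 'a) module) \<Rightarrow> ('k, (('j \<Rightarrow> 'a) \<Rightarrow>\<^sub>0 'k) set) module" where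
  "multi_tensor J M = quotient (free_on_families J M)
     (gen_submodule (free_on_families J M) (multi_relations J M))"

text \<open>
  The linear map to \<open>P\<close> out of a tensor product (binary or of a family) determined by a
  multilinear \<open>\<beta>\<close>.
\<close>

definition tensor_lift ::
  "('k::comm_ring_1, 'p) module \<Rightarrow> ('b \<Rightarrow> 'p) \<Rightarrow> ('b \<Rightarrow>\<^sub>0 'k) set \<Rightarrow> 'p" where
  "tensor_lift P \<beta> = induced (free_lift P \<beta>)"


section \<open>Hopf algebras and cleft objects\<close>

definition algebra_hom :: "('k, 'a) module \<Rightarrow> ('k, 'b) module \<Rightarrow> ('a \<Rightarrow> 'b) set" where
  "algebra_hom A B = ring_hom A B \<inter> linear_maps A B"

definition convolution ::
  "('h \<Rightarrow> ('h \<times> 'h \<Rightarrow>\<^sub>0 'k::comm_ring_1) set) \<Rightarrow> ('k, 'a) module \<Rightarrow>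
   ('h \<Rightarrow> 'a) \<Rightarrow> ('h \<Rightarrow> 'a) \<Rightarrow> 'h \<Rightarrow> 'a" where
  "convolution \<Delta> A \<phi> \<psi> h = tensor_lift A (\<lambda>(a, b). \<phi> a \<otimes>\<^bsub>A\<^esub> \<psi> b) (\<Delta> h)"

definition convolution_invertible ::
  "('k::comm_ring_1, 'h) module \<Rightarrow> ('h \<Rightarrow> ('h \<times> 'h \<Rightarrow>\<^sub>0 'k) set) \<Rightarrow> ('h \<Rightarrow> 'k) \<Rightarrow>
   ('k, 'a) module \<Rightarrow> ('h \<Rightarrow> 'a) \<Rightarrow> bool" where
  "convolution_invertible H \<Delta> \<epsilon> A \<phi> \<longleftrightarrow>
     (\<exists>\<psi>\<in>linear_maps H A. \<forall>h\<in>carrier H.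
        convolution \<Delta> A \<phi> \<psi> h = \<epsilon> h \<odot>\<^bsub>A\<^esub> \<one>\<^bsub>A\<^esub> \<and> convolution \<Delta> A \<psi> \<phi> h = \<epsilon> h \<odot>\<^bsub>A\<^esub> \<one>\<^bsub>A\<^esub>)"

text \<open>
  Coassociativity is stated in \<open>H \<otimes> (H \<otimes> H)\<close>, the associator being built into the left-hand
  side.  An antipode is a convolution inverse of the identity.
\<close>

definition hopf_algebra ::
  "('k::comm_ring_1, 'h) module \<Rightarrow> ('h \<Rightarrow> ('h \<times> 'h \<Rightarrow>\<^sub>0 'k) set) \<Rightarrow> ('h \<Rightarrow> 'k) \<Rightarrow> bool" where
  "hopf_algebra H \<Delta> \<epsilon> \<longleftrightarrow>
     k_algebra H \<and> \<Delta> \<in> algebra_hom H (tensor H H) \<and>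
     \<epsilon> \<in> ring_hom H ring_of_type_algebra \<and> (\<forall>c. \<forall>h\<in>carrier H. \<epsilon> (c \<odot>\<^bsub>H\<^esub> h) = c * \<epsilon> h) \<and>
     (\<forall>h\<in>carrier H.
        tensor_lift (tensor H (tensor H H))
          (\<lambda>(a, b). tensor_lift (tensor H (tensor H H))
             (\<lambda>(a', a''). pure_tensor H (tensor H H) a' (pure_tensor H H a'' b)) (\<Delta> a)) (\<Delta> h)
        = tensor_lift (tensor H (tensor H H)) (\<lambda>(a, b). pure_tensor H (tensor H H) a (\<Delta> b)) (\<Delta> h)) \<and>
     (\<forall>h\<in>carrier H. tensor_lift H (\<lambda>(a, b). \<epsilon> a \<odot>\<^bsub>H\<^esub> b) (\<Delta> h) = h) \<and>
     (\<forall>h\<in>carrier H. tensor_lift H (\<lambda>(a, b). \<epsilon> b \<odot>\<^bsub>H\<^esub> a) (\<Delta> h) = h) \<and>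
     convolution_invertible H \<Delta> \<epsilon> H (\<lambda>h. h)"

definition comodule_algebra ::
  "('k::comm_ring_1, 'h) module \<Rightarrow> ('h \<Rightarrow> ('h \<times> 'h \<Rightarrow>\<^sub>0 'k) set) \<Rightarrow> ('h \<Rightarrow> 'k) \<Rightarrow>
   ('k, 'a) module \<Rightarrow> ('a \<Rightarrow> ('h \<times> 'a \<Rightarrow>\<^sub>0 'k) set) \<Rightarrow> bool" where
  "comodule_algebra H \<Delta> \<epsilon> A \<rho> \<longleftrightarrow>
     k_algebra A \<and> \<rho> \<in> algebra_hom A (tensor H A) \<and>
     (\<forall>x\<in>carrier A.
        tensor_lift (tensor H (tensor H A))
          (\<lambda>(a, b). tensor_lift (tensor H (tensor H A))
             (\<lambda>(a', a''). pure_tensor H (tensor H A) a' (pure_tensor H A a'' b)) (\<Delta> a)) (\<rho> x)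
        = tensor_lift (tensor H (tensor H A)) (\<lambda>(a, b). pure_tensor H (tensor H A) a (\<rho> b)) (\<rho> x)) \<and>
     (\<forall>x\<in>carrier A. tensor_lift A (\<lambda>(a, b). \<epsilon> a \<odot>\<^bsub>A\<^esub> b) (\<rho> x) = x)"

definition is_section ::
  "('k::comm_ring_1, 'h) module \<Rightarrow> ('h \<Rightarrow> ('h \<times> 'h \<Rightarrow>\<^sub>0 'k) set) \<Rightarrow> ('h \<Rightarrow> 'k) \<Rightarrow>
   ('k, 'a) module \<Rightarrow> ('a \<Rightarrow> ('h \<times> 'a \<Rightarrow>\<^sub>0 'k) set) \<Rightarrow> ('h \<Rightarrow> 'a) \<Rightarrow> bool" where
  "is_section H \<Delta> \<epsilon> A \<rho> \<phi> \<longleftrightarrow>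
     \<phi> \<in> linear_maps H A \<and>
     convolution_invertible H \<Delta> \<epsilon> A \<phi> \<and>
     (\<forall>h\<in>carrier H. \<rho> (\<phi> h) = tensor_lift (tensor H A) (\<lambda>(a, b). pure_tensor H A a (\<phi> b)) (\<Delta> h)) \<and>
     \<phi> \<one>\<^bsub>H\<^esub> = \<one>\<^bsub>A\<^esub>"

text \<open>
  That the coinvariants are \<open>k\<close> means that the unit map is a bijection from \<open>k\<close> onto them.
\<close>

definition cleft_object ::
  "('k::comm_ring_1, 'h) module \<Rightarrow> ('h \<Rightarrow> ('h \<times> 'h \<Rightarrow>\<^sub>0 'k) set) \<Rightarrow> ('h \<Rightarrow> 'k) \<Rightarrow>
   ('k, 'a) module \<Rightarrow> ('a \<Rightarrow> ('h \<times> 'a \<Rightarrow>\<^sub>0 'k) set) \<Rightarrow> bool" where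
  "cleft_object H \<Delta> \<epsilon> A \<rho> \<longleftrightarrow>
     hopf_algebra H \<Delta> \<epsilon> \<and> comodule_algebra H \<Delta> \<epsilon> A \<rho> \<and>
     (\<exists>\<phi>. is_section H \<Delta> \<epsilon> A \<rho> \<phi>) \<and>
     bij_betw (\<lambda>c. c \<odot>\<^bsub>A\<^esub> \<one>\<^bsub>A\<^esub>) UNIV {a \<in> carrier A. \<rho> a = pure_tensor H A \<one>\<^bsub>H\<^esub> a}"


section \<open>Braid groups and their action on tensor powers\<close>

text \<open>
  A braid word is a list of letters \<open>(j, s)\<close> with \<open>j + 1 < l\<close>, standing for the generator that
  braids the (0-based) strands \<open>j\<close> and \<open>j + 1\<close> if \<open>s\<close>, and for its inverse otherwise.
\<close>

definition braid_words :: "nat \<Rightarrow> (nat \<times> bool) list set" where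
  "braid_words l = lists ({j. Suc j < l} \<times> UNIV)"

inductive braid_eq :: "nat \<Rightarrow> (nat \<times> bool) list \<Rightarrow> (nat \<times> bool) list \<Rightarrow> bool" for l where
  refl: "b \<in> braid_words l \<Longrightarrow> braid_eq l b b"
| sym: "braid_eq l b b' \<Longrightarrow> braid_eq l b' b"
| trans: "braid_eq l b b' \<Longrightarrow> braid_eq l b' b'' \<Longrightarrow> braid_eq l b b''"
| append: "braid_eq l a a' \<Longrightarrow> braid_eq l b b' \<Longrightarrow> braid_eq l (a @ b) (a' @ b')"
| cancel: "Suc j < l \<Longrightarrow> braid_eq l [(j, s), (j, \<not> s)] []"
| far: "Suc i < j \<Longrightarrow> Suc j < l \<Longrightarrow>
    braid_eq l [(i, True), (j, True)] [(j, True), (i, True)]"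
| braid: "Suc (Suc j) < l \<Longrightarrow>
    braid_eq l [(j, True), (Suc j, True), (j, True)] [(Suc j, True), (j, True), (Suc j, True)]"

text \<open>The braid group \<open>B\<^sub>l\<close>, and the group algebra \<open>kB\<^sub>l\<close>.\<close>

definition braid_group :: "nat \<Rightarrow> (nat \<times> bool) list set monoid" where
  "braid_group l =
     \<lparr>carrier = braid_words l // {(b, b'). braid_eq l b b'},
      monoid.mult = (\<lambda>C D. \<Union>a\<in>C. \<Union>b\<in>D. {c. braid_eq l (a @ b) c}),
      one = {c. braid_eq l [] c}\<rparr>"

definition braid_algebra ::
  "nat \<Rightarrow> ('k::comm_ring_1, (nat \<times> bool) list set \<Rightarrow>\<^sub>0 'k) module" where
  "braid_algebra l =
     monoid_algebra (carrier (braid_group l)) (monoid.mult (braid_group l)) (monoid.one (braid_group l))"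

text \<open>
  Generators act on monomials \<open>c x\<^sub>w\<close>, encoded as pairs \<open>(c, w)\<close>, through
  \<open>x\<^sub>i \<otimes> x\<^sub>j \<mapsto> \<chi>\<^sub>j(g\<^sub>i) x\<^sub>j \<otimes> x\<^sub>i\<close>; note that \<open>\<chi> j (- a)\<close> is the inverse of \<open>\<chi> j a\<close>.
\<close>

definition strand_action ::
  "('i \<Rightarrow> 'g::ab_group_add \<Rightarrow> 'k::comm_ring_1) \<Rightarrow> ('i \<Rightarrow> 'g) \<Rightarrow>
   nat \<times> bool \<Rightarrow> 'k \<times> 'i list \<Rightarrow> 'k \<times> 'i list" where
  "strand_action \<chi> g = (\<lambda>(j, s) (c, w).
     (c * (if s then \<chi> (w ! Suc j) (g (w ! j)) else \<chi> (w ! j) (- g (w ! Suc j))),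
      w[j := w ! Suc j, Suc j := w ! j]))"

definition braid_action ::
  "('i \<Rightarrow> 'g::ab_group_add \<Rightarrow> 'k::comm_ring_1) \<Rightarrow> ('i \<Rightarrow> 'g) \<Rightarrow>
   ((nat \<times> bool) list set \<Rightarrow>\<^sub>0 'k) \<Rightarrow> 'i list \<Rightarrow> ('i list \<Rightarrow>\<^sub>0 'k)" where
  "braid_action \<chi> g \<xi> w =
     (\<Sum>C\<in>Poly_Mapping.keys \<xi>.
        case induced (\<lambda>b. foldr (strand_action \<chi> g) b (1, w)) C of
          (c, v) \<Rightarrow> Poly_Mapping.single v (Poly_Mapping.lookup \<xi> C * c))"


section \<open>The tensor algebra, its bosonization and their coproducts\<close>

text \<open>
  \<open>Hom(\<Gamma>, k\<^sup>\<times>)\<close>; the units of \<open>k\<close> are the divisors of 1.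
\<close>

definition is_character :: "('g::ab_group_add \<Rightarrow> 'k::comm_ring_1) \<Rightarrow> bool" where
  "is_character \<psi> \<longleftrightarrow> (\<forall>a. \<psi> a dvd 1) \<and> (\<forall>a b. \<psi> (a + b) = \<psi> a * \<psi> b)"

definition word_degree :: "('i \<Rightarrow> 'g::ab_group_add) \<Rightarrow> 'i list \<Rightarrow> 'g" where
  "word_degree g w = (\<Sum>i\<leftarrow>w. g i)"

definition word_char :: "('i \<Rightarrow> 'g \<Rightarrow> 'k::comm_ring_1) \<Rightarrow> 'i list \<Rightarrow> 'g \<Rightarrow> 'k" where
  "word_char \<chi> w a = (\<Prod>i\<leftarrow>w. \<chi> i a)"

text \<open>The tensor algebra of the free module on \<open>S\<close>; the word \<open>[i\<^sub>1, \<dots>, i\<^sub>l]\<close> is \<open>x\<^sub>i\<^sub>1 \<otimes> \<dots> \<otimes> x\<^sub>i\<^sub>l\<close>.\<close>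

definition tensor_algebra :: "'i set \<Rightarrow> ('k::comm_ring_1, 'i list \<Rightarrow>\<^sub>0 'k) module" where
  "tensor_algebra S = monoid_algebra (lists S) (@) []"

definition group_algebra :: "('k::comm_ring_1, 'g::ab_group_add \<Rightarrow>\<^sub>0 'k) module" where
  "group_algebra = monoid_algebra UNIV (+) 0"

text \<open>
  \<open>TV \<otimes> TV\<close>, identified with the free module on pairs of words, with the product twisted by the
  braiding, and the coproduct of \<open>TV\<close>: the algebra map with \<open>x\<^sub>i \<mapsto> x\<^sub>i \<otimes> 1 + 1 \<otimes> x\<^sub>i\<close>.
\<close>

definition TV_square ::
  "('i \<Rightarrow> 'g::ab_group_add \<Rightarrow> 'k::comm_ring_1) \<Rightarrow> ('i \<Rightarrow> 'g) \<Rightarrow>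
   ('k, 'i list \<times> 'i list \<Rightarrow>\<^sub>0 'k) module" where
  "TV_square \<chi> g = twisted_algebra UNIV
     (\<lambda>(u, v) (u', v'). (u @ u', v @ v'))
     (\<lambda>(u, v) (u', v'). word_char \<chi> u' (word_degree g v)) ([], [])"

definition TV_coproduct ::
  "('i \<Rightarrow> 'g::ab_group_add \<Rightarrow> 'k::comm_ring_1) \<Rightarrow> ('i \<Rightarrow> 'g) \<Rightarrow>
   ('i list \<Rightarrow>\<^sub>0 'k) \<Rightarrow> ('i list \<times> 'i list \<Rightarrow>\<^sub>0 'k)" where
  "TV_coproduct \<chi> g = free_lift (TV_square \<chi> g)
     (\<lambda>w. foldr (\<lambda>i z. (Poly_Mapping.single ([i], []) 1 + Poly_Mapping.single ([], [i]) 1)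
                          \<otimes>\<^bsub>TV_square \<chi> g\<^esub> z) w \<one>\<^bsub>TV_square \<chi> g\<^esub>)"

text \<open>\<open>z\<close> is primitive in \<open>TV\<close> modulo the ideal \<open>J\<close>: its image in \<open>TV/J\<close> is primitive.\<close>

definition primitive_modulo ::
  "('i \<Rightarrow> 'g::ab_group_add \<Rightarrow> 'k::comm_ring_1) \<Rightarrow> ('i \<Rightarrow> 'g) \<Rightarrow>
   ('i list \<Rightarrow>\<^sub>0 'k) set \<Rightarrow> ('i list \<Rightarrow>\<^sub>0 'k) \<Rightarrow> bool" where
  "primitive_modulo \<chi> g J z \<longleftrightarrow>
     (let T = tensor_algebra UNIV; Q = quotient T J; p = (\<lambda>y. J +>\<^bsub>T\<^esub> y) in
      free_lift (tensor Q Q)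
        (\<lambda>(u, v). pure_tensor Q Q (p (Poly_Mapping.single u 1)) (p (Poly_Mapping.single v 1)))
        (TV_coproduct \<chi> g z)
      = pure_tensor Q Q (p z) \<one>\<^bsub>Q\<^esub> \<oplus>\<^bsub>tensor Q Q\<^esub> pure_tensor Q Q \<one>\<^bsub>Q\<^esub> (p z))"

text \<open>
  \<open>F = TV \<rtimes> \<Gamma>\<close>, free on the elements \<open>x\<^sub>w a\<close>, encoded as \<open>(w, a)\<close>, with
  \<open>x\<^sub>u a \<cdot> x\<^sub>v b = \<chi>\<^sub>v(a) x\<^sub>u x\<^sub>v (a + b)\<close>; and \<open>F \<otimes> F\<close>, free on pairs of such.
\<close>

definition F_alg ::
  "('i \<Rightarrow> 'g::ab_group_add \<Rightarrow> 'k::comm_ring_1) \<Rightarrow> ('k, 'i list \<times> 'g \<Rightarrow>\<^sub>0 'k) module" where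
  "F_alg \<chi> = twisted_algebra UNIV
     (\<lambda>(u, a) (v, b). (u @ v, a + b)) (\<lambda>(u, a) (v, b). word_char \<chi> v a) ([], 0)"

definition F_square ::
  "('i \<Rightarrow> 'g::ab_group_add \<Rightarrow> 'k::comm_ring_1) \<Rightarrow>
   ('k, ('i list \<times> 'g) \<times> ('i list \<times> 'g) \<Rightarrow>\<^sub>0 'k) module" where
  "F_square \<chi> = twisted_algebra UNIV
     (\<lambda>((u, a), (u', a')) ((v, b), (v', b')). ((u @ v, a + b), (u' @ v', a' + b')))
     (\<lambda>((u, a), (u', a')) ((v, b), (v', b')). word_char \<chi> v a * word_char \<chi> v' a')
     (([], 0), ([], 0))"

text \<open>The algebra map with \<open>x\<^sub>i \<mapsto> x\<^sub>i \<otimes> 1 + g\<^sub>i \<otimes> x\<^sub>i\<close> and \<open>a \<mapsto> a \<otimes> a\<close> for \<open>a \<in> \<Gamma>\<close>.\<close>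

definition F_coproduct ::
  "('i \<Rightarrow> 'g::ab_group_add \<Rightarrow> 'k::comm_ring_1) \<Rightarrow> ('i \<Rightarrow> 'g) \<Rightarrow>
   ('i list \<times> 'g \<Rightarrow>\<^sub>0 'k) \<Rightarrow> (('i list \<times> 'g) \<times> ('i list \<times> 'g) \<Rightarrow>\<^sub>0 'k)" where
  "F_coproduct \<chi> g = free_lift (F_square \<chi>)
     (\<lambda>(w, a). foldr
        (\<lambda>i z. (Poly_Mapping.single (([i], 0), ([], 0)) 1 + Poly_Mapping.single (([], g i), ([i], 0)) 1)
                 \<otimes>\<^bsub>F_square \<chi>\<^esub> z)
        w (Poly_Mapping.single (([], a), ([], a)) 1))"

definition F_counit :: "('i list \<times> 'g \<Rightarrow>\<^sub>0 'k::comm_ring_1) \<Rightarrow> 'k" where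
  "F_counit f = (\<Sum>(w, a)\<in>Poly_Mapping.keys f. if w = [] then Poly_Mapping.lookup f (w, a) else 0)"

definition TV_to_F ::
  "('i \<Rightarrow> 'g::ab_group_add \<Rightarrow> 'k::comm_ring_1) \<Rightarrow> ('i list \<Rightarrow>\<^sub>0 'k) \<Rightarrow> ('i list \<times> 'g \<Rightarrow>\<^sub>0 'k)" where
  "TV_to_F \<chi> = free_lift (F_alg \<chi>) (\<lambda>w. Poly_Mapping.single (w, 0) 1)"

definition Gamma_to_F ::
  "('i \<Rightarrow> 'g::ab_group_add \<Rightarrow> 'k::comm_ring_1) \<Rightarrow> ('g \<Rightarrow>\<^sub>0 'k) \<Rightarrow> ('i list \<times> 'g \<Rightarrow>\<^sub>0 'k)" where
  "Gamma_to_F \<chi> = free_lift (F_alg \<chi>) (\<lambda>a. Poly_Mapping.single ([], a) 1)"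

definition ad_c ::
  "('i \<Rightarrow> 'g::ab_group_add \<Rightarrow> 'k::comm_ring_1) \<Rightarrow> ('i \<Rightarrow> 'g) \<Rightarrow> 'i \<Rightarrow> 'i \<Rightarrow> ('i list \<Rightarrow>\<^sub>0 'k)" where
  "ad_c \<chi> g i j = Poly_Mapping.single [i, j] 1 - Poly_Mapping.single [j, i] (\<chi> j (g i))"


section \<open>The algebras and maps of the statement\<close>

text \<open>The partition of the index set is given by \<open>blk\<close>, where \<open>blk i\<close> is \<open>|i|\<close>.\<close>

definition Theta :: "('i \<Rightarrow> nat) \<Rightarrow> ('i \<times> 'i) set" where
  "Theta blk = {(i, j). blk i > blk j}"

definition Xi ::
  "('i \<Rightarrow> 'g \<Rightarrow> 'k::comm_ring_1) \<Rightarrow> ('i \<Rightarrow> nat) \<Rightarrow> ('i \<times> 'i) set" where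
  "Xi \<chi> blk = {(i, j) \<in> Theta blk. \<forall>a. \<chi> i a * \<chi> j a = 1}"

text \<open>\<open>z = \<xi>(x\<^sub>i\<^sub>1 \<otimes> \<dots> \<otimes> x\<^sub>i\<^sub>l)\<close> for some \<open>l \<ge> 2\<close>, \<open>\<xi> \<in> kB\<^sub>l\<close> and \<open>|i\<^sub>1| = \<dots> = |i\<^sub>l| = r\<close>.\<close>

definition braided_element ::
  "('i \<Rightarrow> 'g::ab_group_add \<Rightarrow> 'k::comm_ring_1) \<Rightarrow> ('i \<Rightarrow> 'g) \<Rightarrow> ('i \<Rightarrow> nat) \<Rightarrow> nat \<Rightarrow>
   ('i list \<Rightarrow>\<^sub>0 'k) \<Rightarrow> bool" where
  "braided_element \<chi> g blk r z \<longleftrightarrow>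
     (\<exists>l \<xi> w. l \<ge> 2 \<and> \<xi> \<in> carrier (braid_algebra l) \<and> length w = l \<and> (\<forall>i\<in>set w. blk i = r) \<and>
        z = braid_action \<chi> g \<xi> w)"

definition block_relations ::
  "('i \<Rightarrow> 'g::ab_group_add \<Rightarrow> 'k::comm_ring_1) \<Rightarrow> ('i \<Rightarrow> 'g) \<Rightarrow> ('i \<Rightarrow> nat) \<Rightarrow>
   ('i list \<Rightarrow>\<^sub>0 'k) set \<Rightarrow> nat \<Rightarrow> ('i list \<Rightarrow>\<^sub>0 'k) set" where
  "block_relations \<chi> g blk R r = {z \<in> R. braided_element \<chi> g blk r z}"

definition H0_ideal ::
  "('i \<Rightarrow> 'g::ab_group_add \<Rightarrow> 'k::comm_ring_1) \<Rightarrow> ('i \<Rightarrow> 'g) \<Rightarrow> ('i \<Rightarrow> nat) \<Rightarrow>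
   ('i list \<Rightarrow>\<^sub>0 'k) set \<Rightarrow> ('i list \<times> 'g \<Rightarrow>\<^sub>0 'k) set" where
  "H0_ideal \<chi> g blk R = genideal (F_alg \<chi>)
     (TV_to_F \<chi> ` R \<union> {TV_to_F \<chi> (ad_c \<chi> g i j) | i j. (i, j) \<in> Theta blk})"

text \<open>
  A family \<open>\<lambda> \<in> k\<^sup>\<Xi>\<close> is a function on all pairs of which only the values on \<open>\<Xi>\<close> are used;
  \<^term>\<open>ext_by_zero S lam\<close> is its extension by zero.
\<close>

definition ext_by_zero :: "'c set \<Rightarrow> ('c \<Rightarrow> 'k) \<Rightarrow> 'c \<Rightarrow> 'k::comm_ring_1" where
  "ext_by_zero S lam p = (if p \<in> S then lam p else 0)"

definition A_ideal ::
  "('i \<Rightarrow> 'g::ab_group_add \<Rightarrow> 'k::comm_ring_1) \<Rightarrow> ('i \<Rightarrow> 'g) \<Rightarrow> ('i \<Rightarrow> nat) \<Rightarrow>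
   ('i list \<Rightarrow>\<^sub>0 'k) set \<Rightarrow> ('i \<times> 'i \<Rightarrow> 'k) \<Rightarrow> ('i list \<times> 'g \<Rightarrow>\<^sub>0 'k) set" where
  "A_ideal \<chi> g blk R lam = genideal (F_alg \<chi>)
     (TV_to_F \<chi> ` R \<union>
      {TV_to_F \<chi> (ad_c \<chi> g i j)
         - Poly_Mapping.single ([], g i + g j) (ext_by_zero (Xi \<chi> blk) lam (i, j))
       | i j. (i, j) \<in> Theta blk})"

definition H0_alg ::
  "('i \<Rightarrow> 'g::ab_group_add \<Rightarrow> 'k::comm_ring_1) \<Rightarrow> ('i \<Rightarrow> 'g) \<Rightarrow> ('i \<Rightarrow> nat) \<Rightarrow>
   ('i list \<Rightarrow>\<^sub>0 'k) set \<Rightarrow> ('k, ('i list \<times> 'g \<Rightarrow>\<^sub>0 'k) set) module" where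
  "H0_alg \<chi> g blk R = quotient (F_alg \<chi>) (H0_ideal \<chi> g blk R)"

definition A_alg ::
  "('i \<Rightarrow> 'g::ab_group_add \<Rightarrow> 'k::comm_ring_1) \<Rightarrow> ('i \<Rightarrow> 'g) \<Rightarrow> ('i \<Rightarrow> nat) \<Rightarrow>
   ('i list \<Rightarrow>\<^sub>0 'k) set \<Rightarrow> ('i \<times> 'i \<Rightarrow> 'k) \<Rightarrow> ('k, ('i list \<times> 'g \<Rightarrow>\<^sub>0 'k) set) module" where
  "A_alg \<chi> g blk R lam = quotient (F_alg \<chi>) (A_ideal \<chi> g blk R lam)"

text \<open>The map \<open>F/I' \<rightarrow> F/I \<otimes> F/I'\<close> induced by the coproduct of \<open>F\<close>.\<close>

definition induced_coproduct ::
  "('i \<Rightarrow> 'g::ab_group_add \<Rightarrow> 'k::comm_ring_1) \<Rightarrow> ('i \<Rightarrow> 'g) \<Rightarrow>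
   ('i list \<times> 'g \<Rightarrow>\<^sub>0 'k) set \<Rightarrow> ('i list \<times> 'g \<Rightarrow>\<^sub>0 'k) set \<Rightarrow> ('i list \<times> 'g \<Rightarrow>\<^sub>0 'k) set \<Rightarrow>
   (('i list \<times> 'g \<Rightarrow>\<^sub>0 'k) set \<times> ('i list \<times> 'g \<Rightarrow>\<^sub>0 'k) set \<Rightarrow>\<^sub>0 'k) set" where
  "induced_coproduct \<chi> g I I' =
     (let F = F_alg \<chi>; H = quotient F I; A = quotient F I' in
      induced (\<lambda>f. free_lift (tensor H A)
        (\<lambda>(b, c). pure_tensor H A (I +>\<^bsub>F\<^esub> Poly_Mapping.single b 1) (I' +>\<^bsub>F\<^esub> Poly_Mapping.single c 1))
        (F_coproduct \<chi> g f)))"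

definition H0_coproduct where
  "H0_coproduct \<chi> g blk R = induced_coproduct \<chi> g (H0_ideal \<chi> g blk R) (H0_ideal \<chi> g blk R)"

definition H0_counit ::
  "('i list \<times> 'g \<Rightarrow>\<^sub>0 'k::comm_ring_1) set \<Rightarrow> 'k" where
  "H0_counit = induced F_counit"

definition A_coaction where
  "A_coaction \<chi> g blk R lam = induced_coproduct \<chi> g (H0_ideal \<chi> g blk R) (A_ideal \<chi> g blk R lam)"

text \<open>\<open>TV\<^sub>r/(\<R>\<^sub>r)\<close> for the block \<open>r\<close>, and \<open>E = (\<Otimes>\<^sub>r TV\<^sub>r/(\<R>\<^sub>r)) \<otimes> k\<Gamma>\<close>.\<close>

definition block_algebra ::
  "('i \<Rightarrow> 'g::ab_group_add \<Rightarrow> 'k::comm_ring_1) \<Rightarrow> ('i \<Rightarrow> 'g) \<Rightarrow> ('i \<Rightarrow> nat) \<Rightarrow>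
   ('i list \<Rightarrow>\<^sub>0 'k) set \<Rightarrow> nat \<Rightarrow> ('k, ('i list \<Rightarrow>\<^sub>0 'k) set) module" where
  "block_algebra \<chi> g blk R r =
     (let T = tensor_algebra {i. blk i = r} in
      quotient T (genideal T (block_relations \<chi> g blk R r)))"

definition E_mod ::
  "('i \<Rightarrow> 'g::ab_group_add \<Rightarrow> 'k::comm_ring_1) \<Rightarrow> ('i \<Rightarrow> 'g) \<Rightarrow> ('i \<Rightarrow> nat) \<Rightarrow> nat \<Rightarrow>
   ('i list \<Rightarrow>\<^sub>0 'k) set \<Rightarrow>
   ('k, (((nat \<Rightarrow> ('i list \<Rightarrow>\<^sub>0 'k) set) \<Rightarrow>\<^sub>0 'k) set \<times> ('g \<Rightarrow>\<^sub>0 'k) \<Rightarrow>\<^sub>0 'k) set) module" where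
  "E_mod \<chi> g blk N R = tensor (multi_tensor {1..N} (block_algebra \<chi> g blk R)) group_algebra"

text \<open>\<open>y\<^sub>1 \<otimes> \<dots> \<otimes> y\<^sub>N \<otimes> a \<mapsto> y\<^sub>1 \<cdots> y\<^sub>N a\<close>.\<close>

definition e_map ::
  "('i \<Rightarrow> 'g::ab_group_add \<Rightarrow> 'k::comm_ring_1) \<Rightarrow> ('i \<Rightarrow> 'g) \<Rightarrow> ('i \<Rightarrow> nat) \<Rightarrow> nat \<Rightarrow>
   ('i list \<Rightarrow>\<^sub>0 'k) set \<Rightarrow> ('i \<times> 'i \<Rightarrow> 'k) \<Rightarrow>
   (((nat \<Rightarrow> ('i list \<Rightarrow>\<^sub>0 'k) set) \<Rightarrow>\<^sub>0 'k) set \<times> ('g \<Rightarrow>\<^sub>0 'k) \<Rightarrow>\<^sub>0 'k) set \<Rightarrow>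
   ('i list \<times> 'g \<Rightarrow>\<^sub>0 'k) set" where
  "e_map \<chi> g blk N R lam =
     (let A = A_alg \<chi> g blk R lam;
          p = (\<lambda>f. A_ideal \<chi> g blk R lam +>\<^bsub>F_alg \<chi>\<^esub> f);
          can = induced (\<lambda>y. p (TV_to_F \<chi> y))
      in tensor_lift A (\<lambda>(t, z).
           tensor_lift A (\<lambda>y. foldr (\<lambda>r s. can (y r) \<otimes>\<^bsub>A\<^esub> s) [1..<Suc N] \<one>\<^bsub>A\<^esub>) t
           \<otimes>\<^bsub>A\<^esub> p (Gamma_to_F \<chi> z)))"

definition phi_map ::
  "('i \<Rightarrow> 'g::ab_group_add \<Rightarrow> 'k::comm_ring_1) \<Rightarrow> ('i \<Rightarrow> 'g) \<Rightarrow> ('i \<Rightarrow> nat) \<Rightarrow> nat \<Rightarrow>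
   ('i list \<Rightarrow>\<^sub>0 'k) set \<Rightarrow> ('i \<times> 'i \<Rightarrow> 'k) \<Rightarrow>
   ('i list \<times> 'g \<Rightarrow>\<^sub>0 'k) set \<Rightarrow> ('i list \<times> 'g \<Rightarrow>\<^sub>0 'k) set" where
  "phi_map \<chi> g blk N R lam =
     e_map \<chi> g blk N R lam \<circ> inv_into (carrier (E_mod \<chi> g blk N R)) (e_map \<chi> g blk N R (\<lambda>_. 0))"

end

theory Submission
  imports Defs
begin

text \<open>
  Call a word normal if its letters are sorted by block, and let \<open>NN\<close> be the span in \<open>F\<close> of the normal words
  times group elements.  Straightening a word by the relations \<open>(ad x\<^sub>i)(x\<^sub>j) = \<lambda>\<^sub>i\<^sub>j g\<^sub>i g\<^sub>j\<close> is confluent, so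
  \<open>F = I' \<oplus> NN\<close> for the ideal \<open>I'\<close> they generate.  A relation \<open>z \<in> \<R>\<close> of one block commutes, up to a
  character and modulo \<open>I'\<close>, with a generator of another block, except for a term in the skew derivatives of
  \<open>z\<close>; as \<open>z\<close> is primitive modulo the previous stage of the chain, that term lies in the ideal of that stage.
  By induction along the chain, the defining ideal of \<open>A(\<lambda>)\<close> meets \<open>NN\<close> in one and the same submodule \<open>K\<close>,
  spanned by the \<open>p z s\<close> with \<open>p s\<close> normal and \<open>z\<close> in its proper place.  Hence \<open>e(\<lambda>)\<close> identifies \<open>E\<close> with
  \<open>NN / K\<close> for every \<open>\<lambda>\<close>, and \<open>\<phi>(\<lambda>)\<close> is the identity of \<open>NN / K\<close>.  It is colinear because \<open>NN\<close> is a
  subcoalgebra of \<open>F\<close>, and its convolution inverse is induced by the antipode of \<open>F\<close>, which preserves the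
  ideal generated by \<open>\<R>\<close>.
\<close>

section \<open>Free modules\<close>

text \<open>Over a commutative ring nothing guarantees that \<open>E\<close>, \<open>H^0\<close> or
  \<open>A(\<lambda>)\<close> is free or flat, so neither a dimension count nor an exactness
  argument is at hand. Computations are therefore made in the free modules \<open>F\<close> and
  \<open>F \<otimes> F\<close>, and maps out of quotients and tensor products are evaluated on
  representatives.

  Primitivity modulo a stage is an equation in a tensor square of a quotient; it is lifted to
  \<open>TV \<otimes> TV\<close> modulo \<open>J \<otimes> TV + TV \<otimes> J\<close>. From there
  it serves three times: its component ending in a single letter places the skew derivatives in the
  previous ideal, the full equation makes the coaction well defined, and multiplication after
  \<open>S \<otimes> id\<close> shows that \<open>S\<close> preserves the ideal of \<open>R\<close>.

  The section and its convolution inverse need not respect products, so they cannot be obtained by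
  checking relations. They are prescribed on normal words only, which suffices since
  \<open>\<Delta>\<close> maps \<open>NN\<close> into \<open>NN \<otimes> NN\<close>. The inverse is
  well defined because \<open>K\<close> lies in the ideal of \<open>R\<close> alone, which contains
  no \<open>\<lambda>\<close>.\<close>

abbreviation "single \<equiv> Poly_Mapping.single"
abbreviation "keys \<equiv> Poly_Mapping.keys"
abbreviation "lookup \<equiv> Poly_Mapping.lookup"

abbreviation scale :: "'k::comm_ring_1 \<Rightarrow> ('b \<Rightarrow>\<^sub>0 'k) \<Rightarrow> ('b \<Rightarrow>\<^sub>0 'k)" where
  "scale c \<equiv> Poly_Mapping.map ((*) c)"

lemma lookup_scale [simp]: "lookup (scale c f) b = c * lookup f b"
  by (transfer) (auto simp: when_def)

lemma scale_single [simp]: "scale c (single b x) = single b (c * x)"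
  by simp

lemma scale_module: "Modules.module scale"
  by unfold_locales (auto intro!: poly_mapping_eqI simp: lookup_add algebra_simps)

text \<open>Free modules are handled by the type-based module library, which supplies spans and
  subspaces; the record-based modules of the statement enter with quotients and tensor
  products.\<close>

global_interpretation pm: Modules.module scale
  by (rule scale_module)

abbreviation plin :: "(('b \<Rightarrow>\<^sub>0 'k::comm_ring_1) \<Rightarrow> ('c \<Rightarrow>\<^sub>0 'k)) \<Rightarrow> bool" where
  "plin \<equiv> module_hom scale scale"

lemma plinI:
  assumes "\<And>f h. T (f + h) = T f + T h" "\<And>c f. T (scale c f) = scale c (T f)"
  shows "plin T"
  using assms by (simp add: module_hom_def module_hom_axioms_def scale_module)

lemmas plin_add = module_hom.add[where ?s1.0 = scale and ?s2.0 = scale]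
  and plin_scale = module_hom.scale[where ?s1.0 = scale and ?s2.0 = scale]
  and plin_zero = module_hom.zero[where ?s1.0 = scale and ?s2.0 = scale]
  and plin_diff = module_hom.diff[where ?s1.0 = scale and ?s2.0 = scale]
  and plin_sum = module_hom.sum[where ?s1.0 = scale and ?s2.0 = scale]

lemma pm_expand: "f = (\<Sum>b\<in>keys f. single b (lookup f b))"
  by (rule poly_mapping_eqI)
    (auto simp: lookup_sum lookup_single when_def in_keys_iff)

text \<open>The step keeps the support condition for both summands, so that maps known to be linear
  only on the span of \<open>B\<close> can be treated as well.\<close>

lemma keys_induct [consumes 1, case_names zero single add]:
  assumes "keys f \<subseteq> B"
    and "P 0" and "\<And>b c. b \<in> B \<Longrightarrow> P (single b c)"
    and add: "\<And>f h. keys f \<subseteq> B \<Longrightarrow> keys h \<subseteq> B \<Longrightarrow> P f \<Longrightarrow> P h \<Longrightarrow> P (f + h)"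
  shows "P (f :: 'b \<Rightarrow>\<^sub>0 'k::comm_monoid_add)"
proof -
  have "P (\<Sum>b\<in>S. single b (lookup f b)) \<and>
    keys (\<Sum>b\<in>S. single b (lookup f b)) \<subseteq> B"
    if "finite S" "S \<subseteq> keys f" for S
    using that
  proof (induction S)
    case empty
    then show ?case using assms by simp
  next
    case (insert x S)
    have "x \<in> B" using insert assms(1) by auto
    then have k: "keys (single x (lookup f x)) \<subseteq> B"
      by simp
    have IH: "P (\<Sum>b\<in>S. single b (lookup f b))"
      "keys (\<Sum>b\<in>S. single b (lookup f b)) \<subseteq> B"
      using insert by auto
    show ?case
      using add[OF k IH(2) assms(3)[OF \<open>x \<in> B\<close>] IH(1)] insert
        subset_trans[OF keys_add Un_least[OF k IH(2)]] by simp
  qed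
  from this[of "keys f"] show ?thesis
    by (simp add: pm_expand[symmetric])
qed

lemma plin_eqI:
  assumes "plin S" "plin T" "\<And>b. b \<in> B \<Longrightarrow> S (single b 1) = T (single b 1)"
    and "keys f \<subseteq> B"
  shows "S f = T f"
  using assms(4)
proof (induction rule: keys_induct)
  case (single b c)
  have "single b c = scale c (single b 1)" by simp
  with assms(3)[OF single] show ?case
    by (metis plin_scale[OF assms(1)] plin_scale[OF assms(2)])
qed (simp_all add: plin_zero[OF assms(1)] plin_zero[OF assms(2)] plin_add[OF assms(1)] plin_add[OF assms(2)])

lemma plin_eq:
  assumes "plin S" "plin T" "\<And>b. S (single b 1) = T (single b 1)"
  shows "S f = T f"
  using plin_eqI[OF assms(1,2), of UNIV] assms(3) by blast

lemma plin_eq2: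
  assumes "\<And>h. plin (\<lambda>f. S f h)" "\<And>h. plin (\<lambda>f. T f h)" "\<And>f. plin (S f)" "\<And>f. plin (T f)"
    and "\<And>b c. S (single b 1) (single c 1) = T (single b 1) (single c 1)"
  shows "S f h = T f h"
  by (rule plin_eq[OF assms(1,2)], rule plin_eq[OF assms(3,4)], rule assms(5))

lemma plin_span:
  assumes "plin T" "x \<in> pm.span S" "\<And>s. s \<in> S \<Longrightarrow> T s \<in> V" "pm.subspace V"
  shows "T x \<in> V"
  using assms(2)
proof (induction rule: pm.span_induct)
  case base
  show ?case
    by (rule pm.subspaceI)
      (auto simp: plin_zero[OF assms(1)] plin_add[OF assms(1)] plin_scale[OF assms(1)]
        intro: pm.subspace_0 pm.subspace_add pm.subspace_scale assms(4))
qed (use assms in auto)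

lemma plin_in:
  assumes "plin T" "pm.subspace V" "keys f \<subseteq> B" "\<And>b. b \<in> B \<Longrightarrow> T (single b 1) \<in> V"
  shows "T f \<in> V"
  using assms(3)
proof (induction rule: keys_induct)
  case (single b c)
  have "single b c = scale c (single b 1)" by simp
  then show ?case using pm.subspace_scale[OF assms(2) assms(4)[OF single], of c]
    by (metis plin_scale[OF assms(1)])
qed (simp_all add: plin_zero[OF assms(1)] plin_add[OF assms(1)] pm.subspace_0 pm.subspace_add assms(2))

lemma plin_compose: "plin S \<Longrightarrow> plin T \<Longrightarrow> plin (\<lambda>x. S (T x))"
  by (rule plinI) (simp_all add: plin_add plin_scale)

lemma plin_id: "plin (\<lambda>x. x)"
  by (rule plinI) simp_all

lemma plin_const_scale: "plin T \<Longrightarrow> plin (\<lambda>x. scale c (T x))"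
  by (rule plinI) (simp_all add: plin_add plin_scale pm.scale_right_distrib mult.commute)

lemma plin_plus: "plin S \<Longrightarrow> plin T \<Longrightarrow> plin (\<lambda>x. S x + T x)"
  by (rule plinI) (simp_all add: plin_add plin_scale pm.scale_right_distrib)

lemma plin_minus: "plin S \<Longrightarrow> plin T \<Longrightarrow> plin (\<lambda>x. S x - T x)"
  by (rule plinI) (simp_all add: plin_add plin_scale pm.scale_right_diff_distrib)

lemma plin_null: "plin (\<lambda>x. 0)"
  by (rule plinI) simp_all

lemma plin_setsum: "(\<And>i. i \<in> A \<Longrightarrow> plin (T i)) \<Longrightarrow> plin (\<lambda>x. \<Sum>i\<in>A. T i x)"
  by (induction A rule: infinite_finite_induct) (auto intro: plin_plus plin_null)

text \<open>Agrees with \<open>free_lift\<close> into the full free module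
  (\<open>free_lift_lin\<close>), but is written with the sum of the type class instead of
  \<open>finsum\<close>.\<close>

definition lin :: "('b \<Rightarrow> ('c \<Rightarrow>\<^sub>0 'k)) \<Rightarrow> ('b \<Rightarrow>\<^sub>0 'k::comm_ring_1) \<Rightarrow> ('c \<Rightarrow>\<^sub>0 'k)" where
  "lin \<beta> f = (\<Sum>b\<in>keys f. scale (lookup f b) (\<beta> b))"

lemma lin_superset:
  assumes "finite S" "keys f \<subseteq> S"
  shows "lin \<beta> f = (\<Sum>b\<in>S. scale (lookup f b) (\<beta> b))"
  unfolding lin_def using assms by (intro sum.mono_neutral_left) (auto simp: in_keys_iff)

lemma lin_plin: "plin (lin (\<beta> :: 'b \<Rightarrow> 'c \<Rightarrow>\<^sub>0 'k::comm_ring_1))"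
proof (rule plinI)
  fix f h :: "'b \<Rightarrow>\<^sub>0 'k"
  let ?S = "keys f \<union> keys h"
  have "finite ?S" by simp
  then show "lin \<beta> (f + h) = lin \<beta> f + lin \<beta> h"
    using keys_add[of f h]
    by (simp add: lin_superset[of ?S] lookup_add pm.scale_left_distrib sum.distrib)
next
  fix c and f :: "'b \<Rightarrow>\<^sub>0 'k"
  have "keys (scale c f) \<subseteq> keys f" by (auto simp: in_keys_iff)
  then show "lin \<beta> (scale c f) = scale c (lin \<beta> f)"
    by (simp add: lin_superset[of "keys f"] pm.scale_sum_right)
qed

lemma lin_single [simp]: "lin \<beta> (single b c) = scale c (\<beta> b)"
  using lin_superset[of "{b}" "single b c" \<beta>] by (auto split: if_splits)

lemmas lin_add = plin_add[OF lin_plin] and lin_scale = plin_scale[OF lin_plin]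
  and lin_zero = plin_zero[OF lin_plin]

lemma keys_scale: "keys (scale c f) \<subseteq> keys f"
  by (auto simp: in_keys_iff)

lemma keys_subspace: "pm.subspace {f. keys f \<subseteq> B}"
  by (rule pm.subspaceI) (auto dest: subsetD[OF keys_add] subsetD[OF keys_scale])

definition tmul :: "('b \<Rightarrow> 'b \<Rightarrow> 'b) \<Rightarrow> ('b \<Rightarrow> 'b \<Rightarrow> 'k) \<Rightarrow> ('b \<Rightarrow>\<^sub>0 'k::comm_ring_1) \<Rightarrow> ('b \<Rightarrow>\<^sub>0 'k) \<Rightarrow> ('b \<Rightarrow>\<^sub>0 'k)" where
  "tmul m t f h = lin (\<lambda>b. lin (\<lambda>c. single (m b c) (t b c)) h) f"

lemma tmul_left: "plin (\<lambda>f. tmul m t f h)"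
  unfolding tmul_def by (rule lin_plin)

lemma tmul_right: "plin (tmul m t f)"
proof -
  \<comment> \<open>For fixed \<open>f\<close> the outer sum is a fixed finite combination of linear
    maps in \<open>h\<close>.\<close>
  have eq: "tmul m t f = (\<lambda>h. \<Sum>b\<in>keys f. scale (lookup f b)
      (lin (\<lambda>c. single (m b c) (t b c)) h))"
    by (rule ext) (simp add: tmul_def lin_def[of "\<lambda>b. lin (\<lambda>c. single (m b c) (t b c)) _"])
  show ?thesis unfolding eq by (intro plin_setsum plin_const_scale lin_plin)
qed

lemma tmul_single [simp]:
  "tmul m t (single b x) (single c y) = single (m b c) (x * y * t b c)"
  by (simp add: tmul_def mult.assoc)

lemma twisted_simps [simp]:
  "carrier (twisted_algebra B m t e) = {f. keys f \<subseteq> B}"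
  "monoid.one (twisted_algebra B m t e) = single e 1"
  "ring.zero (twisted_algebra B m t e) = 0"
  "ring.add (twisted_algebra B m t e) = (+)"
  "module.smult (twisted_algebra B m t e) = scale"
  "monoid.mult (twisted_algebra B m t e) = tmul m t"
  by (auto simp: twisted_algebra_def tmul_def lin_def pm.scale_sum_right mult.assoc intro!: ext)

text \<open>On basis elements associativity amounts to associativity of \<open>m\<close> together
  with the 2-cocycle identity for \<open>t\<close>; trilinearity does the rest.\<close>

lemma tmul_assoc:
  assumes "\<And>b c d. b \<in> B \<Longrightarrow> c \<in> B \<Longrightarrow> d \<in> B \<Longrightarrow> m (m b c) d = m b (m c d)"
    and "\<And>b c d. b \<in> B \<Longrightarrow> c \<in> B \<Longrightarrow> d \<in> B \<Longrightarrow> t b c * t (m b c) d = t c d * t b (m c d)"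
    and "keys f \<subseteq> B" "keys h \<subseteq> B" "keys l \<subseteq> B"
  shows "tmul m t (tmul m t f h) l = tmul m t f (tmul m t h l)"
proof (rule plin_eqI[OF _ _ _ assms(3)])
  show "plin (\<lambda>f. tmul m t (tmul m t f h) l)"
    by (rule plin_compose[OF tmul_left tmul_left])
  show "plin (\<lambda>f. tmul m t f (tmul m t h l))"
    by (rule tmul_left)
  fix b assume b: "b \<in> B"
  show "tmul m t (tmul m t (single b 1) h) l = tmul m t (single b 1) (tmul m t h l)"
  proof (rule plin_eqI[OF _ _ _ assms(4)])
    show "plin (\<lambda>h. tmul m t (tmul m t (single b 1) h) l)"
      by (rule plin_compose[OF tmul_left tmul_right])
    show "plin (\<lambda>h. tmul m t (single b 1) (tmul m t h l))"
      by (rule plin_compose[OF tmul_right tmul_left])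
    fix c assume c: "c \<in> B"
    show "tmul m t (tmul m t (single b 1) (single c 1)) l =
        tmul m t (single b 1) (tmul m t (single c 1) l)"
      by (rule plin_eqI[OF _ _ _ assms(5)])
        (auto intro!: tmul_right plin_compose[OF tmul_right tmul_right] simp: assms b c)
  qed
qed

lemma tmul_keys:
  assumes "\<And>b c. b \<in> B \<Longrightarrow> c \<in> B \<Longrightarrow> m b c \<in> B"
    and "keys f \<subseteq> B" "keys h \<subseteq> B"
  shows "keys (tmul m t f h) \<subseteq> B"
proof -
  have "tmul m t f h \<in> {f. keys f \<subseteq> B}"
  proof (rule plin_in[OF tmul_left keys_subspace assms(2)])
    fix b assume "b \<in> B"
    then show "tmul m t (single b 1) h \<in> {f. keys f \<subseteq> B}"
      by (intro plin_in[OF tmul_right keys_subspace assms(3)]) (auto simp: assms)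
  qed
  then show ?thesis by simp
qed

section \<open>Modules and algebras as records\<close>

lemma rta_simps [simp]:
  "carrier (ring_of_type_algebra :: 'k::comm_ring_1 ring) = UNIV"
  "(monoid.mult (ring_of_type_algebra :: 'k ring)) = (*)"
  "monoid.one (ring_of_type_algebra :: 'k ring) = 1"
  "ring.zero (ring_of_type_algebra :: 'k ring) = 0"
  "ring.add (ring_of_type_algebra :: 'k ring) = (+)"
  by (auto simp: ring_of_type_algebra_def)

locale kmodule = fixes M :: "('k::comm_ring_1, 'a) module" (structure)
  assumes kmod: "module ring_of_type_algebra M"
begin

sublocale abelian_group M
  using kmod unfolding module_def by blast

lemma smul_closed [simp, intro]: "x \<in> carrier M \<Longrightarrow> c \<odot> x \<in> carrier M"
  using module.smult_closed[OF kmod] by simp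
lemma smul_ldistr: "x \<in> carrier M \<Longrightarrow> (c + d) \<odot> x = c \<odot> x \<oplus> d \<odot> x"
  using module.smult_l_distr[OF kmod] by simp
lemma smul_rdistr: "x \<in> carrier M \<Longrightarrow> y \<in> carrier M \<Longrightarrow> c \<odot> (x \<oplus> y) = c \<odot> x \<oplus> c \<odot> y"
  using module.smult_r_distr[OF kmod] by simp
lemma smul_assoc: "x \<in> carrier M \<Longrightarrow> (c * d) \<odot> x = c \<odot> (d \<odot> x)"
  using module.smult_assoc1[OF kmod] by simp
lemma smul_one [simp]: "x \<in> carrier M \<Longrightarrow> 1 \<odot> x = x"
  using module.smult_one[OF kmod] by simp
lemma smul_zero_left [simp]: "x \<in> carrier M \<Longrightarrow> 0 \<odot> x = \<zero>"
  using module.smult_l_null[OF kmod] by simp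
lemma smul_zero_right [simp]: "c \<odot> \<zero> = \<zero>"
  using module.smult_r_null[OF kmod] by simp
lemma smul_neg: "x \<in> carrier M \<Longrightarrow> (- 1) \<odot> x = \<ominus> x"
  using smul_ldistr[of x "-1" 1] by (simp add: minus_equality)

end

text \<open>The scalar \<open>-1\<close> supplies additive inverses, so the group axioms follow from
  the scalar laws.\<close>

lemma kmoduleI:
  fixes M (structure)
  assumes "\<And>x y. x \<in> carrier M \<Longrightarrow> y \<in> carrier M \<Longrightarrow> x \<oplus> y \<in> carrier M"
    and "\<zero> \<in> carrier M"
    and "\<And>x c. x \<in> carrier M \<Longrightarrow> c \<odot> x \<in> carrier M"
    and "\<And>x y z. x \<in> carrier M \<Longrightarrow> y \<in> carrier M \<Longrightarrow> z \<in> carrier M \<Longrightarrow> (x \<oplus> y) \<oplus> z = x \<oplus> (y \<oplus> z)"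
    and "\<And>x y. x \<in> carrier M \<Longrightarrow> y \<in> carrier M \<Longrightarrow> x \<oplus> y = y \<oplus> x"
    and "\<And>x. x \<in> carrier M \<Longrightarrow> \<zero> \<oplus> x = x"
    and d: "\<And>x c d. x \<in> carrier M \<Longrightarrow> (c + d) \<odot> x = c \<odot> x \<oplus> d \<odot> x"
    and "\<And>x y c. x \<in> carrier M \<Longrightarrow> y \<in> carrier M \<Longrightarrow> c \<odot> (x \<oplus> y) = c \<odot> x \<oplus> c \<odot> y"
    and "\<And>x c d. x \<in> carrier M \<Longrightarrow> (c * d) \<odot> x = c \<odot> (d \<odot> x)"
    and o: "\<And>x. x \<in> carrier M \<Longrightarrow> 1 \<odot> x = x"
    and z: "\<And>x. x \<in> carrier M \<Longrightarrow> 0 \<odot> x = \<zero>"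
  shows "kmodule (M :: ('k::comm_ring_1, 'a) module)"
proof (rule kmodule.intro)
  have neg: "(- 1) \<odot> x \<oplus> x = \<zero>" if "x \<in> carrier M" for x
    using d[OF that, of "-1" 1] o[OF that] z[OF that] by simp
  have "abelian_group M"
  proof (rule abelian_groupI)
    fix x assume "x \<in> carrier M"
    then show "\<exists>y\<in>carrier M. y \<oplus> x = \<zero>" using neg assms(3) by blast
  qed (fact assms(1,2,4,5,6))+
  then show "module ring_of_type_algebra M"
    by (rule moduleI[OF comm_ring_1_class.cring_from_type_algebra]) (simp_all add: assms(3,7,8,9,10))
qed

locale kalgebra = fixes A :: "('k::comm_ring_1, 'a) module" (structure)
  assumes kalg: "k_algebra A"
begin

sublocale kmodule A
  by (rule kmodule.intro) (use kalg in \<open>simp add: k_algebra_def\<close>)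
sublocale ring A
  using kalg unfolding k_algebra_def by blast

lemma smul_mult_left: "x \<in> carrier A \<Longrightarrow> y \<in> carrier A \<Longrightarrow> (c \<odot> x) \<otimes> y = c \<odot> (x \<otimes> y)"
  using kalg by (auto simp: k_algebra_def)
lemma smul_mult_right: "x \<in> carrier A \<Longrightarrow> y \<in> carrier A \<Longrightarrow> x \<otimes> (c \<odot> y) = c \<odot> (x \<otimes> y)"
  using kalg by (auto simp: k_algebra_def)

end

lemma twisted_kmodule [simp]: "kmodule (twisted_algebra B m t e)"
  by (rule kmoduleI)
    (auto simp: pm.scale_right_distrib pm.scale_left_distrib add.assoc add.commute
      dest: subsetD[OF keys_add] subsetD[OF keys_scale])

lemma twisted_kalgebra:
  assumes "\<And>b c. b \<in> B \<Longrightarrow> c \<in> B \<Longrightarrow> m b c \<in> B" "e \<in> B"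
    and "\<And>b c d. b \<in> B \<Longrightarrow> c \<in> B \<Longrightarrow> d \<in> B \<Longrightarrow> m (m b c) d = m b (m c d)"
    and "\<And>b c d. b \<in> B \<Longrightarrow> c \<in> B \<Longrightarrow> d \<in> B \<Longrightarrow> t b c * t (m b c) d = t c d * t b (m c d)"
    and "\<And>b. b \<in> B \<Longrightarrow> m e b = b" "\<And>b. b \<in> B \<Longrightarrow> m b e = b"
    and "\<And>b. b \<in> B \<Longrightarrow> t e b = 1" "\<And>b. b \<in> B \<Longrightarrow> t b e = 1"
  shows "kalgebra (twisted_algebra B m t e)"
proof (rule kalgebra.intro)
  let ?A = "twisted_algebra B m t e"
  interpret kmodule ?A by simp
  have l: "tmul m t (single e 1) f = f" if "keys f \<subseteq> B" for f
    by (rule plin_eqI[OF tmul_right plin_id _ that]) (simp add: assms)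
  have r: "tmul m t f (single e 1) = f" if "keys f \<subseteq> B" for f
    by (rule plin_eqI[OF tmul_left plin_id _ that]) (simp add: assms)
  have "Group.monoid ?A"
  proof (rule monoidI)
    fix x y z assume "x \<in> carrier ?A" "y \<in> carrier ?A" "z \<in> carrier ?A"
    then show "x \<otimes>\<^bsub>?A\<^esub> y \<otimes>\<^bsub>?A\<^esub> z = x \<otimes>\<^bsub>?A\<^esub> (y \<otimes>\<^bsub>?A\<^esub> z)"
      using tmul_assoc[of B m t x y z, OF assms(3,4)] by simp
  next
    fix x y assume "x \<in> carrier ?A" "y \<in> carrier ?A"
    then show "x \<otimes>\<^bsub>?A\<^esub> y \<in> carrier ?A"
      using tmul_keys[of B m x y t, OF assms(1)] by simp
  qed (simp_all add: l r assms)
  then have "ring ?A"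
    by (intro ringI abelian_group_axioms)
      (auto simp: plin_add[OF tmul_left] plin_add[OF tmul_right])
  then show "k_algebra ?A"
    unfolding k_algebra_def using kmod
    by (auto simp: plin_scale[OF tmul_left] plin_scale[OF tmul_right])
qed

subsection \<open>Linear maps\<close>

lemma linear_mapsI:
  assumes "\<And>x. x \<in> carrier M \<Longrightarrow> f x \<in> carrier P"
    and "\<And>x y. x \<in> carrier M \<Longrightarrow> y \<in> carrier M \<Longrightarrow> f (x \<oplus>\<^bsub>M\<^esub> y) = f x \<oplus>\<^bsub>P\<^esub> f y"
    and "\<And>c x. x \<in> carrier M \<Longrightarrow> f (c \<odot>\<^bsub>M\<^esub> x) = c \<odot>\<^bsub>P\<^esub> f x"
  shows "f \<in> linear_maps M P"
  using assms by (auto simp: linear_maps_def)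

lemma
  assumes "f \<in> linear_maps M P"
  shows lm_closed: "x \<in> carrier M \<Longrightarrow> f x \<in> carrier P"
    and lm_add: "x \<in> carrier M \<Longrightarrow> y \<in> carrier M \<Longrightarrow> f (x \<oplus>\<^bsub>M\<^esub> y) = f x \<oplus>\<^bsub>P\<^esub> f y"
    and lm_smul: "x \<in> carrier M \<Longrightarrow> f (c \<odot>\<^bsub>M\<^esub> x) = c \<odot>\<^bsub>P\<^esub> f x"
  using assms by (auto simp: linear_maps_def)

lemma lm_zero:
  assumes "f \<in> linear_maps M P" "kmodule M" "kmodule P"
  shows "f \<zero>\<^bsub>M\<^esub> = \<zero>\<^bsub>P\<^esub>"
proof -
  interpret M: kmodule M by fact
  interpret P: kmodule P by fact
  show ?thesis
    by (metis M.smul_zero_left M.zero_closed P.smul_zero_left assms(1) lm_closed lm_smul)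
qed

lemma lm_neg:
  assumes "f \<in> linear_maps M P" "kmodule M" "kmodule P" "x \<in> carrier M"
  shows "f (\<ominus>\<^bsub>M\<^esub> x) = \<ominus>\<^bsub>P\<^esub> f x"
  by (metis assms kmodule.smul_neg lm_closed lm_smul)

lemma lm_compose:
  assumes "f \<in> linear_maps M P" "h \<in> linear_maps P Q"
  shows "(\<lambda>x. h (f x)) \<in> linear_maps M Q"
  using assms by (auto simp: linear_maps_def Pi_iff)

lemma lm_inv:
  assumes f: "f \<in> linear_maps M P" and bij: "bij_betw f (carrier M) (carrier P)" and "kmodule M"
  shows "inv_into (carrier M) f \<in> linear_maps P M"
proof -
  interpret M: kmodule M by fact
  let ?i = "inv_into (carrier M) f"
  have i: "?i (f x) = x" if "x \<in> carrier M" for x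
    using bij that by (simp add: bij_betw_def)
  have ex: "\<exists>x\<in>carrier M. y = f x" if "y \<in> carrier P" for y
    using bij that unfolding bij_betw_def by blast
  show ?thesis
  proof (rule linear_mapsI)
    fix y y' assume "y \<in> carrier P" "y' \<in> carrier P"
    then obtain x x' where "x \<in> carrier M" "y = f x" "x' \<in> carrier M" "y' = f x'" using ex by meson
    then show "?i (y \<oplus>\<^bsub>P\<^esub> y') = ?i y \<oplus>\<^bsub>M\<^esub> ?i y'"
      using i[of "x \<oplus>\<^bsub>M\<^esub> x'"] by (simp add: i lm_add[OF f, symmetric])
  next
    fix y c assume "y \<in> carrier P"
    then obtain x where "x \<in> carrier M" "y = f x" using ex by meson
    then show "?i y \<in> carrier M" "?i (c \<odot>\<^bsub>P\<^esub> y) = c \<odot>\<^bsub>M\<^esub> ?i y"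
      using i[of "c \<odot>\<^bsub>M\<^esub> x"] by (simp_all add: i lm_smul[OF f, symmetric])
  qed
qed

lemma lm_eqI_keys:
  assumes "S \<in> linear_maps (twisted_algebra B m t e) P" "T \<in> linear_maps (twisted_algebra B m t e) P"
    and "kmodule P"
    and "\<And>b. b \<in> B \<Longrightarrow> S (single b 1) = T (single b 1)"
    and "keys f \<subseteq> B"
  shows "S f = T f"
  using assms(5)
proof (induction rule: keys_induct)
  case zero
  then show ?case using lm_zero[OF assms(1)] lm_zero[OF assms(2)] assms(3) by simp
next
  case (single b c)
  have "single b c = scale c (single b 1)" by simp
  then show ?case
    using lm_smul[OF assms(1), of "single b 1" c] lm_smul[OF assms(2), of "single b 1" c]
      assms(4)[OF single] single by simp
next
  case (add f h)
  then show ?case using lm_add[OF assms(1), of f h] lm_add[OF assms(2), of f h] by simp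
qed

lemma free_lift_superset:
  assumes "kmodule P" "finite S" "keys f \<subseteq> S" "\<And>b. b \<in> S \<Longrightarrow> \<beta> b \<in> carrier P"
  shows "free_lift P \<beta> f = (\<Oplus>\<^bsub>P\<^esub>b\<in>S. lookup f b \<odot>\<^bsub>P\<^esub> \<beta> b)"
proof -
  interpret P: kmodule P by fact
  show ?thesis unfolding free_lift_def
    by (rule P.add.finprod_mono_neutral_cong_left) (use assms in \<open>auto simp: in_keys_iff\<close>)
qed

lemma free_lift_add:
  assumes "kmodule P" "\<And>b. b \<in> B \<Longrightarrow> \<beta> b \<in> carrier P" "keys f \<subseteq> B" "keys h \<subseteq> B"
  shows "free_lift P \<beta> (f + h) = free_lift P \<beta> f \<oplus>\<^bsub>P\<^esub> free_lift P \<beta> h"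
proof -
  interpret P: kmodule P by fact
  let ?S = "keys f \<union> keys h"
  have *: "finite ?S" "keys (f + h) \<subseteq> ?S" by (simp, rule keys_add)
  have S: "\<beta> b \<in> carrier P" if "b \<in> ?S" for b using that assms by auto
  have "free_lift P \<beta> f \<oplus>\<^bsub>P\<^esub> free_lift P \<beta> h =
    (\<Oplus>\<^bsub>P\<^esub>b\<in>?S. lookup f b \<odot>\<^bsub>P\<^esub> \<beta> b) \<oplus>\<^bsub>P\<^esub> (\<Oplus>\<^bsub>P\<^esub>b\<in>?S. lookup h b \<odot>\<^bsub>P\<^esub> \<beta> b)"
    using free_lift_superset[OF assms(1) *(1) _ S, where f = f] free_lift_superset[OF assms(1) *(1) _ S, where f = h]
    by simp
  also have "\<dots> = (\<Oplus>\<^bsub>P\<^esub>b\<in>?S. lookup f b \<odot>\<^bsub>P\<^esub> \<beta> b \<oplus>\<^bsub>P\<^esub> lookup h b \<odot>\<^bsub>P\<^esub> \<beta> b)"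
    by (rule P.finsum_addf[symmetric]) (use S in auto)
  also have "\<dots> = (\<Oplus>\<^bsub>P\<^esub>b\<in>?S. lookup (f + h) b \<odot>\<^bsub>P\<^esub> \<beta> b)"
    by (rule P.finsum_cong') (use S in \<open>auto simp: lookup_add P.smul_ldistr\<close>)
  also have "\<dots> = free_lift P \<beta> (f + h)"
    using free_lift_superset[OF assms(1) * S] by simp
  finally show ?thesis ..
qed

lemma free_lift_lm:
  assumes "kmodule P" "\<And>b. b \<in> B \<Longrightarrow> \<beta> b \<in> carrier P"
  shows "free_lift P \<beta> \<in> linear_maps (twisted_algebra B m t e) P"
proof (rule linear_mapsI)
  interpret P: kmodule P by fact
  fix f assume f: "f \<in> carrier (twisted_algebra B m t e)"
  then show "free_lift P \<beta> f \<in> carrier P"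
    unfolding free_lift_def by (intro P.finsum_closed) (use assms in auto)
  show "free_lift P \<beta> (f \<oplus>\<^bsub>twisted_algebra B m t e\<^esub> h) = free_lift P \<beta> f \<oplus>\<^bsub>P\<^esub> free_lift P \<beta> h"
    if "h \<in> carrier (twisted_algebra B m t e)" for h
    using f that by (simp add: free_lift_add[OF assms])
  fix c
  show "free_lift P \<beta> (c \<odot>\<^bsub>twisted_algebra B m t e\<^esub> f) = c \<odot>\<^bsub>P\<^esub> free_lift P \<beta> f"
  proof -
    have S: "\<beta> b \<in> carrier P" if "b \<in> keys f" for b using that f assms by auto
    have hom: "c \<odot>\<^bsub>P\<^esub> (\<Oplus>\<^bsub>P\<^esub>b\<in>S. v b) = (\<Oplus>\<^bsub>P\<^esub>b\<in>S. c \<odot>\<^bsub>P\<^esub> v b)"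
      if "finite S" "v \<in> S \<rightarrow> carrier P" for S v
      using that by (induction S) (auto simp: Pi_iff P.smul_rdistr)
    have "keys (scale c f) \<subseteq> keys f" by (auto simp: in_keys_iff)
    then have "free_lift P \<beta> (scale c f) = (\<Oplus>\<^bsub>P\<^esub>b\<in>keys f. lookup (scale c f) b \<odot>\<^bsub>P\<^esub> \<beta> b)"
      using S by (intro free_lift_superset assms(1)) auto
    also have "\<dots> = (\<Oplus>\<^bsub>P\<^esub>b\<in>keys f. c \<odot>\<^bsub>P\<^esub> (lookup f b \<odot>\<^bsub>P\<^esub> \<beta> b))"
      by (rule P.finsum_cong') (use S in \<open>auto simp: P.smul_assoc\<close>)
    also have "\<dots> = c \<odot>\<^bsub>P\<^esub> free_lift P \<beta> f"
      unfolding free_lift_def by (rule hom[symmetric]) (use S in auto)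
    finally show ?thesis by simp
  qed
qed

lemma free_lift_single [simp]:
  assumes "kmodule P" "\<beta> b \<in> carrier P"
  shows "free_lift P \<beta> (single b c) = c \<odot>\<^bsub>P\<^esub> \<beta> b"
proof -
  interpret P: kmodule P by fact
  have "free_lift P \<beta> (single b c) =
    (\<Oplus>\<^bsub>P\<^esub>b'\<in>{b}. lookup (single b c) b' \<odot>\<^bsub>P\<^esub> \<beta> b')"
    by (rule free_lift_superset[OF assms(1)]) (use assms(2) in auto)
  also have "\<dots> = c \<odot>\<^bsub>P\<^esub> \<beta> b"
    using P.finsum_insert[of "{}" b "\<lambda>b'. lookup (single b c) b' \<odot>\<^bsub>P\<^esub> \<beta> b'"] assms(2)
    by simp
  finally show ?thesis .
qed

lemma free_lift_lin [simp]: "free_lift (twisted_algebra UNIV m t e) \<beta> = lin \<beta>"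
proof
  fix f
  show "free_lift (twisted_algebra UNIV m t e) \<beta> f = lin \<beta> f"
    by (rule lm_eqI_keys[where B = UNIV and P = "twisted_algebra UNIV m t e", OF free_lift_lm])
      (auto intro!: linear_mapsI simp: lin_add lin_scale)
qed

section \<open>Quotients and tensor products\<close>

lemma (in kmodule) submoduleI':
  assumes "N \<subseteq> carrier M" "\<zero> \<in> N" "\<And>a b. a \<in> N \<Longrightarrow> b \<in> N \<Longrightarrow> a \<oplus> b \<in> N"
    and "\<And>c x. x \<in> N \<Longrightarrow> c \<odot> x \<in> N"
  shows "submodule N ring_of_type_algebra M"
proof (rule module.submoduleI[OF kmod assms(1,2) _ assms(3)])
  fix a assume "a \<in> N"
  then show "\<ominus> a \<in> N" using assms(4)[of a "-1"] smul_neg[of a] assms(1) by auto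
qed (use assms in auto)

lemma (in kmodule)
  assumes "submodule N ring_of_type_algebra M"
  shows submodule_sub: "N \<subseteq> carrier M"
    and submodule_zero: "\<zero> \<in> N"
    and submodule_add: "x \<in> N \<Longrightarrow> y \<in> N \<Longrightarrow> x \<oplus> y \<in> N"
    and submodule_smul: "x \<in> N \<Longrightarrow> c \<odot> x \<in> N"
proof -
  show s: "N \<subseteq> carrier M" using module.submoduleE(1)[OF kmod assms] .
  show "x \<in> N \<Longrightarrow> y \<in> N \<Longrightarrow> x \<oplus> y \<in> N" using module.submoduleE(5)[OF kmod assms] .
  show *: "x \<in> N \<Longrightarrow> c \<odot> x \<in> N" for x c using module.submoduleE(4)[OF kmod assms] by simp
  obtain x where "x \<in> N" using module.submoduleE(2)[OF kmod assms] by blast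
  with *[of x 0] s show "\<zero> \<in> N" by (metis smul_zero_left subsetD)
qed

lemma gen_submodule_submodule:
  assumes "kmodule M" "S \<subseteq> carrier M"
  shows "submodule (gen_submodule M S) ring_of_type_algebra M"
proof -
  interpret kmodule M by fact
  have c: "submodule (carrier M) ring_of_type_algebra M"
    using module.carrier_is_submodule[OF kmod] .
  show ?thesis
  proof (rule submoduleI')
    show "gen_submodule M S \<subseteq> carrier M" unfolding gen_submodule_def using c assms(2) by blast
  qed (auto simp: gen_submodule_def submodule_zero submodule_add submodule_smul)
qed

lemma gen_submodule_base: "s \<in> S \<Longrightarrow> s \<in> gen_submodule M S"
  by (auto simp: gen_submodule_def)

lemma gen_submodule_minimal: "submodule N ring_of_type_algebra M \<Longrightarrow> S \<subseteq> N \<Longrightarrow> gen_submodule M S \<subseteq> N"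
  by (auto simp: gen_submodule_def)

lemma kernel_submodule:
  assumes "f \<in> linear_maps M P" "kmodule M" "kmodule P"
  shows "submodule {x \<in> carrier M. f x = \<zero>\<^bsub>P\<^esub>} ring_of_type_algebra M"
proof -
  interpret M: kmodule M by fact
  interpret P: kmodule P by fact
  show ?thesis
    by (rule M.submoduleI') (auto simp: lm_zero[OF assms] lm_add[OF assms(1)] lm_smul[OF assms(1)])
qed

locale kquot = kmodule M for M :: "('k::comm_ring_1, 'a) module" (structure) +
  fixes N
  assumes sub: "submodule N ring_of_type_algebra M"
begin

sublocale abelian_subgroup N M
  by (rule abelian_subgroupI3[OF additive_subgroupI abelian_group_axioms])
    (rule submodule.axioms(1)[OF sub])

abbreviation "Q \<equiv> quotient M N"

lemma quot_carrier: "carrier Q = (\<lambda>x. N +> x) ` carrier M"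
  by (auto simp: quotient_def A_RCOSETS_def')

lemma coset_closed [simp, intro]: "x \<in> carrier M \<Longrightarrow> N +> x \<in> carrier Q"
  by (auto simp: quot_carrier)

lemma quot_cases:
  assumes "C \<in> carrier Q" obtains x where "x \<in> carrier M" "C = N +> x"
  using assms by (auto simp: quot_carrier)

lemma coset_eq_iff: "x \<in> carrier M \<Longrightarrow> y \<in> carrier M \<Longrightarrow> N +> x = N +> y \<longleftrightarrow> x \<ominus> y \<in> N"
  by (metis a_minus_def a_rcos_module a_repr_independence' a_repr_independenceD)

lemma coset_zero_iff: "x \<in> carrier M \<Longrightarrow> N +> x = N \<longleftrightarrow> x \<in> N"
  by (metis a_coset_join1 a_rcos_const a_subgroup a_rcos_self)

lemma quot_add: "x \<in> carrier M \<Longrightarrow> y \<in> carrier M \<Longrightarrow> (N +> x) \<oplus>\<^bsub>Q\<^esub> (N +> y) = N +> (x \<oplus> y)"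
  using a_rcos_sum by (simp add: quotient_def)

lemma quot_zero: "\<zero>\<^bsub>Q\<^esub> = N"
  by (simp add: quotient_def)

lemma quot_zero': "\<zero>\<^bsub>Q\<^esub> = N +> \<zero>"
  using coset_zero_iff[of \<zero>] by (simp add: quot_zero)

text \<open>\<open>induced\<close> takes the only element of the image of a coset, so this is the
  statement that makes it meaningful.\<close>

lemma coset_const:
  assumes f: "\<And>x y. x \<in> carrier M \<Longrightarrow> y \<in> carrier M \<Longrightarrow> x \<ominus> y \<in> N \<Longrightarrow> f x = f y"
    and x: "x \<in> carrier M"
  shows "f ` (N +> x) = {f x}"
proof -
  have "f y = f x" if "y \<in> N +> x" for y
    using that a_elemrcos_carrier[OF x that] a_rcos_module_imp[OF x that] f x by (simp add: a_minus_def)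
  then show ?thesis using a_rcos_self[OF x] by blast
qed

lemma quot_smul: 
  assumes x: "x \<in> carrier M" shows "c \<odot>\<^bsub>Q\<^esub> (N +> x) = N +> (c \<odot> x)"
proof -
  have "(\<lambda>y. N +> (c \<odot> y)) ` (N +> x) = {N +> (c \<odot> x)}"
  proof (rule coset_const[OF _ x])
    fix u v assume uv: "u \<in> carrier M" "v \<in> carrier M" "u \<ominus> v \<in> N"
    have "c \<odot> u \<ominus> c \<odot> v = c \<odot> (u \<ominus> v)"
      using uv by (simp add: a_minus_def smul_neg[symmetric] smul_rdistr smul_assoc[symmetric])
    then show "N +> (c \<odot> u) = N +> (c \<odot> v)"
      using uv submodule_smul[OF sub] by (simp add: coset_eq_iff)
  qed
  then show ?thesis by (auto simp: quotient_def)
qed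

lemma quot_kmodule: "kmodule Q"
proof (rule kmoduleI)
  show "\<zero>\<^bsub>Q\<^esub> \<in> carrier Q" by (auto simp: quot_zero')
qed (auto simp: quot_carrier quot_add quot_smul a_ac quot_zero'
    smul_ldistr smul_rdistr smul_assoc)

lemma proj_lm: "(\<lambda>x. N +> x) \<in> linear_maps M Q"
  by (rule linear_mapsI) (auto simp: quot_add quot_smul)

lemma lm_const:
  assumes "f \<in> linear_maps M P" "kmodule P" "\<And>n. n \<in> N \<Longrightarrow> f n = \<zero>\<^bsub>P\<^esub>"
    "x \<in> carrier M" "y \<in> carrier M" "x \<ominus> y \<in> N"
  shows "f x = f y"
proof -
  interpret P: kmodule P by fact
  have "f x \<oplus>\<^bsub>P\<^esub> \<ominus>\<^bsub>P\<^esub> f y = \<zero>\<^bsub>P\<^esub>"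
    using assms(3)[OF assms(6)] assms(4,5) 
    by (simp add: a_minus_def lm_add[OF assms(1)] lm_neg[OF assms(1) kmodule_axioms assms(2)])
  then show ?thesis
    using P.minus_unique lm_closed[OF assms(1)] assms(4,5) by (metis P.a_inv_closed P.minus_equality P.minus_minus)
qed

lemma induced_eq:
  assumes "f \<in> linear_maps M P" "kmodule P" "\<And>n. n \<in> N \<Longrightarrow> f n = \<zero>\<^bsub>P\<^esub>" "x \<in> carrier M"
  shows "induced f (N +> x) = f x"
  unfolding induced_def
  using coset_const[OF _ assms(4), of f] lm_const[OF assms(1-3)] by auto

lemma induced_lm:
  assumes "f \<in> linear_maps M P" "kmodule P" "\<And>n. n \<in> N \<Longrightarrow> f n = \<zero>\<^bsub>P\<^esub>"
  shows "induced f \<in> linear_maps Q P"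
  by (rule linear_mapsI)
    (auto simp: quot_carrier quot_add quot_smul induced_eq[OF assms] lm_closed[OF assms(1)]
      lm_add[OF assms(1)] lm_smul[OF assms(1)])

end

text \<open>\<open>quotient\<close> is \<open>FactRing\<close> with a scalar multiplication added;
  this carries the ring axioms over field by field.\<close>

lemma ring_cong:
  assumes "ring R" "carrier S = carrier R" "monoid.mult S = monoid.mult R" "monoid.one S = monoid.one R"
    "ring.zero S = ring.zero R" "ring.add S = ring.add R"
  shows "ring S"
proof -
  interpret R: ring R by fact
  show ?thesis
  proof (rule ringI)
    show "abelian_group S"
      by (rule abelian_groupI) (use assms in \<open>auto simp: R.a_ac intro: R.add.l_inv_ex\<close>)
    show "Group.monoid S"
      by (rule monoidI) (use assms in \<open>auto simp: R.m_assoc\<close>)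
  qed (use assms in \<open>auto simp: R.l_distr R.r_distr\<close>)
qed

locale kquot_alg = kalgebra A for A :: "('k::comm_ring_1, 'a) module" (structure) +
  fixes N
  assumes idl: "ideal N A"
begin

sublocale kquot A N
proof (rule kquot.intro[OF kmodule_axioms], rule kquot_axioms.intro)
  interpret ideal N A by (rule idl)
  show "submodule N ring_of_type_algebra A"
  proof (rule submoduleI')
    fix c x assume x: "x \<in> N"
    \<comment> \<open>Scalars act as multiplication by multiples of the unit, hence an ideal is a
      submodule.\<close>
    have "c \<odot> x = (c \<odot> \<one>) \<otimes> x" using x by (simp add: smul_mult_left)
    then show "c \<odot> x \<in> N" using I_l_closed[OF x, of "c \<odot> \<one>"] by simp
  qed (auto)
qed

lemma quot_mult: "x \<in> carrier A \<Longrightarrow> y \<in> carrier A \<Longrightarrow> (N +> x) \<otimes>\<^bsub>Q\<^esub> (N +> y) = N +> (x \<otimes> y)"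
  using ideal.rcoset_mult_add[OF idl] by (simp add: quotient_def)

lemma quot_one: "\<one>\<^bsub>Q\<^esub> = N +> \<one>"
  by (simp add: quotient_def)

lemma quot_kalgebra: "kalgebra Q"
proof (rule kalgebra.intro)
  interpret qm: kmodule Q by (rule quot_kmodule)
  have "ring Q"
    by (rule ring_cong[OF ideal.quotient_is_ring[OF idl]]) (simp_all add: quotient_def FactRing_def)
  then show "k_algebra Q"
    unfolding k_algebra_def using qm.kmod
    by (auto simp: quot_carrier quot_mult quot_smul smul_mult_left smul_mult_right)
qed

end

lemma
  assumes "f \<in> algebra_hom A P"
  shows ah_lm: "f \<in> linear_maps A P"
    and ah_closed: "x \<in> carrier A \<Longrightarrow> f x \<in> carrier P"
    and ah_mult: "x \<in> carrier A \<Longrightarrow> y \<in> carrier A \<Longrightarrow> f (x \<otimes>\<^bsub>A\<^esub> y) = f x \<otimes>\<^bsub>P\<^esub> f y"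
    and ah_one: "f \<one>\<^bsub>A\<^esub> = \<one>\<^bsub>P\<^esub>"
    and ah_smul: "x \<in> carrier A \<Longrightarrow> f (c \<odot>\<^bsub>A\<^esub> x) = c \<odot>\<^bsub>P\<^esub> f x"
  using assms by (auto simp: algebra_hom_def linear_maps_def ring_hom_def)

lemma ahI:
  assumes "f \<in> linear_maps A P"
    and "\<And>x y. x \<in> carrier A \<Longrightarrow> y \<in> carrier A \<Longrightarrow> f (x \<otimes>\<^bsub>A\<^esub> y) = f x \<otimes>\<^bsub>P\<^esub> f y"
    and "f \<one>\<^bsub>A\<^esub> = \<one>\<^bsub>P\<^esub>"
  shows "f \<in> algebra_hom A P"
  using assms by (auto simp: algebra_hom_def linear_maps_def ring_hom_def Pi_iff)

lemma ah_compose: "f \<in> algebra_hom A P \<Longrightarrow> h \<in> algebra_hom P S \<Longrightarrow> (\<lambda>x. h (f x)) \<in> algebra_hom A S"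
  by (rule ahI) (auto intro: lm_compose ah_lm simp: ah_mult ah_one ah_closed)

lemma ah_kernel_ideal:
  assumes "f \<in> algebra_hom A P" "kalgebra A" "kalgebra P"
  shows "ideal {x \<in> carrier A. f x = \<zero>\<^bsub>P\<^esub>} A"
proof -
  interpret A: kalgebra A by fact
  interpret P: kalgebra P by fact
  have "submodule {x \<in> carrier A. f x = \<zero>\<^bsub>P\<^esub>} ring_of_type_algebra A"
    by (rule kernel_submodule[OF ah_lm[OF assms(1)]]) unfold_locales
  then show ?thesis
    by (intro idealI A.ring_axioms submodule.axioms(1)) (auto simp: ah_mult[OF assms(1)] ah_closed[OF assms(1)])
qed

lemma (in kquot_alg) induced_hom:
  assumes "f \<in> algebra_hom A P" "kalgebra P" "\<And>n. n \<in> N \<Longrightarrow> f n = \<zero>\<^bsub>P\<^esub>"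
  shows "induced f \<in> algebra_hom Q P"
proof -
  interpret P: kalgebra P by fact
  note eq = induced_eq[OF ah_lm[OF assms(1)] P.kmodule_axioms assms(3)]
  show ?thesis
    by (rule ahI[OF induced_lm[OF ah_lm[OF assms(1)] P.kmodule_axioms assms(3)]])
      (auto simp: quot_carrier quot_mult eq quot_one ah_mult[OF assms(1)] ah_one[OF assms(1)])
qed

lemma twisted_hom:
  assumes lm: "T \<in> linear_maps (twisted_algebra B m t e) (P :: ('k::comm_ring_1, 'p) module)"
    and P: "kalgebra P" and one: "T (single e 1) = \<one>\<^bsub>P\<^esub>"
    and cl: "\<And>b c. b \<in> B \<Longrightarrow> c \<in> B \<Longrightarrow> m b c \<in> B"
    and mult: "\<And>b c. b \<in> B \<Longrightarrow> c \<in> B \<Longrightarrow> T (single (m b c) (t b c)) =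
      T (single b 1) \<otimes>\<^bsub>P\<^esub> T (single c 1)"
  shows "T \<in> algebra_hom (twisted_algebra B m t e) P"
proof (rule ahI[OF lm])
  let ?A = "twisted_algebra B m t e"
  interpret P: kalgebra P by fact
  note [simp] = P.smul_mult_left P.smul_mult_right
  have cl': "T f \<in> carrier P" if "keys f \<subseteq> B" for f
    using lm_closed[OF lm, of f] that by simp
  have kc: "keys (tmul m t f h) \<subseteq> B" if "keys f \<subseteq> B" "keys h \<subseteq> B" for f h
    using tmul_keys[OF cl that] .
  have add: "T (f + h) = T f \<oplus>\<^bsub>P\<^esub> T h" if "keys f \<subseteq> B" "keys h \<subseteq> B" for f h
    using lm_add[OF lm, of f h] that by simp
  have sm: "T (scale c f) = c \<odot>\<^bsub>P\<^esub> T f" if "keys f \<subseteq> B" for f c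
    using lm_smul[OF lm, of f c] that by simp
  fix x y assume "x \<in> carrier ?A" and "y \<in> carrier ?A"
  then have x: "keys x \<subseteq> B" and y: "keys y \<subseteq> B" by auto
  have "T (tmul m t x y) = T x \<otimes>\<^bsub>P\<^esub> T y"
  proof (rule lm_eqI_keys[OF _ _ P.kmodule_axioms _ x])
    show "(\<lambda>x. T (tmul m t x y)) \<in> linear_maps ?A P"
      using y by (intro linear_mapsI) (auto simp: cl' kc plin_add[OF tmul_left] plin_scale[OF tmul_left] add sm)
    show "(\<lambda>x. T x \<otimes>\<^bsub>P\<^esub> T y) \<in> linear_maps ?A P"
      using y by (intro linear_mapsI) (auto simp: cl' add sm P.l_distr)
    fix b assume b: "b \<in> B"
    then have sb: "keys (single b (1::'k)) \<subseteq> B" by simp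
    show "T (tmul m t (single b 1) y) = T (single b 1) \<otimes>\<^bsub>P\<^esub> T y"
    proof (rule lm_eqI_keys[OF _ _ P.kmodule_axioms _ y])
      show "(\<lambda>y. T (tmul m t (single b 1) y)) \<in> linear_maps ?A P"
        using sb by (intro linear_mapsI) (simp_all add: cl' kc plin_add[OF tmul_right] plin_scale[OF tmul_right] add sm)
      show "(\<lambda>y. T (single b 1) \<otimes>\<^bsub>P\<^esub> T y) \<in> linear_maps ?A P"
        using cl'[OF sb] by (intro linear_mapsI) (simp_all add: cl' add sm P.r_distr)
      fix c assume "c \<in> B"
      then show "T (tmul m t (single b 1) (single c 1)) =
        T (single b 1) \<otimes>\<^bsub>P\<^esub> T (single c 1)"
        using mult[OF b] by simp
    qed
  qed
  then show "T (x \<otimes>\<^bsub>?A\<^esub> y) = T x \<otimes>\<^bsub>P\<^esub> T y" by simp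
qed (use one in simp)

lemma a_inv_twisted:
  assumes "keys f \<subseteq> B"
  shows "\<ominus>\<^bsub>twisted_algebra B m t e\<^esub> f = - f"
proof -
  interpret kmodule "twisted_algebra B m t e" by simp
  show ?thesis by (rule minus_equality) (use assms in auto)
qed

text \<open>Binary tensor products and tensor products of families are both free modules modulo
  generated submodules; their universal property is proved here once for both.\<close>

locale presented =
  fixes B :: "'b set" and m :: "'b \<Rightarrow> 'b \<Rightarrow> 'b" and e :: 'b and Rel :: "('b \<Rightarrow>\<^sub>0 'k::comm_ring_1) set"
  assumes rel: "Rel \<subseteq> {f. keys f \<subseteq> B}"
begin

definition "Fr = monoid_algebra B m e"
definition "Z = gen_submodule Fr Rel"

sublocale kquot Fr Z
proof (rule kquot.intro)
  show *: "kmodule Fr" by (simp add: Fr_def monoid_algebra_def)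
  show "kquot_axioms Fr Z" unfolding Z_def
    by (rule kquot_axioms.intro[OF gen_submodule_submodule[OF *]])
      (use rel in \<open>simp add: Fr_def monoid_algebra_def\<close>)
qed

lemma Fr_simps [simp]: "carrier Fr = {f. keys f \<subseteq> B}" "ring.add Fr = (+)"
  "module.smult Fr = scale" "ring.zero Fr = 0"
  by (simp_all add: Fr_def monoid_algebra_def)

lemma Fr_neg [simp]: "keys f \<subseteq> B \<Longrightarrow> \<ominus>\<^bsub>Fr\<^esub> f = - f"
  by (simp add: Fr_def monoid_algebra_def a_inv_twisted)

definition gen where "gen b = Z +>\<^bsub>Fr\<^esub> single b 1"

lemma gen_closed: "b \<in> B \<Longrightarrow> gen b \<in> carrier Q"
  by (auto simp: gen_def)

lemma lift_zero:
  assumes "kmodule P" "\<And>b. b \<in> B \<Longrightarrow> \<beta> b \<in> carrier P" "\<And>r. r \<in> Rel \<Longrightarrow> free_lift P \<beta> r = \<zero>\<^bsub>P\<^esub>"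
    "z \<in> Z"
  shows "free_lift P \<beta> z = \<zero>\<^bsub>P\<^esub>"
proof -
  have lm: "free_lift P \<beta> \<in> linear_maps Fr P"
    unfolding Fr_def monoid_algebra_def by (rule free_lift_lm[OF assms(1,2)])
  have "Z \<subseteq> {x \<in> carrier Fr. free_lift P \<beta> x = \<zero>\<^bsub>P\<^esub>}"
    unfolding Z_def
    by (rule gen_submodule_minimal[OF kernel_submodule[OF lm kmodule_axioms assms(1)]])
      (use rel assms in auto)
  then show ?thesis using assms(4) by auto
qed

lemma
  assumes "kmodule P" "\<And>b. b \<in> B \<Longrightarrow> \<beta> b \<in> carrier P" "\<And>r. r \<in> Rel \<Longrightarrow> free_lift P \<beta> r = \<zero>\<^bsub>P\<^esub>"
  shows lift_lm: "tensor_lift P \<beta> \<in> linear_maps Q P"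
    and lift_coset: "keys f \<subseteq> B \<Longrightarrow> tensor_lift P \<beta> (Z +>\<^bsub>Fr\<^esub> f) = free_lift P \<beta> f"
    and lift_gen: "b \<in> B \<Longrightarrow> tensor_lift P \<beta> (gen b) = \<beta> b"
proof -
  interpret P: kmodule P by fact
  have lm: "free_lift P \<beta> \<in> linear_maps Fr P"
    unfolding Fr_def monoid_algebra_def by (rule free_lift_lm[OF assms(1,2)])
  note z = lift_zero[OF assms]
  show "tensor_lift P \<beta> \<in> linear_maps Q P"
    unfolding tensor_lift_def by (rule induced_lm[OF lm assms(1) z])
  show *: "keys f \<subseteq> B \<Longrightarrow> tensor_lift P \<beta> (Z +>\<^bsub>Fr\<^esub> f) = free_lift P \<beta> f" for f
    unfolding tensor_lift_def by (rule induced_eq[OF lm assms(1) z]) auto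
  show "b \<in> B \<Longrightarrow> tensor_lift P \<beta> (gen b) = \<beta> b"
    unfolding gen_def using *[of "single b 1"] assms(1,2) by simp
qed

lemma quot_induct [consumes 1, case_names zero gen add]:
  assumes "x \<in> carrier Q"
    and "P \<zero>\<^bsub>Q\<^esub>" "\<And>b c. b \<in> B \<Longrightarrow> P (c \<odot>\<^bsub>Q\<^esub> gen b)"
    and add: "\<And>x y. x \<in> carrier Q \<Longrightarrow> y \<in> carrier Q \<Longrightarrow> P x \<Longrightarrow> P y \<Longrightarrow> P (x \<oplus>\<^bsub>Q\<^esub> y)"
  shows "P x"
proof -
  obtain f where f: "keys f \<subseteq> B" "x = Z +>\<^bsub>Fr\<^esub> f"
    using assms(1) by (elim quot_cases) auto
  from f(1) have "P (Z +>\<^bsub>Fr\<^esub> f)"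
  proof (induction rule: keys_induct)
    case zero
    then show ?case using assms(2) quot_zero' by simp
  next
    case (single b c)
    have "c \<odot>\<^bsub>Q\<^esub> gen b = Z +>\<^bsub>Fr\<^esub> single b c"
      unfolding gen_def using quot_smul[of "single b 1" c] single by simp
    then show ?case using assms(3)[OF single, of c] by simp
  next
    case (add f h)
    then show ?case using assms(4)[of "Z +>\<^bsub>Fr\<^esub> f" "Z +>\<^bsub>Fr\<^esub> h"] quot_add[of f h] by auto
  qed
  then show ?thesis by (simp add: f(2))
qed

lemma coset_eqI:
  assumes "f - h \<in> Rel" "keys f \<subseteq> B" "keys h \<subseteq> B"
  shows "Z +>\<^bsub>Fr\<^esub> f = Z +>\<^bsub>Fr\<^esub> h"
  using assms gen_submodule_base[of "f - h" Rel Fr]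
  by (simp add: coset_eq_iff a_minus_def Z_def[symmetric])

end

lemma (in kmodule) add_minus_cancel2: "x \<in> carrier M \<Longrightarrow> y \<in> carrier M \<Longrightarrow> (x \<oplus> y) \<ominus> x \<ominus> y = \<zero>"
  by (simp add: a_minus_def a_comm[of x y] a_assoc r_neg)

lemma (in kmodule) minus_self: "x \<in> carrier M \<Longrightarrow> x \<ominus> x = \<zero>"
  by (simp add: a_minus_def r_neg)

lemma free_lift_diff:
  assumes "kmodule (P :: ('k::comm_ring_1, 'p) module)" "\<And>b. b \<in> B \<Longrightarrow> \<beta> b \<in> carrier P" "keys f \<subseteq> B" "keys h \<subseteq> B"
  shows "free_lift P \<beta> (f - h) = free_lift P \<beta> f \<ominus>\<^bsub>P\<^esub> free_lift P \<beta> h"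
proof -
  interpret P: kmodule P by fact
  let ?A = "twisted_algebra B undefined undefined undefined :: ('k, _ \<Rightarrow>\<^sub>0 'k) module"
  have lm: "free_lift P \<beta> \<in> linear_maps ?A P"
    by (rule free_lift_lm[OF assms(1,2)])
  have "f - h = f + scale (-1) h" by (simp add: poly_mapping_eq_iff fun_eq_iff lookup_minus lookup_add)
  moreover have "free_lift P \<beta> (scale (-1) h) = \<ominus>\<^bsub>P\<^esub> free_lift P \<beta> h"
    using lm_smul[OF lm, of h "-1"] lm_closed[OF lm, of h] assms(4) by (simp add: P.smul_neg)
  ultimately show ?thesis
    using free_lift_add[OF assms(1-3), where h = "scale (-1) h"] assms(4) subset_trans[OF keys_scale assms(4)]
    by (simp add: a_minus_def)
qed

lemma keys_minus_subset: "keys f \<subseteq> B \<Longrightarrow> keys h \<subseteq> B \<Longrightarrow> keys (f - h) \<subseteq> B"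
  for f h :: "'b \<Rightarrow>\<^sub>0 'k::comm_ring_1"
  using keys_diff[of f h] by blast

lemma keys_single_subset: "b \<in> B \<Longrightarrow> keys (single b c) \<subseteq> B"
  by simp

locale bimod = M: kmodule M + P: kmodule P
  for M :: "('k::comm_ring_1, 'a) module" and P :: "('k, 'b) module"
begin

lemma presented: "presented (carrier M \<times> carrier P) (tensor_relations M P)"
proof (rule presented.intro, rule subsetI)
  fix r assume "r \<in> tensor_relations M P"
  then show "r \<in> {f. keys f \<subseteq> carrier M \<times> carrier P}"
    unfolding tensor_relations_def
    by (elim UnE CollectE exE conjE; hypsubst; intro CollectI keys_minus_subset keys_single_subset; simp)
qed

end

sublocale bimod \<subseteq> T: presented "carrier M \<times> carrier P"
  "\<lambda>(a, b) (a', b'). (a \<otimes>\<^bsub>M\<^esub> a', b \<otimes>\<^bsub>P\<^esub> b')" "(\<one>\<^bsub>M\<^esub>, \<one>\<^bsub>P\<^esub>)" "tensor_relations M P"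
  by (rule presented)

context bimod
begin

lemma T_Fr: "T.Fr = free_on_pairs M P" by (simp add: T.Fr_def free_on_pairs_def)
lemma T_Q: "T.Q = tensor M P" by (simp add: tensor_def T.Z_def T_Fr)
lemma T_gen: "T.gen (a, b) = pure_tensor M P a b" by (simp add: T.gen_def pure_tensor_def T.Z_def T_Fr)

abbreviation "pt \<equiv> pure_tensor M P"

lemma tensor_kmodule: "kmodule (tensor M P)"
  using T.quot_kmodule by (simp add: T_Q)

sublocale TM: kmodule "tensor M P" by (rule tensor_kmodule)

lemma pt_closed [simp, intro]: "a \<in> carrier M \<Longrightarrow> b \<in> carrier P \<Longrightarrow> pt a b \<in> carrier (tensor M P)"
  using T.gen_closed[of "(a, b)"] by (simp add: T_Q T_gen)

lemma pt_add_left: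
  assumes "a \<in> carrier M" "a' \<in> carrier M" "b \<in> carrier P"
  shows "pt (a \<oplus>\<^bsub>M\<^esub> a') b = pt a b \<oplus>\<^bsub>tensor M P\<^esub> pt a' b"
proof -
  have "T.Z +>\<^bsub>T.Fr\<^esub> single (a \<oplus>\<^bsub>M\<^esub> a', b) 1 =
    T.Z +>\<^bsub>T.Fr\<^esub> (single (a, b) 1 + single (a', b) 1)"
    by (rule T.coset_eqI)
      (use assms in \<open>auto simp: tensor_relations_def diff_diff_add[symmetric]
        dest!: subsetD[OF keys_add] split: if_splits\<close>)
  then show ?thesis
    using T.quot_add[of "single (a, b) 1" "single (a', b) 1"] assms
    by (simp add: T_Q[symmetric] T_gen[symmetric] T.gen_def)
qed

lemma pt_add_right:
  assumes "a \<in> carrier M" "b \<in> carrier P" "b' \<in> carrier P"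
  shows "pt a (b \<oplus>\<^bsub>P\<^esub> b') = pt a b \<oplus>\<^bsub>tensor M P\<^esub> pt a b'"
proof -
  have "T.Z +>\<^bsub>T.Fr\<^esub> single (a, b \<oplus>\<^bsub>P\<^esub> b') 1 =
    T.Z +>\<^bsub>T.Fr\<^esub> (single (a, b) 1 + single (a, b') 1)"
    by (rule T.coset_eqI)
      (use assms in \<open>auto simp: tensor_relations_def diff_diff_add[symmetric]
        dest!: subsetD[OF keys_add] split: if_splits\<close>)
  then show ?thesis
    using T.quot_add[of "single (a, b) 1" "single (a, b') 1"] assms
    by (simp add: T_Q[symmetric] T_gen[symmetric] T.gen_def)
qed

lemma pt_smul_left:
  assumes "a \<in> carrier M" "b \<in> carrier P"
  shows "pt (c \<odot>\<^bsub>M\<^esub> a) b = c \<odot>\<^bsub>tensor M P\<^esub> pt a b"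
proof -
  have "T.Z +>\<^bsub>T.Fr\<^esub> single (c \<odot>\<^bsub>M\<^esub> a, b) 1 = T.Z +>\<^bsub>T.Fr\<^esub> single (a, b) c"
    by (rule T.coset_eqI) (use assms in \<open>auto simp: tensor_relations_def\<close>)
  then show ?thesis
    using T.quot_smul[of "single (a, b) 1" c] assms
    by (simp add: T_Q[symmetric] T_gen[symmetric] T.gen_def)
qed

lemma pt_smul_right:
  assumes "a \<in> carrier M" "b \<in> carrier P"
  shows "pt a (c \<odot>\<^bsub>P\<^esub> b) = c \<odot>\<^bsub>tensor M P\<^esub> pt a b"
proof -
  have "T.Z +>\<^bsub>T.Fr\<^esub> single (a, c \<odot>\<^bsub>P\<^esub> b) 1 = T.Z +>\<^bsub>T.Fr\<^esub> single (a, b) c"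
    by (rule T.coset_eqI) (use assms in \<open>auto simp: tensor_relations_def\<close>)
  then show ?thesis
    using T.quot_smul[of "single (a, b) 1" c] assms
    by (simp add: T_Q[symmetric] T_gen[symmetric] T.gen_def)
qed

lemma pt_lm_left: "b \<in> carrier P \<Longrightarrow> (\<lambda>a. pt a b) \<in> linear_maps M (tensor M P)"
  by (rule linear_mapsI) (auto simp: pt_add_left pt_smul_left)

lemma pt_lm_right: "a \<in> carrier M \<Longrightarrow> pt a \<in> linear_maps P (tensor M P)"
  by (rule linear_mapsI) (auto simp: pt_add_right pt_smul_right)

lemma pt_zero_left [simp]: "b \<in> carrier P \<Longrightarrow> pt \<zero>\<^bsub>M\<^esub> b = \<zero>\<^bsub>tensor M P\<^esub>"
  using lm_zero[OF pt_lm_left M.kmodule_axioms TM.kmodule_axioms] .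

lemma pt_zero_right [simp]: "a \<in> carrier M \<Longrightarrow> pt a \<zero>\<^bsub>P\<^esub> = \<zero>\<^bsub>tensor M P\<^esub>"
  using lm_zero[OF pt_lm_right P.kmodule_axioms TM.kmodule_axioms] .

definition bilin :: "('k, 'c) module \<Rightarrow> ('a \<times> 'b \<Rightarrow> 'c) \<Rightarrow> bool" where
  "bilin S \<beta> \<longleftrightarrow> (\<forall>b\<in>carrier P. (\<lambda>a. \<beta> (a, b)) \<in> linear_maps M S) \<and>
     (\<forall>a\<in>carrier M. (\<lambda>b. \<beta> (a, b)) \<in> linear_maps P S)"

context
  fixes S :: "('k, 'c) module" and \<beta>
  assumes S: "kmodule S" and \<beta>: "bilin S \<beta>"
begin

lemma bilin_closed: "x \<in> carrier M \<times> carrier P \<Longrightarrow> \<beta> x \<in> carrier S"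
  using \<beta> lm_closed by (fastforce simp: bilin_def)

lemma bilin_rel: "r \<in> tensor_relations M P \<Longrightarrow> free_lift S \<beta> r = \<zero>\<^bsub>S\<^esub>"
proof -
  interpret S: kmodule S by (rule S)
  have L: "(\<lambda>a. \<beta> (a, b)) \<in> linear_maps M S" if "b \<in> carrier P" for b using \<beta> that by (auto simp: bilin_def)
  have R: "(\<lambda>b. \<beta> (a, b)) \<in> linear_maps P S" if "a \<in> carrier M" for a using \<beta> that by (auto simp: bilin_def)
  note d = free_lift_diff[OF S bilin_closed]
  have cl: "\<beta> (a, b) \<in> carrier S" if "a \<in> carrier M" "b \<in> carrier P" for a b
    using bilin_closed[of "(a, b)"] that by simp
  show "r \<in> tensor_relations M P \<Longrightarrow> free_lift S \<beta> r = \<zero>\<^bsub>S\<^esub>"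
    unfolding tensor_relations_def
    by (auto simp: d keys_minus_subset keys_single_subset S cl lm_add[OF L] lm_add[OF R] lm_smul[OF L] lm_smul[OF R]
        S.add_minus_cancel2 S.minus_self)
qed

lemmas tensor_lift_lm = T.lift_lm[OF S bilin_closed bilin_rel, unfolded T_Q]

lemma tensor_lift_pure: "a \<in> carrier M \<Longrightarrow> b \<in> carrier P \<Longrightarrow> tensor_lift S \<beta> (pt a b) = \<beta> (a, b)"
  using T.lift_gen[OF S bilin_closed bilin_rel, of "(a, b)"] by (simp add: T_gen)

end

lemma tensor_induct [consumes 1, case_names pure add]:
  assumes "x \<in> carrier (tensor M P)"
    and p: "\<And>a b. a \<in> carrier M \<Longrightarrow> b \<in> carrier P \<Longrightarrow> R (pt a b)"
    and "\<And>x y. x \<in> carrier (tensor M P) \<Longrightarrow> y \<in> carrier (tensor M P) \<Longrightarrow> R x \<Longrightarrow> R y \<Longrightarrow> R (x \<oplus>\<^bsub>tensor M P\<^esub> y)"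
  shows "R x"
proof (rule T.quot_induct[unfolded T_Q, OF assms(1)])
  show "R \<zero>\<^bsub>tensor M P\<^esub>" using p[of "\<zero>\<^bsub>M\<^esub>" "\<zero>\<^bsub>P\<^esub>"] by simp
  show "R (c \<odot>\<^bsub>tensor M P\<^esub> T.gen b)" if "b \<in> carrier M \<times> carrier P" for b c
    using that p[of "c \<odot>\<^bsub>M\<^esub> fst b" "snd b"] by (auto simp: T_gen pt_smul_left)
qed (use assms in auto)

end

locale bialg = M: kalgebra M + P: kalgebra P
  for M :: "('k::comm_ring_1, 'a) module" and P :: "('k, 'b) module"
begin

sublocale bimod M P by unfold_locales

lemma Fr_kalgebra: "kalgebra T.Fr"
  unfolding T.Fr_def monoid_algebra_def
  by (rule twisted_kalgebra) (auto simp: M.m_assoc P.m_assoc)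

sublocale TF: kalgebra T.Fr by (rule Fr_kalgebra)

abbreviation (input) "mm \<equiv> tmul (\<lambda>(a, b) (a', b'). (a \<otimes>\<^bsub>M\<^esub> a', b \<otimes>\<^bsub>P\<^esub> b')) (\<lambda>_ _. 1)"

lemma Fr_mult: "monoid.mult T.Fr = mm"
  by (simp add: T.Fr_def monoid_algebra_def)

text \<open>Multiplication by a pair sends pairs to pairs and becomes bilinear after projection to
  the tensor product. By the universal property the composite vanishes on \<open>T.Z\<close>, on
  either side, so no relation has to be multiplied out.\<close>

lemma Z_ideal: "ideal T.Z T.Fr"
proof -
  have V: "pm.subspace T.Z"
    using TF.submodule_zero[OF T.sub] TF.submodule_add[OF T.sub] TF.submodule_smul[OF T.sub]
    by (intro pm.subspaceI) auto
  have F_in: "F z \<in> T.Z"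
    if F: "plin F" "\<And>b. b \<in> carrier M \<times> carrier P \<Longrightarrow> F (single b 1) = single (u b) 1"
      and u: "\<And>b. b \<in> carrier M \<times> carrier P \<Longrightarrow> u b \<in> carrier M \<times> carrier P"
      and bil: "bilin (tensor M P) (\<lambda>b. T.gen (u b))" and z: "z \<in> T.Z" for F u z
  proof -
    have k: "keys (F f) \<subseteq> carrier M \<times> carrier P" if "keys f \<subseteq> carrier M \<times> carrier P" for f
      using plin_in[OF F(1) keys_subspace that] F(2) u by auto
    have kz: "keys z \<subseteq> carrier M \<times> carrier P" using T.a_Hcarr[OF z] by simp
    have "T.Z +>\<^bsub>T.Fr\<^esub> F z = free_lift (tensor M P) (\<lambda>b. T.gen (u b)) z"
    proof (rule lm_eqI_keys[OF _ free_lift_lm[OF TM.kmodule_axioms] TM.kmodule_axioms _ kz])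
      show "(\<lambda>f. T.Z +>\<^bsub>T.Fr\<^esub> F f) \<in> linear_maps (twisted_algebra (carrier M \<times> carrier P) undefined undefined undefined) (tensor M P)"
        using T.quot_add[symmetric] T.quot_smul[symmetric] T.coset_closed
        by (intro linear_mapsI) (simp_all add: k plin_add[OF F(1)] plin_scale[OF F(1)] flip: T_Q)
    qed (use F(2) u T.gen_closed[unfolded T_Q] in \<open>simp_all add: T.gen_def TM.kmodule_axioms\<close>)
    also have "\<dots> = T.Z"
      using T.lift_zero[OF TM.kmodule_axioms bilin_closed[OF TM.kmodule_axioms bil] bilin_rel[OF TM.kmodule_axioms bil] z]
        T.quot_zero by (simp add: T_Q)
    finally show ?thesis using T.coset_zero_iff k[OF kz] by simp
  qed
  have left1: "mm (single b 1) z \<in> T.Z" if b: "b \<in> carrier M \<times> carrier P" and z: "z \<in> T.Z" for b z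
  proof (rule F_in[of _ "\<lambda>c. (fst b \<otimes>\<^bsub>M\<^esub> fst c, snd b \<otimes>\<^bsub>P\<^esub> snd c)", OF tmul_right _ _ _ z])
    have b': "fst b \<in> carrier M" "snd b \<in> carrier P" using b by auto
    show "bilin (tensor M P) (\<lambda>c. T.gen (fst b \<otimes>\<^bsub>M\<^esub> fst c, snd b \<otimes>\<^bsub>P\<^esub> snd c))"
      unfolding bilin_def T_gen fst_conv snd_conv
      by (intro conjI ballI linear_mapsI)
        (simp_all add: b' M.r_distr P.r_distr M.smul_mult_right P.smul_mult_right
          pt_add_left pt_add_right pt_smul_left pt_smul_right)
  qed (use b in \<open>auto simp: case_prod_beta\<close>)
  have left: "mm f z \<in> T.Z" if "keys f \<subseteq> carrier M \<times> carrier P" "z \<in> T.Z" for f z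
    by (rule plin_in[OF tmul_left V that(1) left1[OF _ that(2)]])
  have right1: "mm z (single b 1) \<in> T.Z" if b: "b \<in> carrier M \<times> carrier P" and z: "z \<in> T.Z" for b z
  proof (rule F_in[of _ "\<lambda>c. (fst c \<otimes>\<^bsub>M\<^esub> fst b, snd c \<otimes>\<^bsub>P\<^esub> snd b)", OF tmul_left _ _ _ z])
    have b': "fst b \<in> carrier M" "snd b \<in> carrier P" using b by auto
    show "bilin (tensor M P) (\<lambda>c. T.gen (fst c \<otimes>\<^bsub>M\<^esub> fst b, snd c \<otimes>\<^bsub>P\<^esub> snd b))"
      unfolding bilin_def T_gen fst_conv snd_conv
      by (intro conjI ballI linear_mapsI)
        (simp_all add: b' M.l_distr P.l_distr M.smul_mult_left P.smul_mult_left
          pt_add_left pt_add_right pt_smul_left pt_smul_right)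
  qed (use b in \<open>auto simp: case_prod_beta\<close>)
  have right: "mm z f \<in> T.Z" if "keys f \<subseteq> carrier M \<times> carrier P" "z \<in> T.Z" for f z
    by (rule plin_in[OF tmul_right V that(1) right1[OF _ that(2)]])
  show ?thesis
    by (rule idealI[OF TF.ring_axioms submodule.axioms(1)[OF T.sub]]) (simp_all add: Fr_mult left right)
qed

sublocale TQ: kquot_alg T.Fr T.Z
  by (rule kquot_alg.intro[OF TF.kalgebra_axioms kquot_alg_axioms.intro[OF Z_ideal]])

lemma tensor_kalgebra: "kalgebra (tensor M P)"
  using TQ.quot_kalgebra by (simp add: T_Q)

sublocale TA: kalgebra "tensor M P" by (rule tensor_kalgebra)

lemma pt_mult: "a \<in> carrier M \<Longrightarrow> a' \<in> carrier M \<Longrightarrow> b \<in> carrier P \<Longrightarrow> b' \<in> carrier P \<Longrightarrow>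
    pt a b \<otimes>\<^bsub>tensor M P\<^esub> pt a' b' = pt (a \<otimes>\<^bsub>M\<^esub> a') (b \<otimes>\<^bsub>P\<^esub> b')"
  using TQ.quot_mult[of "single (a, b) 1" "single (a', b') 1"]
  by (simp add: T_Q T_gen[symmetric] T.gen_def Fr_mult)

lemma pt_one: "\<one>\<^bsub>tensor M P\<^esub> = pt \<one>\<^bsub>M\<^esub> \<one>\<^bsub>P\<^esub>"
  using TQ.quot_one by (simp add: T_Q T_gen[symmetric] T.gen_def) (simp add: T.Fr_def monoid_algebra_def)

end

subsection \<open>Tensor products of families\<close>

locale multimod =
  fixes J :: "'j set" and M :: "'j \<Rightarrow> ('k::comm_ring_1, 'a) module"
  assumes fin: "finite J" and mods: "\<And>j. j \<in> J \<Longrightarrow> kmodule (M j)"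
begin

abbreviation "Bs \<equiv> \<Pi>\<^sub>E i\<in>J. carrier (M i)"

lemma upd: "y \<in> Bs \<Longrightarrow> j \<in> J \<Longrightarrow> a \<in> carrier (M j) \<Longrightarrow> y(j := a) \<in> Bs"
  by (auto simp: PiE_iff extensional_def)

lemma add_cl: "j \<in> J \<Longrightarrow> a \<in> carrier (M j) \<Longrightarrow> a' \<in> carrier (M j) \<Longrightarrow> a \<oplus>\<^bsub>M j\<^esub> a' \<in> carrier (M j)"
  using abelian_groupE(1) mods kmodule_def module_def by metis

lemma smul_cl: "j \<in> J \<Longrightarrow> a \<in> carrier (M j) \<Longrightarrow> c \<odot>\<^bsub>M j\<^esub> a \<in> carrier (M j)"
  using kmodule.smul_closed[OF mods] by blast

lemma presented: "presented Bs (multi_relations J M)"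
proof (rule presented.intro, rule subsetI)
  fix r assume "r \<in> multi_relations J M"
  then show "r \<in> {f. keys f \<subseteq> Bs}"
    unfolding multi_relations_def
    by (elim UnE CollectE exE conjE; hypsubst; intro CollectI keys_minus_subset keys_single_subset upd; blast intro: add_cl smul_cl)
qed

end

sublocale multimod \<subseteq> T: presented Bs "\<lambda>y z. \<lambda>i\<in>J. y i \<otimes>\<^bsub>M i\<^esub> z i" "\<lambda>i\<in>J. \<one>\<^bsub>M i\<^esub>" "multi_relations J M"
  by (rule presented)

context multimod
begin

lemma T_Q: "T.Q = multi_tensor J M"
  by (simp add: multi_tensor_def T.Z_def T.Fr_def free_on_families_def)

sublocale TM: kmodule "multi_tensor J M"
  using T.quot_kmodule by (simp add: T_Q)

lemma gen_closed [simp, intro]: "y \<in> Bs \<Longrightarrow> T.gen y \<in> carrier (multi_tensor J M)"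
  using T.gen_closed by (simp add: T_Q)

lemma gen_lm:
  assumes "y \<in> Bs" "j \<in> J"
  shows "(\<lambda>a. T.gen (y(j := a))) \<in> linear_maps (M j) (multi_tensor J M)"
proof (rule linear_mapsI)
  fix a a' assume a: "a \<in> carrier (M j)" "a' \<in> carrier (M j)"
  show "T.gen (y(j := a)) \<in> carrier (multi_tensor J M)" using upd assms a by blast
  note u = upd[OF assms a(1)] upd[OF assms a(2)] upd[OF assms add_cl[OF assms(2) a]]
  have "T.Z +>\<^bsub>T.Fr\<^esub> single (y(j := a \<oplus>\<^bsub>M j\<^esub> a')) 1 =
    T.Z +>\<^bsub>T.Fr\<^esub> (single (y(j := a)) 1 + single (y(j := a')) 1)"
  proof (rule T.coset_eqI)
    show "single (y(j := a \<oplus>\<^bsub>M j\<^esub> a')) 1 -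
      (single (y(j := a)) 1 + single (y(j := a')) 1) \<in> multi_relations J M"
      using assms a unfolding multi_relations_def diff_diff_add[symmetric] by blast
  qed (use u in \<open>auto dest!: subsetD[OF keys_add] split: if_splits\<close>)
  then show "T.gen (y(j := a \<oplus>\<^bsub>M j\<^esub> a')) = T.gen (y(j := a)) \<oplus>\<^bsub>multi_tensor J M\<^esub> T.gen (y(j := a'))"
    using T.quot_add[of "single (y(j := a)) 1" "single (y(j := a')) 1"] u
    by (simp add: T_Q T.gen_def)
next
  fix c a assume a: "a \<in> carrier (M j)"
  note u = upd[OF assms a(1)] upd[OF assms smul_cl[OF assms(2) a]]
  have "T.Z +>\<^bsub>T.Fr\<^esub> single (y(j := c \<odot>\<^bsub>M j\<^esub> a)) 1 = T.Z +>\<^bsub>T.Fr\<^esub> single (y(j := a)) c"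
  proof (rule T.coset_eqI)
    show "single (y(j := c \<odot>\<^bsub>M j\<^esub> a)) 1 - single (y(j := a)) c \<in> multi_relations J M"
      using assms a unfolding multi_relations_def by blast
  qed (use u in auto)
  then show "T.gen (y(j := c \<odot>\<^bsub>M j\<^esub> a)) = c \<odot>\<^bsub>multi_tensor J M\<^esub> T.gen (y(j := a))"
    using T.quot_smul[of "single (y(j := a)) 1" c] u
    by (simp add: T_Q T.gen_def)
qed

context
  fixes S :: "('k, 'c) module" and \<beta>
  assumes S: "kmodule S" and \<beta>: "\<And>y j. y \<in> Bs \<Longrightarrow> j \<in> J \<Longrightarrow> (\<lambda>a. \<beta> (y(j := a))) \<in> linear_maps (M j) S"
    and cl: "\<And>y. y \<in> Bs \<Longrightarrow> \<beta> y \<in> carrier S"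
begin

lemma multi_rel: "r \<in> multi_relations J M \<Longrightarrow> free_lift S \<beta> r = \<zero>\<^bsub>S\<^esub>"
proof -
  interpret S: kmodule S by (rule S)
  note d = free_lift_diff[OF S cl]
  show "r \<in> multi_relations J M \<Longrightarrow> free_lift S \<beta> r = \<zero>\<^bsub>S\<^esub>"
    unfolding multi_relations_def
    by (auto simp: d keys_minus_subset keys_single_subset S cl lm_add[OF \<beta>] lm_smul[OF \<beta>] upd add_cl smul_cl
        S.add_minus_cancel2 S.minus_self simp del: fun_upd_apply keys_single)
qed

lemmas multi_lift_lm = T.lift_lm[OF S cl multi_rel, unfolded T_Q]
lemmas multi_lift_gen = T.lift_gen[OF S cl multi_rel]

end

text \<open>\<open>K\<close> collects the slots whose entry is still arbitrary, the others holding
  generators. A slot is released by observing that its admissible entries form a submodule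
  containing the generators.\<close>

lemma multi_span:
  assumes W: "submodule W ring_of_type_algebra (multi_tensor J M)"
    and G: "\<And>j. j \<in> J \<Longrightarrow> G j \<subseteq> carrier (M j)" "\<And>j. j \<in> J \<Longrightarrow> carrier (M j) \<subseteq> gen_submodule (M j) (G j)"
    and "\<And>y. y \<in> (\<Pi>\<^sub>E i\<in>J. G i) \<Longrightarrow> T.gen y \<in> W"
  shows "carrier (multi_tensor J M) \<subseteq> W"
proof -
  have *: "T.gen y \<in> W" if "y \<in> Bs" "\<And>i. i \<in> J - K \<Longrightarrow> y i \<in> G i" "finite K" "K \<subseteq> J" for y K
    using that(3,4,1,2)
  proof (induction K arbitrary: y)
    case empty
    then have "y \<in> (\<Pi>\<^sub>E i\<in>J. G i)" by (auto simp: PiE_iff)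
    then show ?case by (rule assms(4))
  next
    case (insert j K)
    then have j: "j \<in> J" by auto
    interpret Mj: kmodule "M j" using mods[OF j] .
    let ?U = "{a \<in> carrier (M j). T.gen (y(j := a)) \<in> W}"
    note lm = gen_lm[OF insert.prems(2) j]
    have "submodule ?U ring_of_type_algebra (M j)"
    proof (rule Mj.submoduleI')
      show "\<zero>\<^bsub>M j\<^esub> \<in> ?U"
        using lm_zero[OF lm Mj.kmodule_axioms TM.kmodule_axioms] TM.submodule_zero[OF W] by simp
      show "a \<oplus>\<^bsub>M j\<^esub> b \<in> ?U" if "a \<in> ?U" "b \<in> ?U" for a b
        using that lm_add[OF lm] TM.submodule_add[OF W] by simp
      show "c \<odot>\<^bsub>M j\<^esub> a \<in> ?U" if "a \<in> ?U" for a c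
        using that lm_smul[OF lm] TM.submodule_smul[OF W] by simp
    qed auto
    moreover have "G j \<subseteq> ?U"
    proof
      fix a assume a: "a \<in> G j"
      then have "a \<in> carrier (M j)" using G(1)[OF j] by auto
      then have "T.gen (y(j := a)) \<in> W"
        using insert.prems insert.hyps a by (intro insert.IH upd j) auto
      with \<open>a \<in> carrier (M j)\<close> show "a \<in> ?U" by simp
    qed
    ultimately have "carrier (M j) \<subseteq> ?U"
      using G(2)[OF j] gen_submodule_minimal by blast
    moreover have "y j \<in> carrier (M j)" using insert.prems(2) j by auto
    ultimately have "T.gen (y(j := y j)) \<in> W" by blast
    then show ?case by (simp only: fun_upd_triv)
  qed
  show ?thesis
  proof
    fix x assume "x \<in> carrier (multi_tensor J M)"
    then show "x \<in> W"
    proof (rule T.quot_induct[unfolded T_Q])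
      show "c \<odot>\<^bsub>multi_tensor J M\<^esub> T.gen b \<in> W" if "b \<in> Bs" for b c
        using that by (intro TM.submodule_smul[OF W] *[OF _ _ fin]) auto
    qed (auto intro: TM.submodule_zero[OF W] TM.submodule_add[OF W])
  qed
qed

end

section \<open>Normal forms in the bosonization\<close>

text \<open>Multiplying \<open>p r q\<close> by a further basis element only changes
  \<open>p\<close> or \<open>q\<close> and a scalar, so the span of these products is already the
  two-sided ideal. Statements about ideals thus become statements about linear maps on a spanning
  set.\<close>

lemma span_mult_closed:
  fixes m :: "'b \<Rightarrow> 'b \<Rightarrow> 'b" and t :: "'b \<Rightarrow> 'b \<Rightarrow> 'k::comm_ring_1" and e :: 'b
  assumes "kalgebra (twisted_algebra UNIV m t e :: ('k, 'b \<Rightarrow>\<^sub>0 'k) module)"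
  defines "V G \<equiv> pm.span {tmul m t (tmul m t (single p 1) r) (single q 1) | p q r. r \<in> G}"
  shows span_mult_left: "x \<in> V G \<Longrightarrow> tmul m t f x \<in> V G"
    and span_mult_right: "x \<in> V G \<Longrightarrow> tmul m t x f \<in> V G"
    and span_mult_base: "r \<in> G \<Longrightarrow> r \<in> V G"
    and genideal_span: "genideal (twisted_algebra UNIV m t e) G = V G"
proof -
  interpret A: kalgebra "twisted_algebra UNIV m t e :: ('k, 'b \<Rightarrow>\<^sub>0 'k) module" by fact
  have assoc: "tmul m t (tmul m t f h) l = tmul m t f (tmul m t h l)" for f h l using A.m_assoc by simp
  have V: "pm.subspace (V G)" unfolding V_def by (rule pm.subspace_span)
  have L: "tmul m t f x \<in> V G" if "x \<in> V G" for f x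
  proof (rule plin_in[OF tmul_left V subset_UNIV])
    fix p'
    show "tmul m t (single p' 1) x \<in> V G"
    proof (rule plin_span[OF tmul_right that[unfolded V_def] _ V])
      fix s assume "s \<in> {tmul m t (tmul m t (single p 1) r) (single q 1) | p q r. r \<in> G}"
      then obtain p q r where s: "s = tmul m t (tmul m t (single p 1) r) (single q 1)" "r \<in> G"
        by blast
      have "tmul m t (single p' 1) s =
        scale (t p' p) (tmul m t (tmul m t (single (m p' p) 1) r) (single q 1))"
        unfolding s by (simp flip: assoc plin_scale[OF tmul_left])
      moreover have "tmul m t (tmul m t (single (m p' p) 1) r) (single q 1) \<in> V G"
        unfolding V_def by (rule pm.span_base) (use s in blast)
      ultimately show "tmul m t (single p' 1) s \<in> V G"
        using pm.subspace_scale[OF V] by simp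
    qed
  qed
  have Rt: "tmul m t x f \<in> V G" if "x \<in> V G" for f x
  proof (rule plin_in[OF tmul_right V subset_UNIV])
    fix p'
    show "tmul m t x (single p' 1) \<in> V G"
    proof (rule plin_span[OF tmul_left that[unfolded V_def] _ V])
      fix s assume "s \<in> {tmul m t (tmul m t (single p 1) r) (single q 1) | p q r. r \<in> G}"
      then obtain p q r where s: "s = tmul m t (tmul m t (single p 1) r) (single q 1)" "r \<in> G"
        by blast
      have "tmul m t s (single p' 1) =
        scale (t q p') (tmul m t (tmul m t (single p 1) r) (single (m q p') 1))"
        unfolding s by (simp add: assoc flip: plin_scale[OF tmul_right])
      moreover have "tmul m t (tmul m t (single p 1) r) (single (m q p') 1) \<in> V G"
        unfolding V_def by (rule pm.span_base) (use s in blast)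
      ultimately show "tmul m t s (single p' 1) \<in> V G"
        using pm.subspace_scale[OF V] by simp
    qed
  qed
  have B: "r \<in> V G" if "r \<in> G" for r
  proof -
    have "tmul m t (tmul m t (single e 1) r) (single e 1) = r"
      using A.l_one[of r] A.r_one[of r] by simp
    moreover have "tmul m t (tmul m t (single e 1) r) (single e 1) \<in> V G"
      unfolding V_def by (rule pm.span_base) (use that in blast)
    ultimately show ?thesis by simp
  qed
  show "x \<in> V G \<Longrightarrow> tmul m t f x \<in> V G" "x \<in> V G \<Longrightarrow> tmul m t x f \<in> V G" "r \<in> G \<Longrightarrow> r \<in> V G"
    by (fact L Rt B)+
  have "submodule (V G) ring_of_type_algebra (twisted_algebra UNIV m t e)"
    by (rule A.submoduleI') (auto intro: pm.subspace_0[OF V] pm.subspace_add[OF V] pm.subspace_scale[OF V])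
  then have "ideal (V G) (twisted_algebra UNIV m t e)"
    by (intro idealI A.ring_axioms submodule.axioms(1)) (auto intro: L Rt)
  then have "genideal (twisted_algebra UNIV m t e) G \<subseteq> V G"
    by (rule A.genideal_minimal) (use B in blast)
  moreover have "V G \<subseteq> genideal (twisted_algebra UNIV m t e) G"
  proof -
    let ?I = "genideal (twisted_algebra UNIV m t e :: ('k, 'b \<Rightarrow>\<^sub>0 'k) module) G"
    interpret I: ideal ?I "twisted_algebra UNIV m t e :: ('k, 'b \<Rightarrow>\<^sub>0 'k) module"
      by (rule A.genideal_ideal) simp
    interpret I: kquot_alg "twisted_algebra UNIV m t e :: ('k, 'b \<Rightarrow>\<^sub>0 'k) module" ?I
      by (rule kquot_alg.intro[OF A.kalgebra_axioms kquot_alg_axioms.intro[OF I.is_ideal]])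
    have "pm.subspace ?I"
      using A.submodule_zero[OF I.sub] A.submodule_add[OF I.sub] A.submodule_smul[OF I.sub]
      by (intro pm.subspaceI) auto
    moreover have "G \<subseteq> ?I" by (rule A.genideal_self) simp
    then have "{tmul m t (tmul m t (single p 1) r) (single q 1) | p q r. r \<in> G} \<subseteq> ?I"
      using I.I_l_closed I.I_r_closed by auto
    ultimately show ?thesis unfolding V_def by (intro pm.span_minimal)
  qed
  ultimately show "genideal (twisted_algebra UNIV m t e) G = V G" by blast
qed

locale yetter_drinfeld =
  fixes \<chi> :: "'i::finite \<Rightarrow> 'g::ab_group_add \<Rightarrow> 'k::comm_ring_1"
    and g :: "'i \<Rightarrow> 'g"
  assumes char: "is_character (\<chi> i)"
begin

lemma char_add: "\<chi> i (a + b) = \<chi> i a * \<chi> i b"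
  using char by (auto simp: is_character_def)

lemma char_zero [simp]: "\<chi> i 0 = 1"
proof -
  obtain u where u: "\<chi> i 0 * u = 1" using char[of i] by (auto simp: is_character_def dvd_def) metis
  have "\<chi> i 0 = \<chi> i 0 * (\<chi> i 0 * u)" using u by simp
  also have "\<dots> = \<chi> i (0 + 0) * u" by (simp only: char_add mult.assoc)
  finally show ?thesis using u by simp
qed

lemma char_neg: "\<chi> i a * \<chi> i (- a) = 1" "\<chi> i (- a) * \<chi> i a = 1"
  by (simp_all flip: char_add)

lemma word_char_simps [simp]:
  "word_char \<chi> [] a = 1" "word_char \<chi> (i # w) a = \<chi> i a * word_char \<chi> w a"
  "word_char \<chi> (u @ v) a = word_char \<chi> u a * word_char \<chi> v a"
  by (simp_all add: word_char_def)

lemma word_char_add: "word_char \<chi> w (a + b) = word_char \<chi> w a * word_char \<chi> w b"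
  by (induction w) (simp_all add: char_add mult_ac)

lemma word_char_zero [simp]: "word_char \<chi> w 0 = 1"
  by (induction w) simp_all

lemma word_degree_simps [simp]:
  "word_degree g [] = 0" "word_degree g (i # w) = g i + word_degree g w"
  "word_degree g (u @ v) = word_degree g u + word_degree g v"
  by (simp_all add: word_degree_def)

abbreviation star (infixl "\<star>" 70) where
  "star \<equiv> tmul (\<lambda>(u, a) (v, b). (u @ v, a + b)) (\<lambda>(u, a :: 'g) (v, b :: 'g). word_char \<chi> v a)"

abbreviation mn :: "'i list \<Rightarrow> 'g \<Rightarrow> ('i list \<times> 'g \<Rightarrow>\<^sub>0 'k)" where
  "mn u a \<equiv> single (u, a) 1"

lemma F_simps [simp]:
  "carrier (F_alg \<chi>) = UNIV" "monoid.mult (F_alg \<chi>) = star" "ring.add (F_alg \<chi>) = (+)"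
  "ring.zero (F_alg \<chi>) = 0" "monoid.one (F_alg \<chi>) = mn [] 0" "module.smult (F_alg \<chi>) = scale"
  by (simp_all add: F_alg_def)

lemma F_kalgebra: "kalgebra (F_alg \<chi>)"
  unfolding F_alg_def
  by (rule twisted_kalgebra) (auto simp: add.assoc word_char_add mult_ac)

sublocale F: kalgebra "F_alg \<chi>" by (rule F_kalgebra)

lemma F_neg [simp]: "\<ominus>\<^bsub>F_alg \<chi>\<^esub> f = - f"
  by (simp add: F_alg_def a_inv_twisted)

lemma star_assoc: "(f \<star> h) \<star> k = f \<star> (h \<star> k)"
  using F.m_assoc by simp

lemma star_one [simp]: "mn [] 0 \<star> f = f" "f \<star> mn [] 0 = f"
  using F.l_one F.r_one by simp_all

lemmas star_lin = plin_add[OF tmul_left] plin_add[OF tmul_right] plin_diff[OF tmul_left] plin_diff[OF tmul_right]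
  plin_scale[OF tmul_left] plin_scale[OF tmul_right] plin_sum[OF tmul_left] plin_sum[OF tmul_right]
  plin_zero[OF tmul_left] plin_zero[OF tmul_right]

definition idl :: "('i list \<times> 'g \<Rightarrow>\<^sub>0 'k) set \<Rightarrow> ('i list \<times> 'g \<Rightarrow>\<^sub>0 'k) set" where
  "idl G = pm.span {mn u a \<star> r \<star> mn v b | u a v b r. r \<in> G}"

lemma idl_eq: "idl G = pm.span {single p 1 \<star> r \<star> single q 1 | p q r. r \<in> G}"
  unfolding idl_def by (rule arg_cong[where f = pm.span]) auto

lemmas idl_left = span_mult_left[OF F_kalgebra[unfolded F_alg_def], folded idl_eq]
  and idl_right = span_mult_right[OF F_kalgebra[unfolded F_alg_def], folded idl_eq]
  and idl_base = span_mult_base[OF F_kalgebra[unfolded F_alg_def], folded idl_eq]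
  and genideal_idl = genideal_span[OF F_kalgebra[unfolded F_alg_def], folded idl_eq F_alg_def]

lemma idl_subspace: "pm.subspace (idl G)"
  unfolding idl_def by (rule pm.subspace_span)

lemma idl_mono: "G \<subseteq> G' \<Longrightarrow> idl G \<subseteq> idl G'"
  unfolding idl_def by (rule pm.span_mono) blast

lemmas idl_scale = pm.subspace_scale[OF idl_subspace] and idl_sum = pm.subspace_sum[OF idl_subspace]

definition \<iota> :: "('i list \<Rightarrow>\<^sub>0 'k) \<Rightarrow> ('i list \<times> 'g \<Rightarrow>\<^sub>0 'k)" where
  "\<iota> = lin (\<lambda>w. mn w 0)"

lemma TV_to_F: "TV_to_F \<chi> = \<iota>"
  by (simp add: TV_to_F_def \<iota>_def F_alg_def)

lemma \<iota>_plin: "plin \<iota>" unfolding \<iota>_def by (rule lin_plin)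

lemma \<iota>_single [simp]: "\<iota> (single w c) = single (w, 0) c"
  by (simp add: \<iota>_def)

text \<open>Skew derivations: \<open>dd i\<close> is the component of the braided coproduct in \<open>TV \<otimes> k x\<^sub>i\<close>.\<close>

fun dw :: "'i \<Rightarrow> 'i list \<Rightarrow> ('i list \<Rightarrow>\<^sub>0 'k)" where
  "dw i [] = 0"
| "dw i (k # v) = lin (\<lambda>u. single (k # u) 1) (dw i v)
     + (if k = i then single v (word_char \<chi> v (g i)) else 0)"

definition dd :: "'i \<Rightarrow> ('i list \<Rightarrow>\<^sub>0 'k) \<Rightarrow> ('i list \<Rightarrow>\<^sub>0 'k)" where
  "dd i = lin (dw i)"

lemma dd_plin: "plin (dd i)" unfolding dd_def by (rule lin_plin)

lemma dd_single [simp]: "dd i (single w 1) = dw i w"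
  by (simp add: dd_def)

lemma \<iota>_cons: "\<iota> (lin (\<lambda>u. single (k # u) 1) f) = mn [k] 0 \<star> \<iota> f"
  by (rule plin_eq[OF plin_compose[OF \<iota>_plin lin_plin] plin_compose[OF tmul_right \<iota>_plin]]) simp

end

text \<open>\<open>l\<close> stands for \<open>\<lambda>\<close> extended by zero. Its support on
  \<open>\<Xi>\<close> is expressed by the equation \<open>l_char\<close>, which can be used without
  deciding whether a coefficient vanishes. The zero family is another instance, so the results serve
  both \<open>A(\<lambda>)\<close> and \<open>H^0\<close>.\<close>

locale liftings = yetter_drinfeld \<chi> g
  for \<chi> :: "'i::finite \<Rightarrow> 'g::ab_group_add \<Rightarrow> 'k::comm_ring_1" and g :: "'i \<Rightarrow> 'g" +
  fixes blk :: "'i \<Rightarrow> nat" and l :: "'i \<Rightarrow> 'i \<Rightarrow> 'k"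
  assumes qq: "blk i \<noteq> blk j \<Longrightarrow> \<chi> j (g i) * \<chi> i (g j) = 1"
    and l_char: "l i j * (\<chi> i a * \<chi> j a) = l i j"
begin

definition rl where
  "rl i j = mn [i, j] 0 - single ([j, i], 0) (\<chi> j (g i)) - single ([], g i + g j) (l i j)"

definition I' where "I' = idl {rl i j | i j. blk j < blk i}"

lemma I'_subspace: "pm.subspace I'" unfolding I'_def by (rule idl_subspace)

lemmas I'_add = pm.subspace_add[OF I'_subspace] and I'_diff = pm.subspace_diff[OF I'_subspace]
  and I'_scale = pm.subspace_scale[OF I'_subspace] and I'_zero = pm.subspace_0[OF I'_subspace]

lemma I'_mult: "x \<in> I' \<Longrightarrow> f \<star> x \<in> I'" "x \<in> I' \<Longrightarrow> x \<star> f \<in> I'"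
  unfolding I'_def by (rule idl_left, assumption) (rule idl_right)

lemma rl_in: "blk j < blk i \<Longrightarrow> f \<star> rl i j \<star> h \<in> I'"
  unfolding I'_def by (intro idl_left idl_right idl_base) blast

text \<open>
  \<open>ins i\<close> is left multiplication by \<open>x\<^sub>i\<close> followed by straightening, for a normal argument; that these operators
  satisfy the relations (\<open>insr_comm\<close>) replaces the confluence argument.
\<close>

fun ins :: "'i \<Rightarrow> 'i list \<Rightarrow> 'g \<Rightarrow> ('i list \<times> 'g \<Rightarrow>\<^sub>0 'k)" where
  "ins i [] a = mn [i] a"
| "ins i (j # w) a = (if blk i \<le> blk j then mn (i # j # w) a
     else scale (\<chi> j (g i)) (mn [j] 0 \<star> ins i w a) + scale (l i j) (mn [] (g i + g j) \<star> mn w a))"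

definition "insr i = lin (\<lambda>(w, a). ins i w a)"

lemma insr_plin: "plin (insr i)" unfolding insr_def by (rule lin_plin)

lemma insr_mn [simp]: "insr i (mn w a) = ins i w a" by (simp add: insr_def)

lemmas insr_lin = plin_add[OF insr_plin] plin_scale[OF insr_plin] plin_diff[OF insr_plin] plin_zero[OF insr_plin]

lemma insr_cons:
  assumes "blk j < blk i"
  shows "insr i (mn [j] 0 \<star> f) = scale (\<chi> j (g i)) (mn [j] 0 \<star> insr i f) + scale (l i j) (mn [] (g i + g j) \<star> f)"
proof (rule plin_eq[where S = "\<lambda>f. insr i (mn [j] 0 \<star> f)" and T = "\<lambda>f. scale (\<chi> j (g i)) (mn [j] 0 \<star> insr i f) + scale (l i j) (mn [] (g i + g j) \<star> f)"])
  show "plin (\<lambda>f. insr i (mn [j] 0 \<star> f))"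
    by (rule plin_compose[OF insr_plin tmul_right])
  show "plin (\<lambda>f. scale (\<chi> j (g i)) (mn [j] 0 \<star> insr i f) + scale (l i j) (mn [] (g i + g j) \<star> f))"
    by (intro plin_plus plin_const_scale plin_compose[OF tmul_right insr_plin] tmul_right)
  fix b :: "'i list \<times> 'g"
  obtain w a where "b = (w, a)" by force
  then show "insr i (mn [j] 0 \<star> single b 1) =
    scale (\<chi> j (g i)) (mn [j] 0 \<star> insr i (single b 1)) + scale (l i j) (mn [] (g i + g j) \<star> single b 1)"
    using assms by simp
qed

lemma grp_x: "mn [] c \<star> (mn [j] 0 \<star> f) = scale (\<chi> j c) (mn [j] 0 \<star> (mn [] c \<star> f))"
proof -
  have "mn [] c \<star> mn [j] 0 = scale (\<chi> j c) (mn [j] 0 \<star> mn [] c)" by simp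
  then show ?thesis by (simp only: star_assoc[symmetric] star_lin)
qed

lemma l_char': "l i j * (\<chi> i a * (\<chi> j a * x)) = l i j * x"
  using l_char[of i j a] by (metis mult.assoc)

text \<open>A group element passes \<open>ins i\<close> at the cost of \<open>\<chi> i\<close>. The
  term with \<open>l i j\<close> loses two letters and would fall short of the factor
  \<open>\<chi> i c * \<chi> j c\<close>; \<open>l_char\<close> absorbs it.\<close>

lemma grp_ins: "mn [] c \<star> ins i w a = scale (\<chi> i c) (insr i (mn [] c \<star> mn w a))"
proof (induction w arbitrary: a)
  case (Cons j w)
  have s: "mn [] c \<star> mn w a = scale (word_char \<chi> w c) (mn w (c + a))" by simp
  show ?case
  proof (cases "blk i \<le> blk j")
    case True
    then show ?thesis by (simp add: insr_def mult_ac)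
  next
    case False
    have "scale (\<chi> i c) (insr i (mn [] c \<star> mn (j # w) a)) = scale (\<chi> i c * \<chi> j c) (insr i (mn [j] 0 \<star> (mn [] c \<star> mn w a)))"
      by (simp add: insr_lin[symmetric] mult_ac del: insr_mn)
    also have "\<dots> = scale (\<chi> i c * \<chi> j c) (scale (\<chi> j (g i)) (mn [j] 0 \<star> insr i (mn [] c \<star> mn w a))
        + scale (l i j) (mn [] (g i + g j) \<star> (mn [] c \<star> mn w a)))"
      using False by (simp only: insr_cons not_le)
    also have "\<dots> = scale (\<chi> j (g i)) (scale (\<chi> j c) (mn [j] 0 \<star> scale (\<chi> i c) (insr i (mn [] c \<star> mn w a))))
        + scale (l i j * (\<chi> i c * \<chi> j c)) (mn [] (g i + g j) \<star> (mn [] c \<star> mn w a))"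
      by (simp only: star_lin pm.scale_right_distrib pm.scale_scale mult_ac)
    also have "\<dots> = scale (\<chi> j (g i)) (scale (\<chi> j c) (mn [j] 0 \<star> (mn [] c \<star> ins i w a)))
        + scale (l i j) (mn [] (g i + g j) \<star> (mn [] c \<star> mn w a))"
      by (simp only: Cons.IH l_char)
    also have "\<dots> = mn [] c \<star> ins i (j # w) a"
      using False by (simp add: star_lin grp_x[symmetric] add_ac mult_ac)
    finally show ?thesis by simp
  qed
qed (simp add: insr_def)

lemma grp_insr: "mn [] c \<star> insr i f = scale (\<chi> i c) (insr i (mn [] c \<star> f))"
proof (rule plin_eq[where S = "\<lambda>f. mn [] c \<star> insr i f" and T = "\<lambda>f. scale (\<chi> i c) (insr i (mn [] c \<star> f))"])
  show "plin (\<lambda>f. mn [] c \<star> insr i f)" by (rule plin_compose[OF tmul_right insr_plin])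
  show "plin (\<lambda>f. scale (\<chi> i c) (insr i (mn [] c \<star> f)))"
    by (rule plin_const_scale[OF plin_compose[OF insr_plin tmul_right]])
  fix b :: "'i list \<times> 'g"
  show "mn [] c \<star> insr i (single b 1) = scale (\<chi> i c) (insr i (mn [] c \<star> single b 1))"
    using grp_ins by (cases b) (simp del: tmul_single)
qed

text \<open>The bound \<open>A\<close> on the letters records that straightening introduces no new
  ones; later it keeps the factors on the two sides of a relation on their side of its
  block.\<close>

definition nrm :: "'i set \<Rightarrow> ('i list \<times> 'g) set" where
  "nrm A = {(w, a). sorted (map blk w) \<and> set w \<subseteq> A}"

abbreviation NN where "NN A \<equiv> {f :: 'i list \<times> 'g \<Rightarrow>\<^sub>0 'k. keys f \<subseteq> nrm A}"

lemma NN_subspace: "pm.subspace (NN A)" by (rule keys_subspace)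

lemma NN_mono: "A \<subseteq> B \<Longrightarrow> NN A \<subseteq> NN B" by (auto simp: nrm_def)

lemma NN_x:
  assumes "f \<in> NN A" "\<And>i. i \<in> A \<Longrightarrow> blk j \<le> blk i"
  shows "mn [j] 0 \<star> f \<in> NN (insert j A)" "insr j f = mn [j] 0 \<star> f"
proof -
  have f: "keys f \<subseteq> nrm A" using assms by simp
  show "mn [j] 0 \<star> f \<in> NN (insert j A)"
    by (rule plin_in[OF tmul_right NN_subspace f]) (use assms(2) in \<open>fastforce simp: nrm_def\<close>)
  show "insr j f = mn [j] 0 \<star> f"
  proof (rule plin_eqI[OF insr_plin tmul_right _ f])
    fix b assume "b \<in> nrm A"
    then obtain w a where b: "b = (w, a)" "set w \<subseteq> A" by (auto simp: nrm_def)
    then show "insr j (single b 1) = mn [j] 0 \<star> single b 1"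
      using assms(2) by (cases w) auto
  qed
qed

lemma NN_grp:
  assumes "f \<in> NN A" shows "mn [] c \<star> f \<in> NN A"
proof -
  have f: "keys f \<subseteq> nrm A" using assms by simp
  show ?thesis by (rule plin_in[OF tmul_right NN_subspace f]) (auto simp: nrm_def)
qed

lemma ins_NN: "sorted (map blk w) \<Longrightarrow> ins i w a \<in> NN (insert i (set w))"
proof (induction w)
  case (Cons j w)
  show ?case
  proof (cases "blk i \<le> blk j")
    case True
    then show ?thesis using Cons.prems by (auto simp: nrm_def)
  next
    case False
    have "mn [j] 0 \<star> ins i w a \<in> NN (insert j (insert i (set w)))"
      by (rule NN_x(1)) (use Cons False in auto)
    then have 1: "mn [j] 0 \<star> ins i w a \<in> NN (insert i (set (j # w)))" by (simp add: insert_commute)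
    have 2: "mn [] (g i + g j) \<star> mn w a \<in> NN (insert i (set (j # w)))"
      by (rule NN_grp) (use Cons.prems in \<open>auto simp: nrm_def\<close>)
    show ?thesis using False pm.subspace_add[OF NN_subspace pm.subspace_scale[OF NN_subspace 1] pm.subspace_scale[OF NN_subspace 2]]
      by simp
  qed
qed (auto simp: nrm_def)

lemma insr_NN:
  assumes "f \<in> NN A" shows "insr i f \<in> NN (insert i A)"
proof -
  have f: "keys f \<subseteq> nrm A" using assms by simp
  show ?thesis
  proof (rule plin_in[OF insr_plin NN_subspace f])
    fix b assume "b \<in> nrm A"
    then obtain w a where b: "b = (w, a)" "sorted (map blk w)" "set w \<subseteq> A" by (auto simp: nrm_def)
    then show "insr i (single b 1) \<in> NN (insert i A)"
      using ins_NN[OF b(2), of i a] NN_mono[of "insert i (set w)" "insert i A"] by auto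
  qed
qed

text \<open>If no letter of \<open>w\<close> lies below \<open>j\<close>, both sides are read off
  from the definition of \<open>insr\<close>. Otherwise the first letter \<open>k\<close> lies below
  \<open>i\<close> and \<open>j\<close>, and pulling it to the front reduces to a shorter word. The
  terms with \<open>l i k\<close> and \<open>l j k\<close> produced by the two orders of insertion
  agree by \<open>qq\<close> (\<open>e1\<close>, \<open>e2\<close>), and the term with
  \<open>l i j\<close> passes \<open>k\<close> (\<open>e3\<close>).\<close>

lemma insr_comm_word:
  assumes "blk j < blk i"
  shows "sorted (map blk w) \<Longrightarrow> insr i (insr j (mn w a)) =
    scale (\<chi> j (g i)) (insr j (insr i (mn w a))) + scale (l i j) (mn [] (g i + g j) \<star> mn w a)"
proof (induction w)
  case Nil
  have "mn [] a \<in> NN {}" by (auto simp: nrm_def)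
  note 1 = NN_x[OF this, of j] and 2 = insr_NN[OF this, of i]
  from NN_x(2)[OF 2, of j] 1 show ?case using insr_cons[OF assms, of "mn [] a"] assms by simp
next
  case (Cons k w)
  show ?case
  proof (cases "blk j \<le> blk k")
    case True
    have N: "mn (k # w) a \<in> NN (set (k # w))" using Cons.prems by (auto simp: nrm_def)
    have le: "blk j \<le> blk n" if "n \<in> set (k # w)" for n using Cons.prems True that by auto
    have le': "blk j \<le> blk n" if "n \<in> insert i (set (k # w))" for n using le that assms by auto
    show ?thesis
      using NN_x(2)[OF N le] NN_x(2)[OF insr_NN[OF N] le', of i] insr_cons[OF assms, of "mn (k # w) a"] by metis
  next
    case False
    then have kj: "blk k < blk j" and ki: "blk k < blk i" using assms by auto
    let ?f = "mn w a"
    have kf: "mn (k # w) a = mn [k] 0 \<star> ?f" by simp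
    have q1: "\<chi> k (g j) * \<chi> j (g k) = 1" "\<chi> k (g i) * \<chi> i (g k) = 1" "\<chi> j (g i) * \<chi> i (g j) = 1"
      using qq kj ki assms by (metis less_irrefl)+
    have A: "insr i (insr j (mn (k # w) a)) =
       scale (\<chi> k (g j) * \<chi> k (g i)) (mn [k] 0 \<star> insr i (insr j ?f))
       + scale (\<chi> k (g j) * l i k) (mn [] (g i + g k) \<star> insr j ?f)
       + scale (l j k) (insr i (mn [] (g j + g k) \<star> ?f))"
      unfolding kf insr_cons[OF kj] insr_lin insr_cons[OF ki]
      by (simp only: pm.scale_right_distrib pm.scale_scale add.assoc)
    have B: "insr j (insr i (mn (k # w) a)) =
       scale (\<chi> k (g i) * \<chi> k (g j)) (mn [k] 0 \<star> insr j (insr i ?f))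
       + scale (\<chi> k (g i) * l j k) (mn [] (g j + g k) \<star> insr i ?f)
       + scale (l i k) (insr j (mn [] (g i + g k) \<star> ?f))"
      unfolding kf insr_cons[OF kj] insr_lin insr_cons[OF ki]
      by (simp only: pm.scale_right_distrib pm.scale_scale add.assoc)
    have IH: "insr i (insr j ?f) = scale (\<chi> j (g i)) (insr j (insr i ?f)) + scale (l i j) (mn [] (g i + g j) \<star> ?f)"
      using Cons by simp
    have e1: "scale (\<chi> k (g j) * l i k) (mn [] (g i + g k) \<star> insr j ?f)
      = scale (\<chi> j (g i)) (scale (l i k) (insr j (mn [] (g i + g k) \<star> ?f)))"
    proof -
      have "\<chi> k (g j) * l i k * \<chi> j (g i + g k) = \<chi> j (g i) * l i k * (\<chi> k (g j) * \<chi> j (g k))"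
        by (simp add: char_add mult_ac)
      then show ?thesis by (simp only: grp_insr pm.scale_scale q1 mult_1_right)
    qed
    have e2: "scale (\<chi> j (g i)) (scale (\<chi> k (g i) * l j k) (mn [] (g j + g k) \<star> insr i ?f))
      = scale (l j k) (insr i (mn [] (g j + g k) \<star> ?f))"
    proof -
      have "\<chi> j (g i) * (\<chi> k (g i) * l j k * \<chi> i (g j + g k)) = l j k * (\<chi> j (g i) * \<chi> i (g j)) * (\<chi> k (g i) * \<chi> i (g k))"
        by (simp add: char_add mult_ac)
      then show ?thesis by (simp only: grp_insr pm.scale_scale q1 mult_1_right)
    qed
    have e3: "scale (l i j) (mn [] (g i + g j) \<star> mn (k # w) a)
       = scale (\<chi> k (g j) * \<chi> k (g i)) (mn [k] 0 \<star> scale (l i j) (mn [] (g i + g j) \<star> ?f))"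
      unfolding kf grp_x by (simp only: star_lin pm.scale_scale char_add mult_ac)
    have "insr i (insr j (mn (k # w) a)) =
       scale (\<chi> k (g j) * \<chi> k (g i)) (mn [k] 0 \<star> scale (\<chi> j (g i)) (insr j (insr i ?f)))
       + scale (l i j) (mn [] (g i + g j) \<star> mn (k # w) a)
       + scale (\<chi> j (g i)) (scale (l i k) (insr j (mn [] (g i + g k) \<star> ?f)))
       + scale (\<chi> j (g i)) (scale (\<chi> k (g i) * l j k) (mn [] (g j + g k) \<star> insr i ?f))"
      unfolding A e1 e2 e3 IH by (simp only: star_lin pm.scale_right_distrib add_ac)
    also have "\<dots> = scale (\<chi> j (g i)) (insr j (insr i (mn (k # w) a))) + scale (l i j) (mn [] (g i + g j) \<star> mn (k # w) a)"
      unfolding B by (simp only: star_lin pm.scale_right_distrib pm.scale_scale mult_ac add_ac)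
    finally show ?thesis .
  qed
qed

lemma insr_comm:
  assumes "blk j < blk i" "f \<in> NN A"
  shows "insr i (insr j f) = scale (\<chi> j (g i)) (insr j (insr i f)) + scale (l i j) (mn [] (g i + g j) \<star> f)"
proof -
  have f: "keys f \<subseteq> nrm A" using assms by simp
  show ?thesis
  proof (rule plin_eqI[where S = "\<lambda>f. insr i (insr j f)" and T = "\<lambda>f. scale (\<chi> j (g i)) (insr j (insr i f)) + scale (l i j) (mn [] (g i + g j) \<star> f)", OF _ _ _ f])
    show "plin (\<lambda>f. insr i (insr j f))" by (rule plin_compose[OF insr_plin insr_plin])
    show "plin (\<lambda>f. scale (\<chi> j (g i)) (insr j (insr i f)) + scale (l i j) (mn [] (g i + g j) \<star> f))"
      by (intro plin_plus plin_const_scale plin_compose[OF insr_plin insr_plin] tmul_right)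
    fix b assume "b \<in> nrm A"
    then obtain w a where b: "b = (w, a)" "sorted (map blk w)" by (auto simp: nrm_def)
    show "insr i (insr j (single b 1)) = scale (\<chi> j (g i)) (insr j (insr i (single b 1)))
      + scale (l i j) (mn [] (g i + g j) \<star> single b 1)"
      unfolding b(1) by (rule insr_comm_word[OF assms(1) b(2)])
  qed
qed

text \<open>The monomials of \<open>F\<close> act through \<open>insr\<close> and the group
  elements; \<open>nf f\<close> is the result of letting \<open>f\<close> act on the empty word. By
  \<open>nf_I'\<close>, \<open>nf_cong\<close> and \<open>nf_id\<close> it is the projection onto
  \<open>NN UNIV\<close> along \<open>I'\<close>.\<close>

definition nf where "nf = lin (\<lambda>(w, a). foldr insr w (mn [] a))"

lemma nf_plin: "plin nf" unfolding nf_def by (rule lin_plin)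

lemma nf_mn: "nf (mn w a) = foldr insr w (mn [] a)" by (simp add: nf_def)

lemma foldr_insr_plin: "plin (foldr insr u)"
  by (induction u) (auto simp: id_def comp_def intro: plin_id plin_compose insr_plin)

lemma nf_x: "nf (mn [i] 0 \<star> f) = insr i (nf f)"
  by (rule plin_eq[OF plin_compose[OF nf_plin tmul_right] plin_compose[OF insr_plin nf_plin]])
    (auto simp: nf_def)

lemma grp_foldr: "mn [] c \<star> foldr insr w f = scale (word_char \<chi> w c) (foldr insr w (mn [] c \<star> f))"
proof (induction w)
  case (Cons i w)
  then show ?case by (simp only: foldr.simps comp_apply grp_insr insr_lin pm.scale_scale word_char_simps)
qed (simp only: foldr.simps id_apply word_char_simps pm.scale_one)

lemma nf_grp: "nf (mn [] c \<star> f) = mn [] c \<star> nf f"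
  by (rule plin_eq[OF plin_compose[OF nf_plin tmul_right] plin_compose[OF tmul_right nf_plin]])
    (auto simp: nf_def grp_foldr)

lemma nf_NN_word: "nf (mn w a) \<in> NN (set w)"
proof (induction w)
  case Nil
  then show ?case by (auto simp: nf_mn nrm_def)
next
  case (Cons i w)
  then show ?case using insr_NN[OF Cons, of i] by (simp add: nf_mn)
qed

lemma nf_NN: "nf f \<in> NN UNIV"
proof (rule plin_in[OF nf_plin NN_subspace subset_UNIV])
  fix b :: "'i list \<times> 'g"
  show "nf (single b 1) \<in> NN UNIV"
    using subsetD[OF NN_mono[OF subset_UNIV] nf_NN_word] by (cases b) blast
qed

lemma nf_id:
  assumes "f \<in> NN A" shows "nf f = f"
proof -
  have f: "keys f \<subseteq> nrm A" using assms by simp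
  have *: "nf (mn w a) = mn w a" if "sorted (map blk w)" for w a
    using that
  proof (induction w)
    case (Cons i w)
    have "mn w a \<in> NN (set w)" using Cons.prems by (auto simp: nrm_def)
    from NN_x(2)[OF this, of i] have "insr i (mn w a) = mn (i # w) a" using Cons.prems by simp
    then show ?case using Cons by (simp add: nf_mn)
  qed (simp add: nf_mn)
  show ?thesis
    by (rule plin_eqI[OF nf_plin plin_id _ f]) (auto simp: nrm_def *)
qed

lemma nf_mult: "nf (mn u a \<star> f) = foldr insr u (mn [] a \<star> nf f)"
proof -
  have *: "nf (mn u 0 \<star> h) = foldr insr u (nf h)" for h
  proof (induction u)
    case (Cons i u)
    have "mn (i # u) 0 \<star> h = mn [i] 0 \<star> (mn u 0 \<star> h)" by (simp flip: star_assoc)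
    then show ?case by (simp add: nf_x Cons)
  qed simp
  have "mn u a = mn u 0 \<star> mn [] a" by simp
  then have "mn u a \<star> f = mn u 0 \<star> (mn [] a \<star> f)" by (metis star_assoc)
  then show ?thesis by (simp only: * nf_grp)
qed

lemma rl_star: "rl i j \<star> f = mn [i] 0 \<star> (mn [j] 0 \<star> f) - scale (\<chi> j (g i)) (mn [j] 0 \<star> (mn [i] 0 \<star> f))
   - scale (l i j) (mn [] (g i + g j) \<star> f)"
proof -
  have "rl i j = mn [i] 0 \<star> mn [j] 0 - scale (\<chi> j (g i)) (mn [j] 0 \<star> mn [i] 0) - scale (l i j) (mn [] (g i + g j))"
    by (simp add: rl_def)
  then show ?thesis by (simp only: star_lin star_assoc)
qed

text \<open>\<open>nf\<close> turns left multiplication into the operators \<open>insr\<close>, and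
  on the normal element \<open>nf (mn v b)\<close> these satisfy the relation \<open>rl i j\<close>
  by \<open>insr_comm\<close>.\<close>

lemma nf_I': "x \<in> I' \<Longrightarrow> nf x = 0"
proof -
  assume "x \<in> I'"
  then have "nf x \<in> {0}"
    unfolding I'_def idl_def
  proof (rule plin_span[OF nf_plin])
    fix s assume "s \<in> {mn u a \<star> r \<star> mn v b |u a v b r. r \<in> {rl i j |i j. blk j < blk i}}"
    then obtain u a i j v b where s: "s = mn u a \<star> (rl i j \<star> mn v b)" and ij: "blk j < blk i"
      by (auto simp: star_assoc)
    have "nf (rl i j \<star> mn v b) = 0"
      unfolding rl_star using insr_comm[OF ij nf_NN, of "mn v b"]
      by (simp add: plin_diff[OF nf_plin] plin_scale[OF nf_plin] nf_x nf_grp del: tmul_single)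
    then show "nf s \<in> {0}"
      by (simp add: s nf_mult star_lin plin_zero[OF foldr_insr_plin] del: tmul_single)
  qed simp
  then show ?thesis by simp
qed

text \<open>The defect for \<open>j # w\<close> is a multiple of \<open>x\<^sub>j\<close> times the
  defect for \<open>w\<close>, minus a multiple of the relation \<open>rl i j\<close>.\<close>

lemma insr_cong: "insr i f - mn [i] 0 \<star> f \<in> I'"
proof (rule plin_in[OF _ _ subset_UNIV, where T = "\<lambda>f. insr i f - mn [i] 0 \<star> f"])
  show "plin (\<lambda>f. insr i f - mn [i] 0 \<star> f)" by (rule plin_minus[OF insr_plin tmul_right])
  show "pm.subspace I'" by (rule I'_subspace)
  fix b :: "'i list \<times> 'g"
  have "insr i (mn w a) - mn [i] 0 \<star> mn w a \<in> I'" for w a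
  proof (induction w)
    case Nil
    then show ?case by (simp add: I'_zero)
  next
    case (Cons j w)
    show ?case
    proof (cases "blk i \<le> blk j")
      case True
      then show ?thesis by (simp add: I'_zero)
    next
      case False
      have j: "mn (j # w) a = mn [j] 0 \<star> mn w a" by simp
      have "insr i (mn (j # w) a) - mn [i] 0 \<star> mn (j # w) a =
        scale (\<chi> j (g i)) (mn [j] 0 \<star> (insr i (mn w a) - mn [i] 0 \<star> mn w a)) - rl i j \<star> mn w a"
        unfolding j rl_star using insr_cons[of j i "mn w a"] False
        by (simp add: star_lin pm.scale_right_diff_distrib del: tmul_single insr_mn)
      moreover have "mn [] 0 \<star> rl i j \<star> mn w a \<in> I'" by (rule rl_in) (use False in simp)
      then have "rl i j \<star> mn w a \<in> I'" by (simp only: star_one)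
      ultimately show ?thesis
        using I'_diff[OF I'_scale[OF I'_mult(1)[OF Cons]]] by metis
    qed
  qed
  then show "insr i (single b 1) - mn [i] 0 \<star> single b 1 \<in> I'"
    by (cases b) blast
qed

lemma nf_cong: "f - nf f \<in> I'"
proof (rule plin_in[OF _ _ subset_UNIV, where T = "\<lambda>f. f - nf f"])
  show "plin (\<lambda>f. f - nf f)" by (rule plin_minus[OF plin_id nf_plin])
  show "pm.subspace I'" by (rule I'_subspace)
  fix b :: "'i list \<times> 'g"
  have "mn w a - nf (mn w a) \<in> I'" for w a
  proof (induction w)
    case Nil
    then show ?case by (simp add: I'_zero nf_mn)
  next
    case (Cons i w)
    have "mn (i # w) a - nf (mn (i # w) a) = mn [i] 0 \<star> (mn w a - nf (mn w a)) - (insr i (nf (mn w a)) - mn [i] 0 \<star> nf (mn w a))"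
      by (simp add: nf_mn star_lin)
    then show ?case using Cons insr_cong[of i "nf (mn w a)"]
      I'_diff[OF I'_mult(1)[OF Cons]] by metis
  qed
  then show "single b 1 - nf (single b 1) \<in> I'"
    by (cases b) blast
qed

end

section \<open>Commuting a relation past generators of other blocks\<close>

context yetter_drinfeld
begin

lemma word_char_mset: "mset v = mset w \<Longrightarrow> word_char \<chi> v a = word_char \<chi> w a"
  unfolding word_char_def by (metis mset_map prod_mset_prod_list)

lemma word_degree_mset: "mset v = mset w \<Longrightarrow> word_degree g v = word_degree g w"
  unfolding word_degree_def by (metis mset_map sum_mset_sum_list)

text \<open>Braids permute the letters of a word, so the words of \<open>\<xi>(x\<^sub>w)\<close>
  are rearrangements of \<open>w\<close>. Such an element has a single degree in
  \<open>\<Gamma>\<close> and a single character, and in this form the braid group enters the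
  argument.\<close>

definition anagram :: "'i list \<Rightarrow> ('i list \<Rightarrow>\<^sub>0 'k) \<Rightarrow> bool" where
  "anagram w z \<longleftrightarrow> keys z \<subseteq> {v. mset v = mset w}"

lemma anagram_grp:
  assumes "anagram w z"
  shows "mn [] a \<star> \<iota> z = scale (word_char \<chi> w a) (\<iota> z \<star> mn [] a)"
proof (rule plin_eqI[where S = "\<lambda>z. mn [] a \<star> \<iota> z" and T = "\<lambda>z. scale (word_char \<chi> w a) (\<iota> z \<star> mn [] a)"])
  show "plin (\<lambda>z. mn [] a \<star> \<iota> z)" by (rule plin_compose[OF tmul_right \<iota>_plin])
  show "plin (\<lambda>z. scale (word_char \<chi> w a) (\<iota> z \<star> mn [] a))"
    by (rule plin_const_scale[OF plin_compose[OF tmul_left \<iota>_plin]])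
  show "keys z \<subseteq> {v. mset v = mset w}" using assms by (simp add: anagram_def)
  fix v assume "v \<in> {v. mset v = mset w}"
  then have "word_char \<chi> v a = word_char \<chi> w a" by (auto intro: word_char_mset)
  then show "mn [] a \<star> \<iota> (single v 1) = scale (word_char \<chi> w a) (\<iota> (single v 1) \<star> mn [] a)"
    by simp
qed

end

context liftings
begin

text \<open>Each exchange of \<open>x\<^sub>j\<close> with a letter \<open>x\<^sub>i\<close> leaves
  a term with the coefficient \<open>c i\<close> and the group element \<open>g j + g i\<close> in
  place of both letters. Summed over all positions of \<open>i\<close>, with the group element moved
  to the right end, these terms form a skew derivative.\<close>

definition D :: "('i \<Rightarrow> 'k) \<Rightarrow> 'i \<Rightarrow> ('i list \<Rightarrow>\<^sub>0 'k) \<Rightarrow> ('i list \<times> 'g \<Rightarrow>\<^sub>0 'k)" where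
  "D c j z = (\<Sum>i\<in>UNIV. scale (c i) (\<iota> (dd i z) \<star> mn [] (g j + g i)))"

lemma D_plin: "plin (D c j)"
  unfolding D_def
  by (intro plin_setsum plin_const_scale plin_compose[OF tmul_left] plin_compose[OF \<iota>_plin dd_plin])

lemma D_nil [simp]: "D c j (single [] 1) = 0"
  by (simp add: D_def plin_zero[OF \<iota>_plin] star_lin)

lemma D_cons: "D c j (single (k # v) 1) = mn [k] 0 \<star> D c j (single v 1)
   + scale (c k * word_char \<chi> v (g k)) (mn v 0 \<star> mn [] (g j + g k))"
proof -
  have "D c j (single (k # v) 1) = (\<Sum>i\<in>UNIV. scale (c i) (mn [k] 0 \<star> (\<iota> (dw i v) \<star> mn [] (g j + g i)))
     + (if k = i then scale (c i * word_char \<chi> v (g i)) (mn v 0 \<star> mn [] (g j + g i)) else 0))"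
    unfolding D_def by (rule sum.cong[OF HOL.refl])
      (simp add: plin_add[OF \<iota>_plin] \<iota>_cons star_lin star_assoc pm.scale_right_distrib plin_zero[OF \<iota>_plin])
  also have "\<dots> = (\<Sum>i\<in>UNIV. scale (c i) (mn [k] 0 \<star> (\<iota> (dw i v) \<star> mn [] (g j + g i)))) + 
     (\<Sum>i\<in>UNIV. (if k = i then scale (c i * word_char \<chi> v (g i)) (mn v 0 \<star> mn [] (g j + g i)) else 0))"
    by (rule sum.distrib)
  also have "(\<Sum>i\<in>UNIV. scale (c i) (mn [k] 0 \<star> (\<iota> (dw i v) \<star> mn [] (g j + g i)))) = mn [k] 0 \<star> D c j (single v 1)"
    unfolding D_def by (simp add: star_lin)
  finally show ?thesis by simp
qed

lemma grp_word: "mn [] a \<star> mn v 0 = scale (word_char \<chi> v a) (mn v 0 \<star> mn [] a)"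
  by simp

lemma cons_star: "mn (k # v) a = mn [k] 0 \<star> mn v a"
  by simp

text \<open>The outer scalar is the braiding of \<open>x\<^sub>j\<close> with the whole word. It
  would also multiply the correction term, where the factor \<open>\<chi> j (g j)\<close>
  compensates for the letter that has disappeared.\<close>

lemma commute_word_left:
  assumes "\<forall>i\<in>set v. blk i < blk j"
  shows "mn [j] 0 \<star> mn v 0 - scale (word_char \<chi> v (g j)) (mn v 0 \<star> mn [j] 0
    + scale (\<chi> j (g j)) (D (l j) j (single v 1))) \<in> I'"
  using assms
proof (induction v)
  case Nil
  then show ?case by (simp only: star_one D_nil) (simp add: I'_zero)
next
  case (Cons k v)
  let ?R = "\<lambda>v. scale (word_char \<chi> v (g j)) (mn v 0 \<star> mn [j] 0 + scale (\<chi> j (g j)) (D (l j) j (single v 1)))"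
  have kj: "blk k < blk j" using Cons.prems by simp
  have IH: "mn [j] 0 \<star> mn v 0 - ?R v \<in> I'" using Cons by simp
  \<comment> \<open>In the presence of \<open>l j k\<close> the characters of \<open>j\<close> and
    \<open>k\<close> are mutually inverse, so \<open>\<chi> j (g j)\<close> cancels
    \<open>\<chi> k (g j)\<close>.\<close>
  have c: "\<chi> k (g j) * (word_char \<chi> v (g j) * (\<chi> j (g j) * (l j k * word_char \<chi> v (g k)))) =
     l j k * word_char \<chi> v (g j + g k)"
    using l_char'[of j k "g j" "word_char \<chi> v (g j) * word_char \<chi> v (g k)"] by (simp add: word_char_add mult_ac)
  have R: "?R (k # v) = scale (\<chi> k (g j)) (mn [k] 0 \<star> ?R v) + scale (l j k) (mn [] (g j + g k) \<star> mn v 0)"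
    unfolding D_cons grp_word cons_star[of k v] word_char_simps
    by (simp only: star_lin pm.scale_right_distrib pm.scale_scale mult.assoc c star_assoc add.assoc)
  have "mn [j] 0 \<star> mn (k # v) 0 - ?R (k # v) = scale (\<chi> k (g j)) (mn [k] 0 \<star> (mn [j] 0 \<star> mn v 0 - ?R v)) + rl j k \<star> mn v 0"
  proof -
    have ag: "x - (y + u) = (t - y) + (x - t - u)" for x y u t :: "'i list \<times> 'g \<Rightarrow>\<^sub>0 'k" by simp
    show ?thesis
      unfolding R unfolding rl_star cons_star[of k v] star_lin pm.scale_right_diff_distrib by (rule ag)
  qed
  moreover have "rl j k \<star> mn v 0 \<in> I'" using rl_in[OF kj, of "mn [] 0" "mn v 0"] by (simp only: star_one)
  ultimately show ?case using I'_add[OF I'_scale[OF I'_mult(1)[OF IH]]] by metis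
qed

text \<open>The product of \<open>qq\<close> over the letters of \<open>v\<close>; it trades the
  action of the degree of \<open>v\<close> on \<open>x\<^sub>j\<close> for the action of
  \<open>g j\<close> on \<open>v\<close>.\<close>

lemma dual_char:
  assumes "\<forall>i\<in>set v. blk i \<noteq> blk j"
  shows "\<chi> j (word_degree g v) * word_char \<chi> v (g j) = 1"
  using assms
proof (induction v)
  case (Cons k v)
  have "\<chi> j (word_degree g (k # v)) * word_char \<chi> (k # v) (g j) =
    (\<chi> j (g k) * \<chi> k (g j)) * (\<chi> j (word_degree g v) * word_char \<chi> v (g j))"
    by (simp add: char_add mult_ac)
  then show ?case using Cons qq[of k j] by simp
qed simp

lemma commute_word_right:
  assumes "\<forall>i\<in>set v. blk j < blk i"
  shows "mn v 0 \<star> mn [j] 0 - (scale (\<chi> j (word_degree g v)) (mn [j] 0 \<star> mn v 0)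
    + D (\<lambda>i. l i j) j (single v 1)) \<in> I'"
  using assms
proof (induction v)
  case Nil
  then show ?case by (simp only: star_one D_nil) (simp add: I'_zero)
next
  case (Cons k v)
  let ?R = "\<lambda>v. scale (\<chi> j (word_degree g v)) (mn [j] 0 \<star> mn v 0) + D (\<lambda>i. l i j) j (single v 1)"
  have kj: "blk j < blk k" using Cons.prems by simp
  have IH: "mn v 0 \<star> mn [j] 0 - ?R v \<in> I'" using Cons by simp
  have "\<chi> j (word_degree g v) * word_char \<chi> v (g j) = 1"
    by (rule dual_char) (use Cons.prems in auto)
  then have c: "\<chi> j (word_degree g v) * (l k j * word_char \<chi> v (g k + g j)) = l k j * word_char \<chi> v (g k)"
    unfolding word_char_add by (metis (no_types, lifting) mult.assoc mult.commute mult_1_right)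
  have R: "?R (k # v) = mn [k] 0 \<star> ?R v - scale (\<chi> j (word_degree g v)) (rl k j \<star> mn v 0)"
    unfolding D_cons rl_star grp_word cons_star[of k v] 
    by (simp only: star_lin pm.scale_right_distrib pm.scale_right_diff_distrib pm.scale_scale mult.assoc c star_assoc add.assoc
        add.commute[of "g k"] word_degree_simps char_add mult.commute[of "\<chi> j (g k)"])
      (simp add: c[unfolded add.commute[of "g k"]])
  have "mn (k # v) 0 \<star> mn [j] 0 - ?R (k # v) = mn [k] 0 \<star> (mn v 0 \<star> mn [j] 0 - ?R v) + scale (\<chi> j (word_degree g v)) (rl k j \<star> mn v 0)"
  proof -
    have ag: "x - (y - u) = (x - y) + u" for x y u :: "'i list \<times> 'g \<Rightarrow>\<^sub>0 'k" by simp
    show ?thesis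
      unfolding R unfolding cons_star[of k v] star_assoc plin_diff[OF tmul_right] by (rule ag)
  qed
  moreover have "rl k j \<star> mn v 0 \<in> I'" using rl_in[OF kj, of "mn [] 0" "mn v 0"] by (simp only: star_one)
  ultimately show ?case using I'_add[OF I'_mult(1)[OF IH] I'_scale] by metis
qed

definition in_block where "in_block w r z \<longleftrightarrow> anagram w z \<and> (\<forall>i\<in>set w. blk i = r)"

lemma commute_left:
  assumes "in_block w r z" "r < blk j"
  shows "mn [j] 0 \<star> \<iota> z - scale (word_char \<chi> w (g j)) (\<iota> z \<star> mn [j] 0 + scale (\<chi> j (g j)) (D (l j) j z)) \<in> I'"
proof -
  have k: "keys z \<subseteq> {v. mset v = mset w}" using assms(1) by (simp add: in_block_def anagram_def)
  show ?thesis
  proof (rule plin_in[where T = "\<lambda>z. mn [j] 0 \<star> \<iota> z - scale (word_char \<chi> w (g j)) (\<iota> z \<star> mn [j] 0 + scale (\<chi> j (g j)) (D (l j) j z))", OF _ I'_subspace k])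
    show "plin (\<lambda>z. mn [j] 0 \<star> \<iota> z - scale (word_char \<chi> w (g j)) (\<iota> z \<star> mn [j] 0 + scale (\<chi> j (g j)) (D (l j) j z)))"
      by (intro plin_minus plin_const_scale plin_plus D_plin plin_compose[OF tmul_left \<iota>_plin] plin_compose[OF tmul_right \<iota>_plin])
    fix v assume "v \<in> {v. mset v = mset w}"
    then have v: "mset v = mset w" by simp
    then have "\<forall>i\<in>set v. blk i < blk j" using assms by (metis in_block_def set_mset_mset)
    from commute_word_left[OF this] show "mn [j] 0 \<star> \<iota> (single v 1) - scale (word_char \<chi> w (g j))
      (\<iota> (single v 1) \<star> mn [j] 0 + scale (\<chi> j (g j)) (D (l j) j (single v 1))) \<in> I'"
      by (simp only: \<iota>_single word_char_mset[OF v])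
  qed
qed

lemma commute_right:
  assumes "in_block w r z" "blk j < r"
  shows "\<iota> z \<star> mn [j] 0 - (scale (\<chi> j (word_degree g w)) (mn [j] 0 \<star> \<iota> z) + D (\<lambda>i. l i j) j z) \<in> I'"
proof -
  have k: "keys z \<subseteq> {v. mset v = mset w}" using assms(1) by (simp add: in_block_def anagram_def)
  show ?thesis
  proof (rule plin_in[where T = "\<lambda>z. \<iota> z \<star> mn [j] 0 - (scale (\<chi> j (word_degree g w)) (mn [j] 0 \<star> \<iota> z) + D (\<lambda>i. l i j) j z)", OF _ I'_subspace k])
    show "plin (\<lambda>z. \<iota> z \<star> mn [j] 0 - (scale (\<chi> j (word_degree g w)) (mn [j] 0 \<star> \<iota> z) + D (\<lambda>i. l i j) j z))"
      by (intro plin_minus plin_const_scale plin_plus D_plin plin_compose[OF tmul_left \<iota>_plin] plin_compose[OF tmul_right \<iota>_plin])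
    fix v assume "v \<in> {v. mset v = mset w}"
    then have v: "mset v = mset w" by simp
    then have "\<forall>i\<in>set v. blk j < blk i" using assms by (metis in_block_def set_mset_mset)
    from commute_word_right[OF this] show "\<iota> (single v 1) \<star> mn [j] 0 - (scale (\<chi> j (word_degree g w))
      (mn [j] 0 \<star> \<iota> (single v 1)) + D (\<lambda>i. l i j) j (single v 1)) \<in> I'"
      by (simp only: \<iota>_single word_degree_mset[OF v])
  qed
qed

end

text \<open>
  The last assumption is all that is used of primitivity for the normal form:
  skew derivatives of a relation lie in the ideal of the previous stage.
\<close>

locale reduced = liftings \<chi> g blk l
  for \<chi> :: "'i::finite \<Rightarrow> 'g::ab_group_add \<Rightarrow> 'k::comm_ring_1" and g :: "'i \<Rightarrow> 'g"
    and blk :: "'i \<Rightarrow> nat" and l :: "'i \<Rightarrow> 'i \<Rightarrow> 'k" +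
  fixes R :: "('i list \<Rightarrow>\<^sub>0 'k) set" and Rc :: "nat \<Rightarrow> ('i list \<Rightarrow>\<^sub>0 'k) set" and L :: nat
  assumes Rc_0: "Rc 0 = {}" and Rc_L: "Rc L = R" and Rc_R: "h \<le> L \<Longrightarrow> Rc h \<subseteq> R"
    and R_block: "z \<in> R \<Longrightarrow> \<exists>w r. in_block w r z"
    and R_der: "Suc h \<le> L \<Longrightarrow> z \<in> Rc (Suc h) \<Longrightarrow> \<iota> (dd i z) \<in> idl (\<iota> ` Rc h)"
begin

section \<open>The ideal of \<open>A(\<lambda>)\<close> and the normal words\<close>

definition K0 :: "('i list \<times> 'g \<Rightarrow>\<^sub>0 'k) set" where
  "K0 = {mn p 0 \<star> \<iota> z \<star> mn s a | p z s a w r. z \<in> R \<and> in_block w r z \<and> sorted (map blk p) \<and> sorted (map blk s) \<and>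
    (\<forall>i\<in>set p. blk i \<le> r) \<and> (\<forall>i\<in>set s. r \<le> blk i)}"

abbreviation "K \<equiv> pm.span K0"

text \<open>This is \<open>I' + K\<close>. The work lies in showing that it contains every product
  of a relation with elements of \<open>F\<close> on both sides (\<open>I_lam_VK\<close>).\<close>

definition "VK = pm.span (I' \<union> K0)"

lemma VK_subspace: "pm.subspace VK" unfolding VK_def by (rule pm.subspace_span)

lemmas VK_add = pm.subspace_add[OF VK_subspace] and VK_scale = pm.subspace_scale[OF VK_subspace]

lemma I'_VK: "x \<in> I' \<Longrightarrow> x \<in> VK" unfolding VK_def by (rule pm.span_base) simp

lemma VK_cong:
  assumes "x - y \<in> I'" "y \<in> VK" shows "x \<in> VK"
  using VK_add[OF I'_VK[OF assms(1)] assms(2)] by simp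

lemma move_grp:
  assumes "in_block w r z"
  shows "mn p a \<star> \<iota> z \<star> f = scale (word_char \<chi> w a) (mn p 0 \<star> \<iota> z \<star> (mn [] a \<star> f))"
proof -
  have "mn p a = mn p 0 \<star> mn [] a" by simp
  then have "mn p a \<star> \<iota> z \<star> f = mn p 0 \<star> (mn [] a \<star> \<iota> z) \<star> f" by (simp only: star_assoc)
  then show ?thesis
    using anagram_grp[of w z a] assms unfolding in_block_def by (simp only: star_lin star_assoc)
qed

lemma sandwich_normal_VK:
  assumes z: "z \<in> R" "in_block w r z"
    and p: "p \<in> NN A" "\<forall>i\<in>A. blk i \<le> r" and s: "s \<in> NN B" "\<forall>i\<in>B. r \<le> blk i"
  shows "p \<star> \<iota> z \<star> s \<in> VK"
proof -
  have pk: "keys p \<subseteq> nrm A" and sk: "keys s \<subseteq> nrm B" using p s by auto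
  show ?thesis
  proof (rule plin_in[where T = "\<lambda>p. p \<star> \<iota> z \<star> s", OF plin_compose[OF tmul_left tmul_left] VK_subspace pk])
    fix b assume "b \<in> nrm A"
    then obtain u a where b: "b = (u, a)" "sorted (map blk u)" "set u \<subseteq> A" by (auto simp: nrm_def)
    show "single b 1 \<star> \<iota> z \<star> s \<in> VK"
    proof (rule plin_in[where T = "\<lambda>s. single b 1 \<star> \<iota> z \<star> s", OF tmul_right VK_subspace sk])
      fix c assume "c \<in> nrm B"
      then obtain v a' where c: "c = (v, a')" "sorted (map blk v)" "set v \<subseteq> B" by (auto simp: nrm_def)
      have "mn u 0 \<star> \<iota> z \<star> mn v (a + a') \<in> K0"
        unfolding K0_def using z b c p(2) s(2) by (intro CollectI exI conjI) (assumption | rule HOL.refl | fastforce)+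
      then have *: "mn u 0 \<star> \<iota> z \<star> mn v (a + a') \<in> VK" unfolding VK_def by (intro pm.span_base) simp
      have "mn [] a \<star> mn v a' = scale (word_char \<chi> v a) (mn v (a + a'))" by simp
      then show "single b 1 \<star> \<iota> z \<star> single c 1 \<in> VK"
        using VK_scale[OF VK_scale[OF *]] unfolding b c move_grp[OF z(2), of u a] by (simp only: star_lin)
    qed
  qed
qed

lemma D_idl:
  assumes "Suc h \<le> L" "z \<in> Rc (Suc h)"
  shows "D c j z \<in> idl (\<iota> ` Rc h)"
  unfolding D_def by (intro idl_sum idl_scale idl_right R_der[OF assms])

context
  fixes h z w r
  assumes h: "Suc h \<le> L" and z: "z \<in> Rc (Suc h)" and w: "in_block w r z"
    and low: "idl (\<iota> ` Rc h) \<subseteq> VK"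
begin

lemma zR: "z \<in> R" using Rc_R[OF h] z by blast

text \<open>\<open>low\<close> is the induction hypothesis of \<open>idl_VK\<close>: the correction
  terms of the commutation rules lie in the ideal of the previous stage and may be dropped.\<close>

lemma low_D: "f \<star> D c j z \<star> f' \<in> VK"
  by (rule subsetD[OF low idl_right[OF idl_left[OF D_idl[OF h z]]]])

text \<open>Letters of \<open>s\<close> below \<open>r\<close> are moved one by one to the left of
  \<open>z\<close>, where they join \<open>u\<close>. When the first remaining letter is at least
  \<open>r\<close>, sortedness puts all of \<open>s\<close> in place, and straightening
  \<open>u\<close> keeps its letters at most \<open>r\<close>.\<close>

lemma sandwich_sorted_right_VK:
  assumes "sorted (map blk s)" "\<forall>i\<in>set u. blk i \<le> r"
  shows "mn u 0 \<star> \<iota> z \<star> mn s b \<in> VK"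
  using assms
proof (induction s arbitrary: u)
  case Nil
  have "mn u 0 \<star> \<iota> z \<star> mn [] b - nf (mn u 0) \<star> \<iota> z \<star> mn [] b = (mn u 0 - nf (mn u 0)) \<star> (\<iota> z \<star> mn [] b)"
    by (simp only: star_lin star_assoc)
  also have "\<dots> \<in> I'" by (rule I'_mult[OF nf_cong])
  finally show ?case
    by (rule VK_cong) (rule sandwich_normal_VK[OF zR w nf_NN_word Nil(2), of _ "{}"], auto simp: nrm_def)
next
  case (Cons j s)
  show ?case
  proof (cases "r \<le> blk j")
    case True
    have "mn u 0 \<star> \<iota> z \<star> mn (j # s) b - nf (mn u 0) \<star> \<iota> z \<star> mn (j # s) b = (mn u 0 - nf (mn u 0)) \<star> (\<iota> z \<star> mn (j # s) b)"
      by (simp only: star_lin star_assoc)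
    also have "\<dots> \<in> I'" by (rule I'_mult[OF nf_cong])
    finally show ?thesis
      by (rule VK_cong) (rule sandwich_normal_VK[OF zR w nf_NN_word Cons.prems(2), of _ "set (j # s)"], use Cons.prems True in \<open>auto simp: nrm_def\<close>)
  next
    case False
    then have j: "blk j < r" by simp
    let ?c = "scale (\<chi> j (word_degree g w)) (mn (u @ [j]) 0 \<star> \<iota> z \<star> mn s b) + mn u 0 \<star> D (\<lambda>i. l i j) j z \<star> mn s b"
    have uj: "mn (u @ [j]) 0 = mn u 0 \<star> mn [j] 0" by simp
    have "mn u 0 \<star> \<iota> z \<star> mn (j # s) b - ?c =
      mn u 0 \<star> ((\<iota> z \<star> mn [j] 0 - (scale (\<chi> j (word_degree g w)) (mn [j] 0 \<star> \<iota> z) + D (\<lambda>i. l i j) j z)) \<star> mn s b)"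
      unfolding uj cons_star[of j s] by (simp only: star_lin star_assoc)
    also have "\<dots> \<in> I'" by (intro I'_mult commute_right[OF w j])
    finally show ?thesis
    proof (rule VK_cong)
      show "?c \<in> VK"
        by (intro VK_add VK_scale low_D Cons.IH) (use Cons.prems j in auto)
    qed
  qed
qed

lemma sandwich_right_VK:
  assumes "\<forall>i\<in>set u. blk i \<le> r"
  shows "mn u 0 \<star> \<iota> z \<star> f \<in> VK"
proof (rule VK_cong)
  have "mn u 0 \<star> \<iota> z \<star> f - mn u 0 \<star> \<iota> z \<star> nf f = mn u 0 \<star> \<iota> z \<star> (f - nf f)" by (simp only: star_lin)
  also have "\<dots> \<in> I'" by (rule I'_mult[OF nf_cong])
  finally show "mn u 0 \<star> \<iota> z \<star> f - mn u 0 \<star> \<iota> z \<star> nf f \<in> I'" .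
  have k: "keys (nf f) \<subseteq> nrm UNIV" using nf_NN by simp
  show "mn u 0 \<star> \<iota> z \<star> nf f \<in> VK"
    by (rule plin_in[OF tmul_right VK_subspace k]) (auto simp: nrm_def intro!: sandwich_sorted_right_VK assms)
qed

text \<open>The mirror image: letters above \<open>r\<close> are taken from the end of
  \<open>u\<close> and moved to the right of \<open>z\<close>. They are absorbed by the arbitrary
  factor \<open>f\<close>, which \<open>sandwich_right_VK\<close> handles at the end.\<close>

lemma sandwich_sorted_left_VK: "sorted (map blk u) \<Longrightarrow> mn u 0 \<star> \<iota> z \<star> f \<in> VK"
proof (induction u arbitrary: f rule: rev_induct)
  case Nil
  then show ?case by (intro sandwich_right_VK) simp
next
  case (snoc j u)
  show ?case
  proof (cases "blk j \<le> r")
    case True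
    then show ?thesis using snoc.prems by (intro sandwich_right_VK) (auto simp: sorted_append)
  next
    case False
    then have j: "r < blk j" by simp
    let ?c = "scale (word_char \<chi> w (g j)) (mn u 0 \<star> \<iota> z \<star> (mn [j] 0 \<star> f) + scale (\<chi> j (g j)) (mn u 0 \<star> D (l j) j z \<star> f))"
    have uj: "mn (u @ [j]) 0 = mn u 0 \<star> mn [j] 0" by simp
    have "mn (u @ [j]) 0 \<star> \<iota> z \<star> f - ?c =
      mn u 0 \<star> ((mn [j] 0 \<star> \<iota> z - scale (word_char \<chi> w (g j)) (\<iota> z \<star> mn [j] 0 + scale (\<chi> j (g j)) (D (l j) j z))) \<star> f)"
      unfolding uj by (simp only: star_lin star_assoc)
    also have "\<dots> \<in> I'" by (intro I'_mult commute_left[OF w j])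
    finally show ?thesis
    proof (rule VK_cong)
      show "?c \<in> VK"
        by (intro VK_add VK_scale low_D snoc.IH) (use snoc.prems in \<open>auto simp: sorted_append\<close>)
    qed
  qed
qed

lemma sandwich_VK: "f \<star> \<iota> z \<star> f' \<in> VK"
proof (rule VK_cong)
  have "f \<star> \<iota> z \<star> f' - nf f \<star> \<iota> z \<star> f' = (f - nf f) \<star> (\<iota> z \<star> f')" by (simp only: star_lin star_assoc)
  also have "\<dots> \<in> I'" by (rule I'_mult[OF nf_cong])
  finally show "f \<star> \<iota> z \<star> f' - nf f \<star> \<iota> z \<star> f' \<in> I'" .
  have k: "keys (nf f) \<subseteq> nrm UNIV" using nf_NN by simp
  show "nf f \<star> \<iota> z \<star> f' \<in> VK"
  proof (rule plin_in[where T = "\<lambda>x. x \<star> \<iota> z \<star> f'", OF plin_compose[OF tmul_left tmul_left] VK_subspace k])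
    fix b assume "b \<in> nrm UNIV"
    then obtain u a where b: "b = (u, a)" "sorted (map blk u)" by (auto simp: nrm_def)
    show "single b 1 \<star> \<iota> z \<star> f' \<in> VK"
      unfolding b(1) move_grp[OF w, of u a] by (intro VK_scale sandwich_sorted_left_VK b(2))
  qed
qed

end

lemma idl_VK: "h \<le> L \<Longrightarrow> idl (\<iota> ` Rc h) \<subseteq> VK"
proof (induction h)
  case 0
  show ?case unfolding idl_def by (rule pm.span_minimal[OF _ VK_subspace]) (simp add: Rc_0)
next
  case (Suc h)
  show ?case unfolding idl_def
  proof (rule pm.span_minimal[OF _ VK_subspace], rule subsetI)
    fix x assume "x \<in> {mn u a \<star> r \<star> mn v b |u a v b r. r \<in> \<iota> ` Rc (Suc h)}"
    then obtain u a z v b where x: "x = mn u a \<star> \<iota> z \<star> mn v b" and z: "z \<in> Rc (Suc h)" by blast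
    obtain w r where "in_block w r z" using R_block Rc_R[OF Suc.prems] z by blast
    then show "x \<in> VK" unfolding x by (intro sandwich_VK[OF Suc.prems z] Suc.IH) (use Suc.prems in auto)
  qed
qed

definition I_lam where "I_lam = idl (\<iota> ` R \<union> {rl i j | i j. blk j < blk i})"
definition I_R where "I_R = idl (\<iota> ` R)"

lemma I_lam_VK: "I_lam \<subseteq> VK"
  unfolding I_lam_def idl_def
proof (rule pm.span_minimal[OF _ VK_subspace], rule subsetI)
  fix x assume "x \<in> {mn u a \<star> r \<star> mn v b |u a v b r. r \<in> \<iota> ` R \<union> {rl i j |i j. blk j < blk i}}"
  then obtain u a r v b where x: "x = mn u a \<star> r \<star> mn v b" and r: "r \<in> \<iota> ` R \<or> r \<in> {rl i j |i j. blk j < blk i}" by blast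
  from r show "x \<in> VK"
  proof
    assume "r \<in> \<iota> ` R"
    then have "x \<in> idl (\<iota> ` Rc L)" unfolding x Rc_L by (intro idl_right idl_left idl_base)
    then show ?thesis using idl_VK[of L] by auto
  next
    assume "r \<in> {rl i j |i j. blk j < blk i}"
    then show ?thesis unfolding x by (auto intro!: I'_VK rl_in)
  qed
qed

lemma K0_NN: "K0 \<subseteq> NN UNIV"
proof
  fix x assume "x \<in> K0"
  then obtain p z s a w r where x: "x = mn p 0 \<star> \<iota> z \<star> mn s a" and z: "in_block w r z"
    and s: "sorted (map blk p)" "sorted (map blk s)" "\<forall>i\<in>set p. blk i \<le> r" "\<forall>i\<in>set s. r \<le> blk i"
    unfolding K0_def by blast
  have k: "keys z \<subseteq> {v. mset v = mset w}" using z by (simp add: in_block_def anagram_def)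
  show "x \<in> NN UNIV" unfolding x
  proof (rule plin_in[where T = "\<lambda>z. mn p 0 \<star> \<iota> z \<star> mn s a", OF _ NN_subspace k])
    show "plin (\<lambda>z. mn p 0 \<star> \<iota> z \<star> mn s a)"
      by (rule plin_compose[OF tmul_left plin_compose[OF tmul_right \<iota>_plin]])
    fix v assume "v \<in> {v. mset v = mset w}"
    then have "set v = set w" using mset_eq_setD by auto
    then have v: "\<forall>i\<in>set v. blk i = r" using z by (auto simp: in_block_def)
    then have "sorted (map blk v)" by (induction v) auto
    then have "sorted (map blk (p @ v @ s))" using s v by (auto simp: sorted_append) (meson order_trans)
    then show "mn p 0 \<star> \<iota> (single v 1) \<star> mn s a \<in> NN UNIV" by (auto simp: nrm_def)
  qed
qed

text \<open>Write \<open>f\<close> as an element of \<open>I' + K\<close> and apply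
  \<open>nf\<close>: it fixes \<open>f\<close>, discards the first part and fixes the second, which
  is already normal.\<close>

theorem I_lam_NN:
  assumes "f \<in> I_lam" "f \<in> NN UNIV"
  shows "f \<in> K"
proof -
  have "nf f \<in> K"
  proof (rule plin_span[OF nf_plin])
    show "f \<in> pm.span (I' \<union> K0)" using assms(1) I_lam_VK by (auto simp: VK_def)
    show "nf s \<in> K" if "s \<in> I' \<union> K0" for s
      using that
    proof
      assume "s \<in> K0"
      then have "nf s = s" by (intro nf_id[of s UNIV] subsetD[OF K0_NN])
      with \<open>s \<in> K0\<close> show ?thesis by (simp add: pm.span_base)
    qed (simp add: nf_I' pm.span_zero)
  qed simp
  then show ?thesis using nf_id[OF assms(2)] by simp
qed

text \<open>The ideal \<open>I_R\<close> is generated by \<open>R\<close> alone, without any linking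
  relation. This bound lets a map defined on normal words pass from \<open>H^0\<close> to
  \<open>A(\<lambda>)\<close>.\<close>

lemma K_I_R: "K \<subseteq> I_R"
proof (rule pm.span_minimal)
  show "pm.subspace I_R" unfolding I_R_def by (rule idl_subspace)
  show "K0 \<subseteq> I_R" unfolding K0_def I_R_def by (blast intro: idl_left idl_right idl_base)
qed

lemma I_R_I_lam: "I_R \<subseteq> I_lam"
  unfolding I_R_def I_lam_def by (rule idl_mono) blast

lemma I'_I_lam: "I' \<subseteq> I_lam"
  unfolding I'_def I_lam_def by (rule idl_mono) blast

end

section \<open>Coproduct and antipode of the bosonization\<close>

text \<open>The pure tensor of \<open>f\<close> and \<open>h\<close>; the free module on pairs
  stands for the tensor product of two free modules.\<close>

definition tt :: "('b \<Rightarrow>\<^sub>0 'k::comm_ring_1) \<Rightarrow> ('c \<Rightarrow>\<^sub>0 'k) \<Rightarrow> ('b \<times> 'c \<Rightarrow>\<^sub>0 'k)" where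
  "tt f h = lin (\<lambda>b. lin (\<lambda>c. single (b, c) 1) h) f"

lemma tt_left: "plin (\<lambda>f. tt f h)"
  unfolding tt_def by (rule lin_plin)

lemma tt_right: "plin (tt f)"
proof -
  have eq: "tt f = (\<lambda>h. \<Sum>b\<in>keys f. scale (lookup f b)
      (lin (\<lambda>c. single (b, c) 1) h))"
    by (rule ext) (simp add: tt_def lin_def[of "\<lambda>b. lin (\<lambda>c. single (b, c) 1) _"])
  show ?thesis unfolding eq by (intro plin_setsum plin_const_scale lin_plin)
qed

lemma tt_single [simp]: "tt (single b x) (single c y) = single (b, c) (x * y)"
  by (simp add: tt_def)

lemmas tt_lin = plin_add[OF tt_left] plin_add[OF tt_right] plin_diff[OF tt_left] plin_diff[OF tt_right]
  plin_scale[OF tt_left] plin_scale[OF tt_right] plin_zero[OF tt_left] plin_zero[OF tt_right]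

lemma tt_eqI:
  assumes "plin S" "plin T" "\<And>b c. S (tt (single b 1) (single c 1)) = T (tt (single b 1) (single c 1))"
  shows "S y = T y"
  by (rule plin_eq[OF assms(1,2)]) (use assms(3) in auto)

abbreviation tm where
  "tm m1 t1 m2 t2 \<equiv> tmul (\<lambda>(b, c) (b', c'). (m1 b b', m2 c c')) (\<lambda>(b, c) (b', c'). t1 b b' * t2 c c')"

lemma tm_tt: "tm m1 t1 m2 t2 (tt f h) (tt f' h') = tt (tmul m1 t1 f f') (tmul m2 t2 h h')"
proof (rule plin_eq2[where S = "\<lambda>f h. tm m1 t1 m2 t2 (tt f h) (tt f' h')" and T = "\<lambda>f h. tt (tmul m1 t1 f f') (tmul m2 t2 h h')",
      OF plin_compose[OF tmul_left tt_left] plin_compose[OF tt_left tmul_left] plin_compose[OF tmul_left tt_right] plin_compose[OF tt_right tmul_left]])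
  fix b c
  show "tm m1 t1 m2 t2 (tt (single b 1) (single c 1)) (tt f' h') = tt (tmul m1 t1 (single b 1) f') (tmul m2 t2 (single c 1) h')"
    by (rule plin_eq2[where S = "\<lambda>f' h'. tm m1 t1 m2 t2 (tt (single b 1) (single c 1)) (tt f' h')"
          and T = "\<lambda>f' h'. tt (tmul m1 t1 (single b 1) f') (tmul m2 t2 (single c 1) h')",
          OF plin_compose[OF tmul_right tt_left] plin_compose[OF tt_left tmul_right]
            plin_compose[OF tmul_right tt_right] plin_compose[OF tt_right tmul_right]]) simp
qed

context yetter_drinfeld
begin

abbreviation mF :: "'i list \<times> 'g \<Rightarrow> 'i list \<times> 'g \<Rightarrow> 'i list \<times> 'g" where "mF \<equiv> \<lambda>(u, a) (v, b). (u @ v, a + b)"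
abbreviation tF :: "'i list \<times> 'g \<Rightarrow> 'i list \<times> 'g \<Rightarrow> 'k" where "tF \<equiv> \<lambda>(u, a) (v, b). word_char \<chi> v a"

abbreviation ss (infixl "\<bullet>" 70) where "ss \<equiv> tm mF tF mF tF"

lemma F_square_eq: "F_square \<chi> = twisted_algebra UNIV (\<lambda>(b, c) (b', c'). (mF b b', mF c c'))
    (\<lambda>(b, c) (b', c'). tF b b' * tF c c') (([], 0), ([], 0))"
  unfolding F_square_def
  by (rule arg_cong2[where f = "\<lambda>m t. twisted_algebra UNIV m t (([], 0), ([], 0))"]) (auto simp: fun_eq_iff)

lemma sq_simps [simp]:
  "carrier (F_square \<chi>) = UNIV" "monoid.mult (F_square \<chi>) = ss" "ring.add (F_square \<chi>) = (+)"
  "ring.zero (F_square \<chi>) = 0" "monoid.one (F_square \<chi>) = single (([], 0), ([], 0)) 1"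
  "module.smult (F_square \<chi>) = scale"
  by (simp_all add: F_square_eq)

lemma sq_kalgebra: "kalgebra (F_square \<chi>)"
  unfolding F_square_eq
  by (rule twisted_kalgebra) (auto simp: add.assoc word_char_add mult_ac)

sublocale F2: kalgebra "F_square \<chi>" by (rule sq_kalgebra)

lemma ss_assoc: "(f \<bullet> h) \<bullet> k = f \<bullet> (h \<bullet> k)"
  using F2.m_assoc by simp

abbreviation gl :: "'g \<Rightarrow> _" where "gl a \<equiv> tt (mn [] a) (mn [] a)"
abbreviation dx :: "'i \<Rightarrow> _" where "dx i \<equiv> tt (mn [i] 0) (mn [] 0) + tt (mn [] (g i)) (mn [i] 0)"

definition cw where "cw w a = foldr (\<lambda>i z. dx i \<bullet> z) w (gl a)"

definition Delta where "Delta = lin (\<lambda>(w, a). cw w a)"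

lemma F_coproduct: "F_coproduct \<chi> g = Delta"
  unfolding F_coproduct_def Delta_def cw_def F_square_eq by simp

lemma Delta_plin: "plin Delta" unfolding Delta_def by (rule lin_plin)

lemma Delta_mn [simp]: "Delta (mn w a) = cw w a" by (simp add: Delta_def)

lemma cw_simps [simp]: "cw [] a = gl a" "cw (i # w) a = dx i \<bullet> cw w a" by (simp_all add: cw_def)

lemma Delta_x: "Delta (mn [i] 0 \<star> f) = dx i \<bullet> Delta f"
  by (rule plin_eq[OF plin_compose[OF Delta_plin tmul_right] plin_compose[OF tmul_right Delta_plin]])
    (auto simp del: tt_single)

text \<open>Both summands of \<open>dx i\<close> carry the same character of
  \<open>\<Gamma>\<close>; hence the coproduct respects the commutation of group elements with
  \<open>x\<^sub>i\<close>.\<close>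

lemma gl_dx: "gl c \<bullet> dx i = scale (\<chi> i c) (dx i \<bullet> gl c)"
  by (simp add: plin_add[OF tmul_left] plin_add[OF tmul_right] pm.scale_right_distrib add.commute)

lemma Delta_grp: "Delta (mn [] c \<star> f) = gl c \<bullet> Delta f"
proof (rule plin_eq[OF plin_compose[OF Delta_plin tmul_right] plin_compose[OF tmul_right Delta_plin]])
  fix b :: "'i list \<times> 'g"
  have "Delta (mn [] c \<star> mn w a) = gl c \<bullet> cw w a" for w a
  proof (induction w)
    case Nil
    show ?case by simp
  next
    case (Cons i w)
    have "mn [] c \<star> mn (i # w) a = scale (\<chi> i c) (mn [i] 0 \<star> (mn [] c \<star> mn w a))" by simp
    then have "Delta (mn [] c \<star> mn (i # w) a) = scale (\<chi> i c) (dx i \<bullet> (gl c \<bullet> cw w a))"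
      by (simp only: plin_scale[OF Delta_plin] Delta_x Cons)
    also have "\<dots> = gl c \<bullet> cw (i # w) a"
      unfolding cw_simps ss_assoc[symmetric] gl_dx plin_scale[OF tmul_left] ..
    finally show ?case .
  qed
  then show "Delta (mn [] c \<star> single b 1) = gl c \<bullet> Delta (single b 1)"
    by (cases b) (simp only: Delta_mn)
qed

lemma Delta_mult: "Delta (f \<star> h) = Delta f \<bullet> Delta h"
proof (rule plin_eq[where S = "\<lambda>f. Delta (f \<star> h)" and T = "\<lambda>f. Delta f \<bullet> Delta h"])
  show "plin (\<lambda>f. Delta (f \<star> h))" by (rule plin_compose[OF Delta_plin tmul_left])
  show "plin (\<lambda>f. Delta f \<bullet> Delta h)" by (rule plin_compose[OF tmul_left Delta_plin])
  fix b :: "'i list \<times> 'g"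
  have "Delta (mn w a \<star> h) = cw w a \<bullet> Delta h" for w a
  proof (induction w)
    case Nil
    show ?case by (simp only: Delta_grp cw_simps)
  next
    case (Cons i w)
    have "mn (i # w) a \<star> h = mn [i] 0 \<star> (mn w a \<star> h)" by (simp flip: star_assoc)
    then show ?case by (simp only: Delta_x Cons cw_simps ss_assoc)
  qed
  then show "Delta (single b 1 \<star> h) = Delta (single b 1) \<bullet> Delta h"
    by (cases b) (simp only: Delta_mn)
qed

lemma Delta_hom: "Delta \<in> algebra_hom (F_alg \<chi>) (F_square \<chi>)"
  by (rule ahI) (auto intro!: linear_mapsI simp: plin_add[OF Delta_plin] plin_scale[OF Delta_plin] Delta_mult)

lemma Delta_x1 [simp]: "Delta (mn [i] 0) = dx i"
  by (simp add: plin_add[OF tmul_left])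

text \<open>The counit followed by the unit of \<open>F\<close> (\<open>ee_counit\<close>). As an
  endomorphism of \<open>F\<close> it is accessible to the lemmas on \<open>plin\<close>, and it is
  the right-hand side of the antipode identities.\<close>

definition ee where "ee = lin (\<lambda>(w :: 'i list, a :: 'g). if w = [] then mn [] 0 else 0)"

lemma ee_plin: "plin ee" unfolding ee_def by (rule lin_plin)

lemma ee_mn [simp]: "ee (mn w a) = (if w = [] then mn [] 0 else 0)" by (simp add: ee_def)

lemma ee_counit: "ee f = scale (F_counit f) (mn [] 0)"
  unfolding ee_def lin_def F_counit_def pm.scale_sum_left
  by (rule sum.cong) (auto split: if_splits)

lemma counit_ee: "F_counit f = lookup (ee f) ([], 0)"
  unfolding ee_counit by simp

lemma counit_add: "F_counit (f + h) = F_counit f + F_counit (h :: 'i list \<times> 'g \<Rightarrow>\<^sub>0 'k)"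
  and counit_scale: "F_counit (scale c (f :: 'i list \<times> 'g \<Rightarrow>\<^sub>0 'k)) = c * F_counit f"
  and counit_mn: "F_counit (mn w a) = (if w = [] then 1 else 0)"
  by (simp_all add: counit_ee plin_add[OF ee_plin] plin_scale[OF ee_plin] lookup_add)

lemma ee_mult: "ee (f \<star> h) = ee f \<star> ee h"
proof (rule plin_eq[where S = "\<lambda>f. ee (f \<star> h)" and T = "\<lambda>f. ee f \<star> ee h"])
  show "plin (\<lambda>f. ee (f \<star> h))" by (rule plin_compose[OF ee_plin tmul_left])
  show "plin (\<lambda>f. ee f \<star> ee h)" by (rule plin_compose[OF tmul_left ee_plin])
  fix b :: "'i list \<times> 'g"
  show "ee (single b 1 \<star> h) = ee (single b 1) \<star> ee h"
    by (rule plin_eq[OF plin_compose[OF ee_plin tmul_right] plin_compose[OF tmul_right ee_plin]])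
      (auto simp: ee_def star_lin split: prod.splits)
qed

lemma counit_mult: "F_counit (f \<star> h) = F_counit f * F_counit h"
  unfolding counit_ee ee_mult unfolding ee_counit by simp

lemma counit_left: "lin (\<lambda>(b, c). single c (F_counit (single b 1))) (Delta f) = f"
    (is "lin ?\<beta> _ = _")
  and counit_right: "lin (\<lambda>(b, c). single b (F_counit (single c 1))) (Delta f) = f"
    (is "lin ?\<gamma> _ = _")
proof -
  have 1: "lin ?\<beta> (dx i \<bullet> y) = mn [i] 0 \<star> lin ?\<beta> y" for i y
    by (rule tt_eqI[OF plin_compose[OF lin_plin tmul_right] plin_compose[OF tmul_right lin_plin]])
      (auto simp: plin_add[OF tmul_left] lin_add counit_mn)
  have 2: "lin ?\<gamma> (dx i \<bullet> y) = mn [i] 0 \<star> lin ?\<gamma> y" for i y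
    by (rule tt_eqI[OF plin_compose[OF lin_plin tmul_right] plin_compose[OF tmul_right lin_plin]])
      (auto simp: plin_add[OF tmul_left] lin_add counit_mn)
  have "lin ?\<beta> (cw w a) = mn w a" for w a
  proof (induction w)
    case (Cons i w)
    show ?case by (simp only: cw_simps 1 Cons) simp
  qed (simp add: counit_mn)
  then show "lin ?\<beta> (Delta f) = f"
    by - (rule plin_eq[OF plin_compose[OF lin_plin Delta_plin] plin_id]; auto)
  have "lin ?\<gamma> (cw w a) = mn w a" for w a
  proof (induction w)
    case (Cons i w)
    show ?case by (simp only: cw_simps 2 Cons) simp
  qed (simp add: counit_mn)
  then show "lin ?\<gamma> (Delta f) = f"
    by - (rule plin_eq[OF plin_compose[OF lin_plin Delta_plin] plin_id]; auto)
qed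

subsection \<open>Coassociativity\<close>

text \<open>The element \<open>y \<otimes> f\<close> reassociated into
  \<open>F \<otimes> (F \<otimes> F)\<close>, the bracketing in which \<open>hopf_algebra\<close>
  states coassociativity.\<close>

definition tr :: "(('i list \<times> 'g) \<times> ('i list \<times> 'g) \<Rightarrow>\<^sub>0 'k) \<Rightarrow> ('i list \<times> 'g \<Rightarrow>\<^sub>0 'k) \<Rightarrow> _" where
  "tr y f = lin (\<lambda>(b1, b2). tt (single b1 1) (tt (single b2 1) f)) y"

lemma tr_left: "plin (\<lambda>y. tr y f)" unfolding tr_def by (rule lin_plin)

lemma tr_tt: "tr (tt f h) k = tt f (tt h k)"
  by (rule plin_eq2[where S = "\<lambda>f h. tr (tt f h) k"
        and T = "\<lambda>f h. tt f (tt h k)", OF plin_compose[OF tr_left tt_left] tt_left plin_compose[OF tr_left tt_right] plin_compose[OF tt_right tt_left]])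
    (simp add: tr_def)

definition co1 where "co1 = lin (\<lambda>(b, c). tr (Delta (single b 1)) (single c 1))"
definition co2 where "co2 = lin (\<lambda>(b, c). tt (single b 1) (Delta (single c 1)))"

lemma co1_plin: "plin co1" and co2_plin: "plin co2"
  unfolding co1_def co2_def by (rule lin_plin)+

lemma tr_right: "plin (tr y)"
proof -
  have eq: "tr y = (\<lambda>f. \<Sum>b\<in>keys y. scale (lookup y b)
      (tt (single (fst b) 1) (tt (single (snd b) 1) f)))"
    by (rule ext) (simp add: tr_def lin_def case_prod_beta)
  show ?thesis unfolding eq by (intro plin_setsum plin_const_scale plin_compose[OF tt_right tt_right])
qed

lemma co1_tt: "co1 (tt f h) = tr (Delta f) h"
  by (rule plin_eq2[where S = "\<lambda>f h. co1 (tt f h)"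
        and T = "\<lambda>f h. tr (Delta f) h", OF plin_compose[OF co1_plin tt_left]
        plin_compose[OF tr_left Delta_plin] plin_compose[OF co1_plin tt_right] tr_right])
    (simp add: co1_def)

lemma co2_tt: "co2 (tt f h) = tt f (Delta h)"
  by (rule plin_eq2[where S = "\<lambda>f h. co2 (tt f h)"
        and T = "\<lambda>f h. tt f (Delta h)", OF plin_compose[OF co2_plin tt_left]
        tt_left plin_compose[OF co2_plin tt_right] plin_compose[OF tt_right Delta_plin]])
    (simp add: co2_def)

abbreviation ccc where
  "ccc \<equiv> tm mF tF (\<lambda>(b, c) (b', c'). (mF b b', mF c c')) (\<lambda>(b, c) (b', c'). tF b b' * tF c c')"

text \<open>The iterated coproduct of \<open>x\<^sub>i\<close>, namely \<open>x\<^sub>i \<otimes> 1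
  \<otimes> 1 + g\<^sub>i \<otimes> x\<^sub>i \<otimes> 1 + g\<^sub>i \<otimes> g\<^sub>i \<otimes>
  x\<^sub>i\<close>.\<close>

abbreviation "dx3 i \<equiv> tt (mn [i] 0) (gl 0) + tt (mn [] (g i)) (dx i)"

lemma dx_tt: "dx i \<bullet> tt f h = tt (mn [i] 0 \<star> f) h + tt (mn [] (g i) \<star> f) (mn [i] 0 \<star> h)"
  by (simp only: plin_add[OF tmul_left] tm_tt star_one)

lemma gl_tt: "gl a \<bullet> tt f h = tt (mn [] a \<star> f) (mn [] a \<star> h)"
  by (simp only: tm_tt)

lemma dx3_tt: "ccc (dx3 i) (tt f y) = tt (mn [i] 0 \<star> f) y + tt (mn [] (g i) \<star> f) (dx i \<bullet> y)"
proof -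
  have "gl 0 \<bullet> y = y" using F2.l_one[of y] by simp
  then show ?thesis by (simp only: plin_add[OF tmul_left] tm_tt)
qed

lemma co2_dx: "co2 (dx i \<bullet> y) = ccc (dx3 i) (co2 y)"
  by (rule tt_eqI[OF plin_compose[OF co2_plin tmul_right] plin_compose[OF tmul_right co2_plin]])
    (simp only: dx_tt plin_add[OF co2_plin] co2_tt Delta_x dx3_tt)

lemma tr_dx: "tr (dx i \<bullet> y) f + tr (gl (g i) \<bullet> y) (mn [i] 0 \<star> f) = ccc (dx3 i) (tr y f)"
proof (rule tt_eqI[where S = "\<lambda>y. tr (dx i \<bullet> y) f + tr (gl (g i) \<bullet> y) (mn [i] 0 \<star> f)" and T = "\<lambda>y. ccc (dx3 i) (tr y f)"])
  show "plin (\<lambda>y. tr (dx i \<bullet> y) f + tr (gl (g i) \<bullet> y) (mn [i] 0 \<star> f))"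
    by (intro plin_plus plin_compose[OF tr_left tmul_right])
  show "plin (\<lambda>y. ccc (dx3 i) (tr y f))" by (rule plin_compose[OF tmul_right tr_left])
qed (simp only: dx_tt gl_tt tr_tt plin_add[OF tr_left] dx3_tt, simp only: tt_lin add.assoc)

lemma co1_dx: "co1 (dx i \<bullet> y) = ccc (dx3 i) (co1 y)"
  by (rule tt_eqI[OF plin_compose[OF co1_plin tmul_right] plin_compose[OF tmul_right co1_plin]])
    (simp only: dx_tt plin_add[OF co1_plin] co1_tt Delta_x Delta_grp tr_dx)

text \<open>Both iterated coproducts turn left multiplication by \<open>dx i\<close> into left
  multiplication by \<open>dx3 i\<close>, and they agree on group elements; induction on the
  word.\<close>

lemma coassoc: "co1 (Delta f) = co2 (Delta f)"
proof (rule plin_eq[OF plin_compose[OF co1_plin Delta_plin] plin_compose[OF co2_plin Delta_plin]])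
  fix b :: "'i list \<times> 'g"
  have "co1 (cw w a) = co2 (cw w a)" for w a
    by (induction w) (simp_all only: cw_simps co1_tt co2_tt Delta_mn tr_tt co1_dx co2_dx)
  then show "co1 (Delta (single b 1)) = co2 (Delta (single b 1))"
    by (cases b) simp
qed

subsection \<open>The antipode\<close>

text \<open>The antipode of \<open>x\<^sub>i\<close>, which is
  \<open>- g\<^sub>i\<^sup>-\<^sup>1 x\<^sub>i\<close>; the character value comes from writing the
  group element on the right.\<close>

abbreviation "sx i \<equiv> - single ([i], - g i) (\<chi> i (- g i))"

lemma sx: "sx i = scale (-1) (mn [] (- g i) \<star> mn [i] 0)"
  by (simp add: single_uminus)

fun Sw :: "'i list \<Rightarrow> 'g \<Rightarrow> ('i list \<times> 'g \<Rightarrow>\<^sub>0 'k)" where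
  "Sw [] a = mn [] (- a)"
| "Sw (i # w) a = Sw w a \<star> sx i"

definition S where "S = lin (\<lambda>(w, a). Sw w a)"

lemma S_plin: "plin S" unfolding S_def by (rule lin_plin)

lemma S_mn [simp]: "S (mn w a) = Sw w a" by (simp add: S_def)

lemma S_x: "S (mn [i] 0 \<star> f) = S f \<star> sx i"
  by (rule plin_eq[OF plin_compose[OF S_plin tmul_right] plin_compose[OF tmul_left S_plin]]) auto

lemma sx_grp: "sx i \<star> mn [] (- c) = scale (\<chi> i c) (mn [] (- c) \<star> sx i)"
proof -
  have "\<chi> i c * (\<chi> i (- c) * \<chi> i (- g i)) = \<chi> i (- g i)" by (simp flip: char_add)
  then show ?thesis
    unfolding sx by (simp add: star_lin add_ac mult_ac)
      (simp only: diff_conv_add_uminus add.commute)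
qed

lemma Sw_grp: "scale (word_char \<chi> w c) (Sw w (c + a)) = Sw w a \<star> mn [] (- c)"
proof (induction w)
  case (Cons i w)
  have "scale (word_char \<chi> (i # w) c) (Sw (i # w) (c + a)) = scale (\<chi> i c) (scale (word_char \<chi> w c) (Sw w (c + a)) \<star> sx i)"
    by (simp add: star_lin)
  also have "\<dots> = scale (\<chi> i c) (Sw w a \<star> (mn [] (- c) \<star> sx i))" unfolding Cons by (simp only: star_assoc)
  also have "\<dots> = Sw w a \<star> (sx i \<star> mn [] (- c))" unfolding sx_grp by (simp only: star_lin)
  finally show ?case by (simp only: Sw.simps star_assoc)
qed simp

lemma S_grp: "S (mn [] c \<star> f) = S f \<star> mn [] (- c)"
proof (rule plin_eq[OF plin_compose[OF S_plin tmul_right] plin_compose[OF tmul_left S_plin]])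
  fix b :: "'i list \<times> 'g"
  obtain w a where b: "b = (w, a)" by force
  have "mn [] c \<star> mn w a = scale (word_char \<chi> w c) (mn w (c + a))" by simp
  then show "S (mn [] c \<star> single b 1) = S (single b 1) \<star> mn [] (- c)"
    unfolding b by (simp only: plin_scale[OF S_plin] S_mn Sw_grp)
qed

lemma S_mult: "S (f \<star> h) = S h \<star> S f"
proof (rule plin_eq[where S = "\<lambda>f. S (f \<star> h)" and T = "\<lambda>f. S h \<star> S f"])
  show "plin (\<lambda>f. S (f \<star> h))" by (rule plin_compose[OF S_plin tmul_left])
  show "plin (\<lambda>f. S h \<star> S f)" by (rule plin_compose[OF tmul_right S_plin])
  fix b :: "'i list \<times> 'g"
  have "S (mn w a \<star> h) = S h \<star> Sw w a" for w a
  proof (induction w)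
    case Nil
    show ?case by (simp only: S_grp Sw.simps)
  next
    case (Cons i w)
    have "mn (i # w) a \<star> h = mn [i] 0 \<star> (mn w a \<star> h)" by (simp flip: star_assoc)
    then show ?case by (simp only: S_x Cons Sw.simps star_assoc)
  qed
  then show "S (single b 1 \<star> h) = S h \<star> S (single b 1)"
    by (cases b) (simp only: S_mn)
qed

definition M1 where "M1 = lin (\<lambda>(b, c). single b 1 \<star> S (single c 1))"
definition M2 where "M2 = lin (\<lambda>(b, c). S (single b 1) \<star> single c 1)"

lemma M1_plin: "plin M1" and M2_plin: "plin M2" unfolding M1_def M2_def by (rule lin_plin)+

lemma M1_tt: "M1 (tt f h) = f \<star> S h"
  by (rule plin_eq2[where S = "\<lambda>f h. M1 (tt f h)"
        and T = "\<lambda>f h. f \<star> S h", OF plin_compose[OF M1_plin tt_left]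
        tmul_left plin_compose[OF M1_plin tt_right] plin_compose[OF tmul_right S_plin]])
    (simp add: M1_def)

lemma M2_tt: "M2 (tt f h) = S f \<star> h"
  by (rule plin_eq2[where S = "\<lambda>f h. M2 (tt f h)"
        and T = "\<lambda>f h. S f \<star> h", OF plin_compose[OF M2_plin tt_left]
        plin_compose[OF tmul_left S_plin] plin_compose[OF M2_plin tt_right] tmul_right])
    (simp add: M2_def)

text \<open>The two new terms surround \<open>M1 y\<close>. They cancel in
  \<open>antipode_right\<close> because there \<open>M1 y\<close> is 0 or 1 by induction.\<close>

lemma M1_dx: "M1 (dx i \<bullet> y) = mn [i] 0 \<star> M1 y + mn [] (g i) \<star> M1 y \<star> sx i"
proof (rule tt_eqI[where S = "\<lambda>y. M1 (dx i \<bullet> y)" and T = "\<lambda>y. mn [i] 0 \<star> M1 y + mn [] (g i) \<star> M1 y \<star> sx i"])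
  show "plin (\<lambda>y. M1 (dx i \<bullet> y))" by (rule plin_compose[OF M1_plin tmul_right])
  show "plin (\<lambda>y. mn [i] 0 \<star> M1 y + mn [] (g i) \<star> M1 y \<star> sx i)"
    by (intro plin_plus plin_compose[OF tmul_right M1_plin] plin_compose[OF tmul_left plin_compose[OF tmul_right M1_plin]])
qed (simp only: dx_tt plin_add[OF M1_plin] M1_tt S_x star_assoc)

text \<open>Here the two new terms meet in the middle, between \<open>S b\<close> and
  \<open>c\<close>, as \<open>sx i + g\<^sub>i\<^sup>-\<^sup>1 x\<^sub>i\<close>, which is
  zero.\<close>

lemma M2_dx: "M2 (dx i \<bullet> y) = 0"
proof (rule tt_eqI[where S = "\<lambda>y. M2 (dx i \<bullet> y)" and T = "\<lambda>y. 0"])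
  show "plin (\<lambda>y. M2 (dx i \<bullet> y))" by (rule plin_compose[OF M2_plin tmul_right])
  fix b c :: "'i list \<times> 'g"
  let ?b = "single b 1 :: _ \<Rightarrow>\<^sub>0 'k" and ?c = "single c 1 :: _ \<Rightarrow>\<^sub>0 'k"
  have "M2 (dx i \<bullet> tt ?b ?c) = S ?b \<star> (sx i + mn [] (- g i) \<star> mn [i] 0) \<star> ?c"
    by (simp only: dx_tt plin_add[OF M2_plin] M2_tt S_x S_grp) (simp only: star_assoc star_lin)
  also have "sx i + mn [] (- g i) \<star> mn [i] 0 = 0" by simp
  finally show "M2 (dx i \<bullet> tt ?b ?c) = 0" by (simp only: star_lin)
qed (rule plin_null)

lemma antipode_right: "M1 (Delta f) = ee f"
proof (rule plin_eq[OF plin_compose[OF M1_plin Delta_plin] ee_plin])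
  fix b :: "'i list \<times> 'g"
  have "M1 (cw w a) = (if w = [] then mn [] 0 else 0)" for w a
  proof (induction w)
    case Nil
    show ?case by (simp only: cw_simps M1_tt S_mn Sw.simps) simp
  next
    case (Cons i w)
    have "mn [] (g i) \<star> sx i = scale (-1) ((mn [] (g i) \<star> mn [] (- g i)) \<star> mn [i] 0)"
      by (simp only: sx star_lin star_assoc)
    also have "\<dots> = - mn [i] 0" by (simp add: single_uminus)
    finally have "mn [i] 0 \<star> mn [] 0 + mn [] (g i) \<star> mn [] 0 \<star> sx i = 0"
      by (simp only: star_one) simp
    then show ?case
      by (simp only: cw_simps M1_dx Cons) (cases "w = []"; simp only: if_True if_False list.distinct star_lin; simp)
  qed
  then show "M1 (Delta (single b 1)) = ee (single b 1)"
    by (cases b) (simp only: Delta_mn ee_mn)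
qed

lemma antipode_left: "M2 (Delta f) = ee f"
proof (rule plin_eq[OF plin_compose[OF M2_plin Delta_plin] ee_plin])
  fix b :: "'i list \<times> 'g"
  have "M2 (cw w a) = (if w = [] then mn [] 0 else 0)" for w a
  proof (cases w)
    case Nil
    have "M2 (gl a) = mn [] 0" by (simp only: M2_tt S_mn Sw.simps) simp
    then show ?thesis by (simp only: Nil cw_simps) simp
  qed (simp add: M2_dx del: tt_single)
  then show "M2 (Delta (single b 1)) = ee (single b 1)"
    by (cases b) (simp only: Delta_mn ee_mn)
qed

end

section \<open>Primitive relations\<close>

context yetter_drinfeld
begin

abbreviation tv where "tv \<equiv> tmul (@) (\<lambda>(_ :: 'i list) (_ :: 'i list). 1 :: 'k)"
abbreviation wd :: "'i list \<Rightarrow> ('i list \<Rightarrow>\<^sub>0 'k)" where "wd u \<equiv> single u 1"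

lemma tensor_algebra_UNIV: "tensor_algebra UNIV = twisted_algebra UNIV (@) (\<lambda>_ _. 1) []"
  by (simp add: tensor_algebra_def monoid_algebra_def)

lemma tensor_algebra_kalgebra: "kalgebra (tensor_algebra A)"
  unfolding tensor_algebra_def monoid_algebra_def
  by (rule twisted_kalgebra) auto

definition cT where "cT w = foldr (\<lambda>i z. (single ([i], []) 1 + single ([], [i]) 1)
                          \<otimes>\<^bsub>TV_square \<chi> g\<^esub> z) w \<one>\<^bsub>TV_square \<chi> g\<^esub>"

abbreviation DT where "DT \<equiv> TV_coproduct \<chi> g"

lemma DT_lin: "DT = lin cT"
  unfolding TV_coproduct_def cT_def TV_square_def by simp

lemma DT_plin: "plin DT" unfolding DT_lin by (rule lin_plin)

lemma cT_simps:
  "cT [] = single ([], []) 1"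
  "cT (i # w) = lin (\<lambda>(u, v). single (i # u, v) 1 + single (u, i # v) (word_char \<chi> u (g i))) (cT w)"
proof -
  show "cT [] = single ([], []) 1" by (simp add: cT_def TV_square_def)
  have "(single ([i], []) 1 + single ([], [i]) 1) \<otimes>\<^bsub>TV_square \<chi> g\<^esub> y =
    lin (\<lambda>(u, v). single (i # u, v) 1 + single (u, i # v) (word_char \<chi> u (g i))) y" for y
    unfolding TV_square_def twisted_simps
    by (rule plin_eq[OF tmul_right lin_plin]) (auto simp: plin_add[OF tmul_left])
  then show "cT (i # w) = lin (\<lambda>(u, v). single (i # u, v) 1 + single (u, i # v) (word_char \<chi> u (g i))) (cT w)"
    by (simp add: cT_def)
qed

text \<open>\<open>u \<otimes> v \<mapsto> u g\<^sub>v \<otimes> v\<close> with \<open>g\<^sub>v\<close> the degree of \<open>v\<close>, the comparison of the braided coproduct with that of \<open>F\<close>.\<close>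

definition om where "om = lin (\<lambda>(u, v). single ((u, word_degree g v), (v, 0 :: 'g)) (1 :: 'k))"

lemma om_plin: "plin om" unfolding om_def by (rule lin_plin)

lemma Delta_iota: "Delta (\<iota> y) = om (DT y)"
proof (rule plin_eq[OF plin_compose[OF Delta_plin \<iota>_plin] plin_compose[OF om_plin DT_plin]])
  fix w
  have step: "dx i \<bullet> om y = om (lin (\<lambda>(u, v). single (i # u, v) 1 + single (u, i # v) (word_char \<chi> u (g i))) y)" for i y
    by (rule plin_eq[OF plin_compose[OF tmul_right om_plin] plin_compose[OF om_plin lin_plin]])
      (auto simp: om_def plin_add[OF tmul_left] lin_add)
  have "cw w 0 = om (cT w)"
    by (induction w) (simp_all only: cw_simps cT_simps step, simp add: om_def)
  then show "Delta (\<iota> (single w 1)) = om (DT (single w 1))"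
    by (simp add: DT_lin)
qed

definition Ci where "Ci i = lin (\<lambda>(u, v). if v = [i] then wd u else 0)"

lemma Ci_plin: "plin (Ci i)" unfolding Ci_def by (rule lin_plin)

lemma Ci_tt: "Ci i (tt f h) = scale (lookup h [i]) f"
proof (rule plin_eq[where S = "\<lambda>f. Ci i (tt f h)" and T = "\<lambda>f. scale (lookup h [i]) f"])
  show "plin (\<lambda>f. Ci i (tt f h))" by (rule plin_compose[OF Ci_plin tt_left])
  show "plin (scale (lookup h [i]))" by (rule plin_const_scale[OF plin_id])
  fix u
  show "Ci i (tt (wd u) h) = scale (lookup h [i]) (wd u)"
  proof (rule plin_eq[OF plin_compose[OF Ci_plin tt_right]])
    show "plin (\<lambda>h. scale (lookup h [i]) (wd u))"
      by (rule plinI) (simp_all only: lookup_add lookup_scale pm.scale_left_distrib pm.scale_scale)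
  qed (simp add: Ci_def lookup_single when_def)
qed

text \<open>Links the recursive skew derivative to the coproduct: both satisfy the same recursion
  over the first letter.\<close>

lemma dd_Ci: "dd i z = Ci i (DT z)"
proof -
  \<comment> \<open>The component in \<open>TV \<otimes> 1\<close>, on which the coproduct is the
    identity. It is needed when the first letter is the one that goes to the right: the rest of the
    word must then stay on the left.\<close>
  let ?C0 = "lin (\<lambda>(u, v). if v = [] then wd u else 0)"
  have s0: "?C0 (lin (\<lambda>(u, v). single (j # u, v) 1 + single (u, j # v) (word_char \<chi> u (g j))) y)
    = lin (\<lambda>u. wd (j # u)) (?C0 y)" for j y
    by (rule plin_eq[OF plin_compose[OF lin_plin lin_plin] plin_compose[OF lin_plin lin_plin]])
      (auto simp: lin_add lin_zero)
  have c0: "?C0 (cT w) = wd w" for w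
    by (induction w) (simp_all only: cT_simps s0, simp_all)
  have s1: "Ci i (lin (\<lambda>(u, v). single (j # u, v) 1 + single (u, j # v) (word_char \<chi> u (g j))) y)
    = lin (\<lambda>u. wd (j # u)) (Ci i y) + (if j = i then lin (\<lambda>u. single u (word_char \<chi> u (g i))) (?C0 y) else 0)" for j y
  proof (rule plin_eq[OF plin_compose[OF Ci_plin lin_plin], where T = "\<lambda>y. lin (\<lambda>u. wd (j # u)) (Ci i y) + (if j = i then lin (\<lambda>u. single u (word_char \<chi> u (g i))) (?C0 y) else 0)"])
    show "plin (\<lambda>y. lin (\<lambda>u. wd (j # u)) (Ci i y) + (if j = i then lin (\<lambda>u. single u (word_char \<chi> u (g i))) (?C0 y) else 0))"
      by (cases "j = i") (auto intro!: plin_plus plin_null plin_compose[OF lin_plin lin_plin] plin_compose[OF lin_plin Ci_plin])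
  qed (auto simp: Ci_def lin_add lin_zero)
  have "dw i w = Ci i (cT w)" for w
  proof (induction w)
    case Nil
    show ?case by (simp add: cT_simps Ci_def)
  next
    case (Cons j w)
    show ?case unfolding cT_simps s1 c0 by (simp add: Cons)
  qed
  then show ?thesis
    by - (rule plin_eq[OF dd_plin plin_compose[OF Ci_plin DT_plin]], simp add: DT_lin)
qed

text \<open>The submodule \<open>J \<otimes> TV + TV \<otimes> J\<close>, inside the free module on
  pairs of words.\<close>

definition WJ where "WJ J = pm.span ({tt j y | j y. j \<in> J} \<union> {tt y j | j y. j \<in> J})"

text \<open>The map from \<open>TV \<otimes> TV\<close> to the tensor square of
  \<open>TV / J\<close> has its kernel inside \<open>WJ J\<close>: the tensor square is mapped back
  to the quotient by \<open>WJ J\<close> through its universal property, and the composite is the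
  canonical projection. Applied to the equation of primitivity, this gives the claim.\<close>

lemma primitive_WJ:
  assumes "primitive_modulo \<chi> g J z" "J = genideal (tensor_algebra UNIV) G"
  shows "DT z - tt z (wd []) - tt (wd []) z \<in> WJ J"
proof -
  let ?T = "tensor_algebra UNIV :: ('k, 'i list \<Rightarrow>\<^sub>0 'k) module"
  interpret T: kalgebra ?T by (rule tensor_algebra_kalgebra)
  have id: "ideal J ?T" unfolding assms(2) by (rule T.genideal_ideal) (simp add: tensor_algebra_UNIV)
  interpret TJ: kquot_alg ?T J
    by (rule kquot_alg.intro[OF T.kalgebra_axioms kquot_alg_axioms.intro[OF id]])
  let ?Q = "quotient ?T J"
  interpret QQ: bialg ?Q ?Q
    by (intro bialg.intro TJ.quot_kalgebra)
  let ?M = "twisted_algebra UNIV undefined undefined undefined :: ('k, 'i list \<times> 'i list \<Rightarrow>\<^sub>0 'k) module"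
  interpret M: kmodule ?M by simp
  have WS: "pm.subspace (WJ J)" unfolding WJ_def by (rule pm.subspace_span)
  have "submodule (WJ J) ring_of_type_algebra ?M"
    by (rule M.submoduleI') (auto intro: pm.subspace_0[OF WS] pm.subspace_add[OF WS] pm.subspace_scale[OF WS])
  then interpret P: kquot ?M "WJ J"
    by (intro kquot.intro M.kmodule_axioms kquot_axioms.intro)
  let ?P = "quotient ?M (WJ J)"
  let ?p = "\<lambda>y. J +>\<^bsub>?T\<^esub> y" and ?w = "\<lambda>y. WJ J +>\<^bsub>?M\<^esub> y"
  have Tc [simp]: "carrier ?T = UNIV" "ring.add ?T = (+)" "module.smult ?T = scale" "ring.zero ?T = 0" "monoid.one ?T = wd []"
    by (simp_all add: tensor_algebra_UNIV)
  have wadd: "?w (x + y) = ?w x \<oplus>\<^bsub>?P\<^esub> ?w y" and wsm: "?w (scale c x) = c \<odot>\<^bsub>?P\<^esub> ?w x" and wc: "?w x \<in> carrier ?P" for x y c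
    using P.quot_add[of x y] P.quot_smul[of x c] by auto
  have wz: "?w x = \<zero>\<^bsub>?P\<^esub>" if "x \<in> WJ J" for x
    using P.coset_zero_iff[of x] that by (simp add: P.quot_zero)
  \<comment> \<open>Changing a representative in either argument by an element of \<open>J\<close>
    changes the value by an element of \<open>WJ J\<close>, so the two nested uses of
    \<open>induced\<close> are legitimate.\<close>
  define \<beta> where "\<beta> = (\<lambda>(C, D). induced (\<lambda>f. induced (\<lambda>h. ?w (tt f h)) D) C)"
  have i1: "induced (\<lambda>h. ?w (tt f h)) (?p h) = ?w (tt f h)" for f h
  proof (rule TJ.induced_eq[OF _ P.quot_kmodule])
    show "(\<lambda>h. ?w (tt f h)) \<in> linear_maps ?T ?P"
      by (rule linear_mapsI) (auto simp: tt_lin wadd wsm wc)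
    show "?w (tt f n) = \<zero>\<^bsub>?P\<^esub>" if "n \<in> J" for n
      by (rule wz) (use that in \<open>auto simp: WJ_def intro!: pm.span_base\<close>)
  qed simp
  have i2: "\<beta> (?p f, ?p h) = ?w (tt f h)" for f h
    unfolding \<beta>_def prod.case i1
  proof (rule TJ.induced_eq[OF _ P.quot_kmodule])
    show "(\<lambda>f. ?w (tt f h)) \<in> linear_maps ?T ?P"
      by (rule linear_mapsI) (auto simp: tt_lin wadd wsm wc)
    show "?w (tt n h) = \<zero>\<^bsub>?P\<^esub>" if "n \<in> J" for n
      by (rule wz) (use that in \<open>auto simp: WJ_def intro!: pm.span_base\<close>)
  qed simp
  have padd: "?p x \<oplus>\<^bsub>?Q\<^esub> ?p y = ?p (x + y)" and psm: "c \<odot>\<^bsub>?Q\<^esub> ?p x = ?p (scale c x)" for x y c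
    using TJ.quot_add[of x y] TJ.quot_smul[of x c] by auto
  have Qc: "\<exists>x. C = ?p x" if "C \<in> carrier ?Q" for C using that by (auto simp: TJ.quot_carrier)
  have bil: "QQ.bilin ?P \<beta>"
    unfolding QQ.bilin_def
  proof (intro conjI ballI linear_mapsI)
    fix C D C' c assume "C \<in> carrier ?Q" "D \<in> carrier ?Q" "C' \<in> carrier ?Q"
    then obtain x y x' where C: "C = ?p x" "D = ?p y" "C' = ?p x'" using Qc by meson
    show "\<beta> (C \<oplus>\<^bsub>?Q\<^esub> C', D) = \<beta> (C, D) \<oplus>\<^bsub>?P\<^esub> \<beta> (C', D)" 
      "\<beta> (D, C \<oplus>\<^bsub>?Q\<^esub> C') = \<beta> (D, C) \<oplus>\<^bsub>?P\<^esub> \<beta> (D, C')" 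
      unfolding C by (simp_all add: i2 padd tt_lin wadd)
  next
    fix C D c assume "C \<in> carrier ?Q" "D \<in> carrier ?Q"
    then obtain x y where C: "C = ?p x" "D = ?p y" using Qc by meson
    show "\<beta> (C, D) \<in> carrier ?P" "\<beta> (D, C) \<in> carrier ?P"
       "\<beta> (c \<odot>\<^bsub>?Q\<^esub> C, D) = c \<odot>\<^bsub>?P\<^esub> \<beta> (C, D)" "\<beta> (D, c \<odot>\<^bsub>?Q\<^esub> C) = c \<odot>\<^bsub>?P\<^esub> \<beta> (D, C)"
      unfolding C by (simp_all add: i2 psm tt_lin wsm wc)
  qed
  let ?\<Phi> = "tensor_lift ?P \<beta>"
  note lm = QQ.tensor_lift_lm[OF P.quot_kmodule bil] and pure = QQ.tensor_lift_pure[OF P.quot_kmodule bil]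
  let ?\<gamma> = "\<lambda>(u, v). pure_tensor ?Q ?Q (?p (wd u)) (?p (wd v))"
  have pc: "?p x \<in> carrier ?Q" for x by auto
  have *: "?\<Phi> (free_lift (tensor ?Q ?Q) ?\<gamma> y) = ?w y" for y
  proof (rule lm_eqI_keys[OF lm_compose[OF free_lift_lm lm] P.proj_lm P.quot_kmodule _ subset_UNIV])
    fix b :: "'i list \<times> 'i list"
    obtain u v where b: "b = (u, v)" by force
    show "?\<Phi> (free_lift (tensor ?Q ?Q) ?\<gamma> (single b 1)) = ?w (single b 1)"
      unfolding b by (simp add: QQ.tensor_kmodule pc pure i2)
  qed (auto simp: QQ.tensor_kmodule)
  have one: "\<one>\<^bsub>?Q\<^esub> = ?p (wd [])" using TJ.quot_one by simp
  have "free_lift (tensor ?Q ?Q) ?\<gamma> (DT z) = pure_tensor ?Q ?Q (?p z) \<one>\<^bsub>?Q\<^esub> \<oplus>\<^bsub>tensor ?Q ?Q\<^esub> pure_tensor ?Q ?Q \<one>\<^bsub>?Q\<^esub> (?p z)"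
    using assms(1) unfolding primitive_modulo_def Let_def .
  from arg_cong[where f = ?\<Phi>, OF this]
  have "?w (DT z) = ?w (tt z (wd []) + tt (wd []) z)"
    unfolding * one by (simp add: lm_add[OF lm] pc pure i2 wadd)
  then have "DT z \<ominus>\<^bsub>?M\<^esub> (tt z (wd []) + tt (wd []) z) \<in> WJ J"
    by (subst (asm) P.coset_eq_iff) auto
  then show ?thesis by (simp add: a_minus_def a_inv_twisted algebra_simps)
qed

lemma iota_tv: "\<iota> (tv f h) = \<iota> f \<star> \<iota> h"
proof (rule plin_eq[where S = "\<lambda>f. \<iota> (tv f h)" and T = "\<lambda>f. \<iota> f \<star> \<iota> h"])
  show "plin (\<lambda>f. \<iota> (tv f h))" by (rule plin_compose[OF \<iota>_plin tmul_left])
  show "plin (\<lambda>f. \<iota> f \<star> \<iota> h)" by (rule plin_compose[OF tmul_left \<iota>_plin])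
  fix u
  show "\<iota> (tv (wd u) h) = \<iota> (wd u) \<star> \<iota> h"
    by (rule plin_eq[OF plin_compose[OF \<iota>_plin tmul_right] plin_compose[OF tmul_right \<iota>_plin]]) simp
qed

lemma genideal_TV: "genideal (tensor_algebra UNIV) G = pm.span {tv (tv (wd p) r) (wd q) | p q r. r \<in> G}"
  using genideal_span[OF tensor_algebra_kalgebra[of UNIV, unfolded tensor_algebra_UNIV], of G]
  unfolding tensor_algebra_UNIV .

lemma iota_J: "j \<in> genideal (tensor_algebra UNIV) G \<Longrightarrow> \<iota> j \<in> idl (\<iota> ` G)"
  unfolding genideal_TV
proof (erule plin_span[OF \<iota>_plin])
  fix x assume "x \<in> {tv (tv (wd p) r) (wd q) | p q r. r \<in> G}"
  then obtain p q r where x: "x = tv (tv (wd p) r) (wd q)" and r: "r \<in> G" by blast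
  show "\<iota> x \<in> idl (\<iota> ` G)"
    unfolding x iota_tv by (rule idl_right[OF idl_left[OF idl_base[OF imageI[OF r]]]])
qed (rule idl_subspace)

definition long where "long z \<longleftrightarrow> keys z \<subseteq> {v :: 'i list. 2 \<le> length v}"

lemma long_J:
  assumes "\<forall>r\<in>G. long r" "j \<in> genideal (tensor_algebra UNIV) G"
  shows "long (j :: 'i list \<Rightarrow>\<^sub>0 'k)"
proof -
  have "pm.span {tv (tv (wd p) r) (wd q) | p q r. r \<in> G} \<subseteq> {f. keys f \<subseteq> {v. 2 \<le> length v}}"
  proof (rule pm.span_minimal[OF _ keys_subspace], rule subsetI)
    fix x assume "x \<in> {tv (tv (wd p) r) (wd q) | p q r. r \<in> G}"
    then obtain p q r where x: "x = tv (tv (wd p) r) (wd q)" "r \<in> G" by blast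
    then have k: "keys r \<subseteq> {v. 2 \<le> length v}" using assms(1) by (auto simp: long_def)
    show "x \<in> {f. keys f \<subseteq> {v. 2 \<le> length v}}" unfolding x(1)
      by (rule plin_in[where T = "\<lambda>r. tv (tv (wd p) r) (wd q)", OF plin_compose[OF tmul_left tmul_right] keys_subspace k]) simp
  qed
  then show ?thesis using assms(2) unfolding genideal_TV long_def by auto
qed

lemma long_lookup: "long z \<Longrightarrow> lookup z [i] = 0"
  unfolding long_def by (force simp: in_keys_iff)

text \<open>Take the component at \<open>x\<^sub>i\<close> in the right factor. It sends
  \<open>J \<otimes> TV\<close> into \<open>J\<close>; it kills \<open>TV \<otimes> J\<close>,
  \<open>z \<otimes> 1\<close> and \<open>1 \<otimes> z\<close>, because neither \<open>z\<close>
  nor an element of \<open>J\<close> has a linear part.\<close>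

lemma primitive_dd:
  assumes "primitive_modulo \<chi> g (genideal (tensor_algebra UNIV) G) z" "\<forall>r\<in>G. long r" "long z"
  shows "\<iota> (dd i z) \<in> idl (\<iota> ` G)"
proof -
  let ?J = "genideal (tensor_algebra UNIV) G :: ('i list \<Rightarrow>\<^sub>0 'k) set"
  have JS: "pm.subspace ?J" unfolding genideal_TV by (rule pm.subspace_span)
  have "Ci i (DT z - tt z (wd []) - tt (wd []) z) \<in> ?J"
    using primitive_WJ[OF assms(1) HOL.refl] unfolding WJ_def
    by (rule plin_span[OF Ci_plin _ _ JS])
      (auto simp: Ci_tt long_lookup[OF long_J[OF assms(2)]] pm.subspace_0[OF JS] intro: pm.subspace_scale[OF JS])
  then have "dd i z \<in> ?J"
    by (simp add: plin_diff[OF Ci_plin] Ci_tt long_lookup[OF assms(3)] lookup_single dd_Ci)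
  then show ?thesis by (rule iota_J)
qed

section \<open>Relations as skew primitive elements of \<open>F\<close>\<close>

definition W2 where "W2 G = pm.span {tt f h | f h. f \<in> idl G \<or> h \<in> idl G}"

lemma W2_subspace: "pm.subspace (W2 G)" unfolding W2_def by (rule pm.subspace_span)

lemma W2_base: "f \<in> idl G \<or> h \<in> idl G \<Longrightarrow> tt f h \<in> W2 G"
  unfolding W2_def by (rule pm.span_base) blast

lemma W2_mono: "G \<subseteq> G' \<Longrightarrow> W2 G \<subseteq> W2 G'"
  unfolding W2_def using idl_mono[of G G'] by (intro pm.span_mono) blast

lemma om_tt_word: "om (tt f (wd v)) = tt (\<iota> f \<star> mn [] (word_degree g v)) (mn v 0)"
  by (rule plin_eq[OF plin_compose[OF om_plin tt_left] plin_compose[OF tt_left plin_compose[OF tmul_left \<iota>_plin]]])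
    (simp add: om_def)

text \<open>\<open>om\<close> multiplies the left factor by the degree of each word on the right. A
  combination of words survives as one pure tensor because all its words have the same degree; this
  carries \<open>TV \<otimes> J\<close> into \<open>F \<otimes> I\<close>.\<close>

lemma om_tt_anagram:
  assumes "anagram w r"
  shows "om (tt (wd u) (tv (tv (wd p) r) (wd q))) =
    tt (mn u (word_degree g p + word_degree g w + word_degree g q)) (mn p 0 \<star> \<iota> r \<star> mn q 0)"
proof (rule plin_eqI[where S = "\<lambda>r. om (tt (wd u) (tv (tv (wd p) r) (wd q)))" and
      T = "\<lambda>r. tt (mn u (word_degree g p + word_degree g w + word_degree g q)) (mn p 0 \<star> \<iota> r \<star> mn q 0)"])
  show "plin (\<lambda>r. om (tt (wd u) (tv (tv (wd p) r) (wd q))))"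
    by (rule plin_compose[OF om_plin plin_compose[OF tt_right plin_compose[OF tmul_left tmul_right]]])
  show "plin (\<lambda>r. tt (mn u (word_degree g p + word_degree g w + word_degree g q)) (mn p 0 \<star> \<iota> r \<star> mn q 0))"
    by (rule plin_compose[OF tt_right plin_compose[OF tmul_left plin_compose[OF tmul_right \<iota>_plin]]])
  show "keys r \<subseteq> {v. mset v = mset w}" using assms by (simp add: anagram_def)
  fix v assume "v \<in> {v. mset v = mset w}"
  then have "word_degree g v = word_degree g w" by (auto intro: word_degree_mset)
  then show "om (tt (wd u) (tv (tv (wd p) (wd v)) (wd q))) =
    tt (mn u (word_degree g p + word_degree g w + word_degree g q)) (mn p 0 \<star> \<iota> (wd v) \<star> mn q 0)"
    by (simp add: om_def add.assoc)
qed

text \<open>The image of \<open>primitive_WJ\<close> under \<open>om\<close>, which fixes the shape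
  of \<open>z \<otimes> 1\<close> and turns \<open>1 \<otimes> z\<close> into
  \<open>g\<^sub>w \<otimes> z\<close>.\<close>

lemma primitive_Delta:
  assumes "primitive_modulo \<chi> g (genideal (tensor_algebra UNIV) G) z" "\<forall>r\<in>G. \<exists>w. anagram w r" "anagram w z"
  shows "Delta (\<iota> z) - tt (\<iota> z) (mn [] 0) - tt (mn [] (word_degree g w)) (\<iota> z) \<in> W2 (\<iota> ` G)"
proof -
  let ?J = "genideal (tensor_algebra UNIV) G :: ('i list \<Rightarrow>\<^sub>0 'k) set"
  have 1: "om (tt j y) \<in> W2 (\<iota> ` G)" if "j \<in> ?J" for j y
    by (rule plin_in[OF plin_compose[OF om_plin tt_right] W2_subspace subset_UNIV])
      (auto simp: om_tt_word intro!: W2_base idl_right iota_J that simp del: tt_single)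
  have 2: "om (tt y j) \<in> W2 (\<iota> ` G)" if "j \<in> ?J" for j y
  proof (rule plin_in[where T = "\<lambda>y. om (tt y j)", OF plin_compose[OF om_plin tt_left] W2_subspace subset_UNIV])
    fix u
    show "om (tt (wd u) j) \<in> W2 (\<iota> ` G)"
    proof (rule plin_span[OF plin_compose[OF om_plin tt_right] that[unfolded genideal_TV] _ W2_subspace])
      fix x assume "x \<in> {tv (tv (wd p) r) (wd q) | p q r. r \<in> G}"
      then obtain p q r where x: "x = tv (tv (wd p) r) (wd q)" and r: "r \<in> G" by blast
      obtain w where "anagram w r" using assms(2) r by blast
      from om_tt_anagram[OF this] show "om (tt (wd u) x) \<in> W2 (\<iota> ` G)"
        unfolding x using W2_base idl_right[OF idl_left[OF idl_base[OF imageI[OF r]]]] by metis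
    qed
  qed
  have "om (DT z - tt z (wd []) - tt (wd []) z) \<in> W2 (\<iota> ` G)"
    using primitive_WJ[OF assms(1) HOL.refl] unfolding WJ_def
    by (rule plin_span[OF om_plin _ _ W2_subspace]) (use 1 2 in blast)
  moreover have "om (tt z (wd [])) = tt (\<iota> z) (mn [] 0)"
    unfolding om_tt_word by (simp only: word_degree_simps star_one)
  moreover have "om (tt (wd []) z) = tt (mn [] (word_degree g w)) (\<iota> z)"
  proof -
    have "tv (tv (wd []) z) (wd []) = z"
      by (rule plin_eq[where S = "\<lambda>z. tv (tv (wd []) z) (wd [])", OF plin_compose[OF tmul_left tmul_right] plin_id]) simp
    then show ?thesis using om_tt_anagram[OF assms(3), of "[]" "[]" "[]"] by (simp only: word_degree_simps star_one add_0_left add_0_right)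
  qed
  ultimately show ?thesis by (simp only: plin_diff[OF om_plin] Delta_iota)
qed

section \<open>The braid group action\<close>

lemma strand_length [simp]: "length (snd (strand_action \<chi> g js cx)) = length (snd cx)"
  by (auto simp: strand_action_def split: prod.splits)

lemma strands_length [simp]: "length (snd (foldr (strand_action \<chi> g) b cx)) = length (snd cx)"
  by (induction b) auto

lemma strands_mset:
  assumes "b \<in> braid_words (length w)"
  shows "mset (snd (foldr (strand_action \<chi> g) b (c, w))) = mset w"
  using assms
proof (induction b)
  case (Cons js b)
  obtain j s where js: "js = (j, s)" by force
  obtain c' w' where cx: "foldr (strand_action \<chi> g) b (c, w) = (c', w')" by force
  have l: "length w' = length w" using strands_length[of b "(c, w)"] cx by simp
  have "Suc j < length w" "b \<in> braid_words (length w)" using Cons.prems by (auto simp: braid_words_def js)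
  then show ?case using Cons.IH mset_swap[of "Suc j" w' j] cx l by (simp add: js strand_action_def)
qed simp

text \<open>The action is defined on braid words; its invariance under the generating moves is what
  makes \<open>induced\<close> in \<open>braid_action\<close> well defined on the braid group.
  Inverse letters cancel because \<open>\<chi> i (- a)\<close> is the inverse of
  \<open>\<chi> i a\<close>.\<close>

lemma braid_eq_action:
  assumes "braid_eq l b b'" "length w = l"
  shows "foldr (strand_action \<chi> g) b (c, w) = foldr (strand_action \<chi> g) b' (c, w)"
  using assms
proof (induction arbitrary: c w rule: braid_eq.induct)
  case (append a a' b b')
  obtain c' w' where cx: "foldr (strand_action \<chi> g) b (c, w) = (c', w')" by force
  have "length w' = l" using strands_length[of b "(c, w)"] cx append.prems by simp
  then show ?case using append.IH(1)[of w' c'] append.IH(2)[OF append.prems, of c] cx by simp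
next
  case (cancel j s)
  have "w[j := w ! Suc j, Suc j := w ! j, j := w ! j, Suc j := w ! Suc j] = w"
    by (rule nth_equalityI) (use cancel in \<open>auto simp: nth_list_update\<close>)
  then show ?case using cancel
    by (cases s) (simp_all add: strand_action_def nth_list_update mult.assoc char_neg)
next
  case (far i j)
  have "w[j := w ! Suc j, Suc j := w ! j, i := w ! Suc i, Suc i := w ! i] = w[i := w ! Suc i, Suc i := w ! i, j := w ! Suc j, Suc j := w ! j]"
    by (rule nth_equalityI) (use far in \<open>auto simp: nth_list_update\<close>)
  then show ?case using far by (simp add: strand_action_def nth_list_update mult_ac)
next
  case (braid j)
  have "j < length w" "Suc j < length w" "Suc (Suc j) < length w" using braid by auto
  then show ?case by (auto simp: strand_action_def nth_list_update mult_ac intro!: nth_equalityI)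
qed auto

lemma braid_action_anagram:
  assumes "\<xi> \<in> carrier (braid_algebra (length w))"
  shows "anagram w (braid_action \<chi> g \<xi> w)"
proof -
  let ?B = "{v. mset v = mset w}"
  have "(case induced (\<lambda>b. foldr (strand_action \<chi> g) b (1, w)) C of
          (c, v) \<Rightarrow> single v (lookup \<xi> C * c)) \<in> {f. keys f \<subseteq> ?B}"
    if C: "C \<in> keys \<xi>" for C
  proof -
    have "C \<in> carrier (braid_group (length w))"
      using assms C by (auto simp: braid_algebra_def monoid_algebra_def)
    then obtain b where b: "b \<in> braid_words (length w)" "C = {b'. braid_eq (length w) b b'}"
      by (auto simp: braid_group_def quotient_def Image_def elim!: quotientE)
    have "b \<in> C" using b by (auto intro: braid_eq.refl)
    moreover have "foldr (strand_action \<chi> g) b' (1, w) = foldr (strand_action \<chi> g) b (1, w)" if "b' \<in> C" for b'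
      using that b braid_eq_action[of "length w" b b' w 1] by auto
    ultimately have "(\<lambda>b. foldr (strand_action \<chi> g) b (1, w)) ` C = {foldr (strand_action \<chi> g) b (1, w)}" by blast
    then have "induced (\<lambda>b. foldr (strand_action \<chi> g) b (1, w)) C = foldr (strand_action \<chi> g) b (1, w)"
      by (simp add: induced_def)
    then show ?thesis using strands_mset[OF b(1), of 1] by (auto split: prod.splits)
  qed
  then have "braid_action \<chi> g \<xi> w \<in> {f. keys f \<subseteq> ?B}"
    unfolding braid_action_def by (intro pm.subspace_sum[OF keys_subspace]) blast
  then show ?thesis by (simp add: anagram_def)
qed

lemma braided_element_anagram:
  assumes "braided_element \<chi> g blk r z"
  shows "\<exists>w. anagram w z \<and> (\<forall>i\<in>set w. blk i = r) \<and> long z"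
proof -
  obtain \<xi> w where w: "2 \<le> length w" "\<xi> \<in> carrier (braid_algebra (length w))" "\<forall>i\<in>set w. blk i = r" "z = braid_action \<chi> g \<xi> w"
    using assms unfolding braided_element_def by blast
  have a: "anagram w z" unfolding w(4) by (rule braid_action_anagram[OF w(2)])
  moreover have "long z" unfolding long_def
  proof
    fix v assume "v \<in> keys z"
    then have "mset v = mset w" using a by (auto simp: anagram_def)
    then show "v \<in> {v. 2 \<le> length v}" using w(1) mset_eq_length by fastforce
  qed
  ultimately show ?thesis using w by blast
qed

end

section \<open>The coaction\<close>

text \<open>The hypotheses of the theorem. Since \<open>lam\<close> is a parameter, the locale can
  be interpreted again at zero inside proofs, turning results on \<open>A(\<lambda>)\<close> into
  results on \<open>H^0\<close>.\<close>

locale lifting_datum =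
  fixes \<chi> :: "'i::finite \<Rightarrow> 'g::ab_group_add \<Rightarrow> 'k::comm_ring_1"
    and g :: "'i \<Rightarrow> 'g" and blk :: "'i \<Rightarrow> nat" and N L :: nat
    and R :: "('i list \<Rightarrow>\<^sub>0 'k) set" and Rc :: "nat \<Rightarrow> ('i list \<Rightarrow>\<^sub>0 'k) set"
    and lam :: "'i \<times> 'i \<Rightarrow> 'k"
  assumes charr: "\<And>i. is_character (\<chi> i)"
    and blk_range: "range blk = {1..N}"
    and qqq: "\<And>i j. blk i \<noteq> blk j \<Longrightarrow> \<chi> j (g i) * \<chi> i (g j) = 1"
    and braided: "\<And>z. z \<in> R \<Longrightarrow> \<exists>r. braided_element \<chi> g blk r z"
    and chain_0: "Rc 0 = {}" and chain_L: "Rc L = R"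
    and chain_mono: "\<And>h. h < L \<Longrightarrow> Rc h \<subseteq> Rc (Suc h)"
    and chain_primitive: "\<And>h z. 0 < h \<Longrightarrow> h \<le> L \<Longrightarrow> z \<in> Rc h \<Longrightarrow>
           primitive_modulo \<chi> g (genideal (tensor_algebra UNIV) (Rc (h - 1))) z"
begin

sublocale yetter_drinfeld \<chi> g by unfold_locales (rule charr)

definition l where "l i j = ext_by_zero (Xi \<chi> blk) lam (i, j)"

lemma chain_R: "h \<le> L \<Longrightarrow> Rc h \<subseteq> R"
proof (induction "L - h" arbitrary: h)
  case 0
  then show ?case using chain_L by auto
next
  case (Suc n)
  then have "Rc (Suc h) \<subseteq> R" by (intro Suc.hyps(1)) auto
  moreover have "h < L" using Suc by linarith
  ultimately show ?case using chain_mono[of h] by blast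
qed

lemma R_anagram: "z \<in> R \<Longrightarrow> \<exists>w r. anagram w z \<and> (\<forall>i\<in>set w. blk i = r) \<and> long z"
  using braided braided_element_anagram by blast

lemma chain_dd: "Suc h \<le> L \<Longrightarrow> z \<in> Rc (Suc h) \<Longrightarrow> \<iota> (dd i z) \<in> idl (\<iota> ` Rc h)"
proof (rule primitive_dd)
  assume h: "Suc h \<le> L" and z: "z \<in> Rc (Suc h)"
  then show "primitive_modulo \<chi> g (genideal (tensor_algebra UNIV) (Rc h)) z"
    using chain_primitive[of "Suc h" z] by simp
  have "Rc h \<subseteq> R" "Rc (Suc h) \<subseteq> R" using h chain_R[of h] chain_R[of "Suc h"] by simp_all
  then show "\<forall>r\<in>Rc h. long r" "long z" using R_anagram z by blast+
qed

lemma reduced_any: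
  fixes l' :: "'i \<Rightarrow> 'i \<Rightarrow> 'k"
  assumes "\<And>i j a. l' i j * (\<chi> i a * \<chi> j a) = l' i j"
  shows "reduced \<chi> g blk l' R Rc L"
proof -
  interpret lf: liftings \<chi> g blk l' by unfold_locales (simp_all add: qqq assms)
  show ?thesis
  proof unfold_locales
    show "z \<in> R \<Longrightarrow> \<exists>w r. lf.in_block w r z" for z
      unfolding lf.in_block_def using R_anagram by blast
  qed (use chain_0 chain_L chain_R chain_dd in auto)
qed

sublocale reduced \<chi> g blk l R Rc L
  by (rule reduced_any) (auto simp: l_def ext_by_zero_def Xi_def)

text \<open>\<open>NN\<close>, \<open>K\<close> and \<open>I_R\<close> do not mention the
  coefficients, hence they are literally the same sets in both interpretations, whereas
  \<open>nf\<close>, \<open>I'\<close> and \<open>I_lam\<close> differ. This identity is what makes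
  \<open>H^0\<close> and \<open>A(\<lambda>)\<close> comparable.\<close>

sublocale Z: reduced \<chi> g blk "\<lambda>i j. 0" R Rc L
  by (rule reduced_any) simp

lemma iota_ad: "\<iota> (ad_c \<chi> g i j) = mn [i, j] 0 - single ([j, i], 0) (\<chi> j (g i))"
  by (simp add: ad_c_def plin_diff[OF \<iota>_plin])

lemma A_ideal_eq: "A_ideal \<chi> g blk R lam = I_lam"
  unfolding A_ideal_def I_lam_def TV_to_F genideal_idl iota_ad rl_def l_def Theta_def by simp

lemma H0_ideal_eq: "H0_ideal \<chi> g blk R = Z.I_lam"
  unfolding H0_ideal_def Z.I_lam_def TV_to_F genideal_idl iota_ad Z.rl_def Theta_def by simp

lemma A_ideal_ideal: "ideal (A_ideal \<chi> g blk R lam) (F_alg \<chi>)"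
  unfolding A_ideal_def by (rule F.genideal_ideal) simp

lemma H0_ideal_ideal: "ideal (H0_ideal \<chi> g blk R) (F_alg \<chi>)"
  unfolding H0_ideal_def by (rule F.genideal_ideal) simp

sublocale QA: kquot_alg "F_alg \<chi>" "A_ideal \<chi> g blk R lam"
  by (rule kquot_alg.intro[OF F_kalgebra kquot_alg_axioms.intro[OF A_ideal_ideal]])

sublocale QH: kquot_alg "F_alg \<chi>" "H0_ideal \<chi> g blk R"
  by (rule kquot_alg.intro[OF F_kalgebra kquot_alg_axioms.intro[OF H0_ideal_ideal]])

abbreviation "AA \<equiv> QA.Q"
abbreviation "HH \<equiv> QH.Q"
abbreviation "pA f \<equiv> A_ideal \<chi> g blk R lam +>\<^bsub>F_alg \<chi>\<^esub> f"
abbreviation "pH f \<equiv> H0_ideal \<chi> g blk R +>\<^bsub>F_alg \<chi>\<^esub> f"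

lemma A_alg_eq: "A_alg \<chi> g blk R lam = AA" by (simp add: A_alg_def)
lemma H0_alg_eq: "H0_alg \<chi> g blk R = HH" by (simp add: H0_alg_def)

sublocale AA: kalgebra AA by (rule QA.quot_kalgebra)
sublocale HH: kalgebra HH by (rule QH.quot_kalgebra)

sublocale HA: bialg HH AA by unfold_locales

lemma pA_closed [simp, intro]: "pA f \<in> carrier AA" and pH_closed [simp, intro]: "pH f \<in> carrier HH"
  by auto

lemma pA_simps: "pA f \<oplus>\<^bsub>AA\<^esub> pA h = pA (f + h)" "pA f \<otimes>\<^bsub>AA\<^esub> pA h = pA (f \<star> h)"
   "c \<odot>\<^bsub>AA\<^esub> pA f = pA (scale c f)" "\<one>\<^bsub>AA\<^esub> = pA (mn [] 0)"
  using QA.quot_add[of f h] QA.quot_mult[of f h] QA.quot_smul[of f c] QA.quot_one by auto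

lemma pH_simps: "pH f \<oplus>\<^bsub>HH\<^esub> pH h = pH (f + h)" "pH f \<otimes>\<^bsub>HH\<^esub> pH h = pH (f \<star> h)"
   "c \<odot>\<^bsub>HH\<^esub> pH f = pH (scale c f)" "\<one>\<^bsub>HH\<^esub> = pH (mn [] 0)"
  using QH.quot_add[of f h] QH.quot_mult[of f h] QH.quot_smul[of f c] QH.quot_one by auto

lemma pA_zero: "pA f = \<zero>\<^bsub>AA\<^esub> \<longleftrightarrow> f \<in> I_lam" 
  using QA.coset_zero_iff[of f] unfolding QA.quot_zero by (simp add: A_ideal_eq)

lemma pH_zero: "pH f = \<zero>\<^bsub>HH\<^esub> \<longleftrightarrow> f \<in> Z.I_lam"
  using QH.coset_zero_iff[of f] unfolding QH.quot_zero by (simp add: H0_ideal_eq)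

lemma pA_eq: "pA f = pA h \<longleftrightarrow> f - h \<in> I_lam"
  using QA.coset_eq_iff[of f h] by (simp add: A_ideal_eq a_minus_def)

lemma pH_eq: "pH f = pH h \<longleftrightarrow> f - h \<in> Z.I_lam"
  using QH.coset_eq_iff[of f h] by (simp add: H0_ideal_eq a_minus_def)

lemma AA_cases: assumes "x \<in> carrier AA" obtains f where "x = pA f"
  using assms by (auto simp: QA.quot_carrier)
lemma HH_cases: assumes "x \<in> carrier HH" obtains f where "x = pH f"
  using assms by (auto simp: QH.quot_carrier)

lemma plin_pA: "plin T \<Longrightarrow> (\<lambda>y. pA (T y)) \<in> linear_maps (twisted_algebra B m t e) AA"
  by (rule linear_mapsI) (simp_all add: pA_simps plin_add plin_scale)

lemma plin_pH: "plin T \<Longrightarrow> (\<lambda>y. pH (T y)) \<in> linear_maps (twisted_algebra B m t e) HH"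
  by (rule linear_mapsI) (simp_all add: pH_simps plin_add plin_scale)

abbreviation "TT \<equiv> tensor HH AA"
abbreviation "pt \<equiv> pure_tensor HH AA"

text \<open>The projection of \<open>F \<otimes> F\<close> onto
  \<open>H^0 \<otimes> A(\<lambda>)\<close>, as it occurs inside
  \<open>induced_coproduct\<close>.\<close>

definition PP where "PP = free_lift TT (\<lambda>(b, c). pt (pH (single b 1)) (pA (single c 1)))"

lemma PP_lm: "PP \<in> linear_maps (twisted_algebra UNIV m t e) TT"
  unfolding PP_def by (rule free_lift_lm[OF HA.tensor_kmodule]) auto

lemma PP_single: "PP (single (b, c) 1) = pt (pH (single b 1)) (pA (single c 1))"
  unfolding PP_def by (subst free_lift_single[OF HA.tensor_kmodule]) auto

lemma PP_add: "PP (x + y) = PP x \<oplus>\<^bsub>TT\<^esub> PP y" and PP_scale: "PP (scale c x) = c \<odot>\<^bsub>TT\<^esub> PP x"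
  and PP_closed: "PP x \<in> carrier TT"
  using lm_add[OF PP_lm, where x = x and y = y] lm_smul[OF PP_lm, where x = x and c = c]
    lm_closed[OF PP_lm, where x = x] by simp_all

lemma PP_tt: "PP (tt f h) = pt (pH f) (pA h)"
proof (rule lm_eqI_keys[where S = "\<lambda>f. PP (tt f h)" and T = "\<lambda>f. pt (pH f) (pA h)" and B = UNIV and m = undefined and t = undefined and e = undefined, OF _ _ HA.tensor_kmodule])
  show "(\<lambda>f. PP (tt f h)) \<in> linear_maps (twisted_algebra UNIV undefined undefined undefined) TT"
    by (rule linear_mapsI) (simp_all add: tt_lin PP_add PP_scale PP_closed)
  show "(\<lambda>f. pt (pH f) (pA h)) \<in> linear_maps (twisted_algebra UNIV undefined undefined undefined) TT"
    by (rule lm_compose[OF plin_pH[OF plin_id] HA.pt_lm_left]) auto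
  fix b
  show "PP (tt (single b 1) h) = pt (pH (single b 1)) (pA h)"
  proof (rule lm_eqI_keys[where B = UNIV and m = undefined and t = undefined and e = undefined, OF _ _ HA.tensor_kmodule _ subset_UNIV])
    show "(\<lambda>h. PP (tt (single b 1) h)) \<in> linear_maps (twisted_algebra UNIV undefined undefined undefined) TT"
      by (rule linear_mapsI) (simp_all add: tt_lin PP_add PP_scale PP_closed)
    show "(\<lambda>h. pt (pH (single b 1)) (pA h)) \<in> linear_maps (twisted_algebra UNIV undefined undefined undefined) TT"
      by (rule lm_compose[OF plin_pA[OF plin_id] HA.pt_lm_right]) auto
  qed (simp add: PP_single)
qed simp

text \<open>Evaluates a map out of the tensor product on a representative \<open>y\<close>. The set
  \<open>B\<close> restricts the comparison to the basis pairs that occur in \<open>y\<close>; for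
  coproducts of normal elements these are pairs of normal words, where the section is known.\<close>

lemma PP_lift:
  assumes "kmodule (P :: ('k, 'p) module)" "HA.bilin P \<beta>" "T \<in> linear_maps (twisted_algebra UNIV m t e) P"
    and "\<And>b c. (b, c) \<in> B \<Longrightarrow> T (single (b, c) 1) = \<beta> (pH (single b 1), pA (single c 1))"
    and "keys y \<subseteq> B"
  shows "tensor_lift P \<beta> (PP y) = T y"
proof -
  note lm = HA.tensor_lift_lm[OF assms(1,2)] and pure = HA.tensor_lift_pure[OF assms(1,2)]
  have r: "f \<in> linear_maps (twisted_algebra B m t e) P" if "f \<in> linear_maps (twisted_algebra UNIV m t e) P" for f :: "(('i list \<times> 'g) \<times> ('i list \<times> 'g) \<Rightarrow>\<^sub>0 'k) \<Rightarrow> 'p"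
    using that by (auto simp: linear_maps_def)
  show ?thesis
    by (rule lm_eqI_keys[OF r[OF lm_compose[OF PP_lm lm]] r[OF assms(3)] assms(1) _ assms(5)])
      (use assms(4) in \<open>auto simp: PP_single pure\<close>)
qed

lemma PP_hom: "PP \<in> algebra_hom (F_square \<chi>) TT"
  unfolding F_square_eq
proof (rule twisted_hom[OF PP_lm HA.tensor_kalgebra])
  show "PP (single (([], 0), ([], 0)) 1) = \<one>\<^bsub>TT\<^esub>"
    by (simp add: PP_single HA.pt_one pA_simps pH_simps)
  fix x y :: "('i list \<times> 'g) \<times> ('i list \<times> 'g)"
  obtain b c b' c' where x: "x = (b, c)" "y = (b', c')" by (metis surj_pair)
  let ?s = "\<lambda>b. single b 1 :: 'i list \<times> 'g \<Rightarrow>\<^sub>0 'k"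
  have "PP (tt (?s b \<star> ?s b') (?s c \<star> ?s c')) = PP (tt (?s b) (?s c)) \<otimes>\<^bsub>TT\<^esub> PP (tt (?s b') (?s c'))"
    unfolding PP_tt by (simp add: HA.pt_mult pA_simps pH_simps del: tmul_single)
  then show "PP (single ((\<lambda>(b, c) (b', c'). (mF b b', mF c c')) x y) ((\<lambda>(b, c) (b', c'). tF b b' * tF c c') x y))
    = PP (single x 1) \<otimes>\<^bsub>TT\<^esub> PP (single y 1)"
    by (simp add: x)
qed auto

definition DD where "DD f = PP (Delta f)"

lemma DD_hom: "DD \<in> algebra_hom (F_alg \<chi>) TT"
  unfolding DD_def by (rule ah_compose[OF Delta_hom PP_hom])

lemma PP_W2: "x \<in> W2 (\<iota> ` R) \<Longrightarrow> PP x = \<zero>\<^bsub>TT\<^esub>"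
proof -
  interpret K: kmodule "twisted_algebra UNIV undefined undefined undefined :: ('k, ('i list \<times> 'g) \<times> ('i list \<times> 'g) \<Rightarrow>\<^sub>0 'k) module" by simp
  let ?V = "{x. PP x = \<zero>\<^bsub>TT\<^esub>}"
  have V: "pm.subspace ?V"
    using lm_zero[OF PP_lm[of undefined undefined undefined] K.kmodule_axioms HA.tensor_kmodule]
    by (intro pm.subspaceI) (simp_all add: PP_add PP_scale)
  assume "x \<in> W2 (\<iota> ` R)"
  moreover have "W2 (\<iota> ` R) \<subseteq> ?V"
    unfolding W2_def
  proof (rule pm.span_minimal[OF _ V], rule subsetI)
    fix y assume "y \<in> {tt f h |f h. f \<in> idl (\<iota> ` R) \<or> h \<in> idl (\<iota> ` R)}"
    then obtain f h where y: "y = tt f h" "f \<in> I_R \<or> h \<in> I_R" unfolding I_R_def by blast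
    then have "pH f = \<zero>\<^bsub>HH\<^esub> \<or> pA h = \<zero>\<^bsub>AA\<^esub>"
      using I_R_I_lam Z.I_R_I_lam unfolding pA_zero pH_zero by blast
    then show "y \<in> ?V" unfolding y by (auto simp: PP_tt)
  qed
  ultimately show "PP x = \<zero>\<^bsub>TT\<^esub>" by blast
qed

lemma R_primitive:
  assumes "Suc h \<le> L" "z \<in> Rc (Suc h)" "anagram w z"
  shows "Delta (\<iota> z) - tt (\<iota> z) (mn [] 0) - tt (mn [] (word_degree g w)) (\<iota> z) \<in> W2 (\<iota> ` Rc h)"
  by (rule primitive_Delta[OF _ _ assms(3)])
    (use chain_primitive[of "Suc h" z] assms R_anagram chain_R[of h] in \<open>auto, blast\<close>)

lemma R_W2:
  assumes "z \<in> R" shows "Delta (\<iota> z) \<in> W2 (\<iota> ` R)"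
proof -
  \<comment> \<open>The last stage of the chain is \<open>R\<close> itself, and \<open>L\<close> is
    positive since \<open>R\<close> has an element.\<close>
  obtain h where h: "L = Suc h" using chain_0 chain_L assms by (cases L) auto
  obtain w where w: "anagram w z" using R_anagram assms by blast
  have "\<iota> z \<in> idl (\<iota> ` R)" by (rule idl_base) (use assms in simp)
  then have "Delta (\<iota> z) - tt (\<iota> z) (mn [] 0) - tt (mn [] (word_degree g w)) (\<iota> z) + tt (\<iota> z) (mn [] 0) + tt (mn [] (word_degree g w)) (\<iota> z) \<in> W2 (\<iota> ` R)"
    using R_primitive[of h z w] w assms h chain_L chain_R[of h] W2_mono[of "\<iota> ` Rc h" "\<iota> ` R"]
    by (intro pm.subspace_add[OF W2_subspace] W2_base) auto
  then show ?thesis by simp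
qed

text \<open>The mixed terms cancel by \<open>qq\<close>, and the term with \<open>l i j\<close> is
  grouplike, so it can be assigned wholly to the right factor. The left factor is then the relation
  of \<open>H^0\<close> and the right one that of \<open>A(\<lambda>)\<close>, which explains the
  target of the coaction.\<close>

lemma Delta_rl:
  assumes "blk j < blk i"
  shows "Delta (rl i j) = tt (Z.rl i j) (mn [] 0) + tt (mn [] (g i + g j)) (rl i j)"
proof -
  let ?q = "\<chi> j (g i)"
  have q: "?q * \<chi> i (g j) = 1" using qqq[of i j] assms by simp
  have "mn [i, j] 0 = mn [i] 0 \<star> mn [j] 0" "single ([j, i], 0) ?q = scale ?q (mn [j] 0 \<star> mn [i] 0)"
     "single ([], g i + g j) (l i j) = scale (l i j) (mn [] (g i + g j))" by simp_all
  then have "Delta (rl i j) = dx i \<bullet> dx j - scale ?q (dx j \<bullet> dx i) - scale (l i j) (gl (g i + g j))"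
    unfolding rl_def by (simp only: plin_diff[OF Delta_plin] plin_scale[OF Delta_plin] Delta_mult Delta_x1) (simp only: Delta_mn cw_simps)
  also have "dx i \<bullet> dx j = tt (mn [i, j] 0) (mn [] 0) + tt (mn [i] (g j)) (mn [j] 0)
     + (tt (scale ?q (mn [j] (g i))) (mn [i] 0) + tt (mn [] (g i + g j)) (mn [i, j] 0))"
    by (simp add: plin_add[OF tmul_left] plin_add[OF tmul_right] add_ac)
  also have "scale ?q (dx j \<bullet> dx i) = tt (scale ?q (mn [j, i] 0)) (mn [] 0) + tt (scale ?q (mn [j] (g i))) (mn [i] 0)
     + (tt (mn [i] (g j)) (mn [j] 0) + tt (mn [] (g i + g j)) (scale ?q (mn [j, i] 0)))"
    using q by (simp add: plin_add[OF tmul_left] plin_add[OF tmul_right] pm.scale_right_distrib add_ac)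
  finally show ?thesis
    unfolding rl_def Z.rl_def by (simp add: tt_lin algebra_simps)
qed

lemma DD_I_lam: "f \<in> A_ideal \<chi> g blk R lam \<Longrightarrow> DD f = \<zero>\<^bsub>TT\<^esub>"
proof -
  let ?K = "{x \<in> carrier (F_alg \<chi>). DD x = \<zero>\<^bsub>TT\<^esub>}"
  have K: "ideal ?K (F_alg \<chi>)" by (rule ah_kernel_ideal[OF DD_hom F_kalgebra HA.tensor_kalgebra])
  have 1: "DD (\<iota> z) = \<zero>\<^bsub>TT\<^esub>" if "z \<in> R" for z unfolding DD_def by (rule PP_W2[OF R_W2[OF that]])
  have 2: "DD (rl i j) = \<zero>\<^bsub>TT\<^esub>" if "blk j < blk i" for i j
  proof -
    have "Z.rl i j \<in> Z.I_lam" unfolding Z.I_lam_def by (rule idl_base) (use that in blast)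
    then have a: "pH (Z.rl i j) = \<zero>\<^bsub>HH\<^esub>" by (simp add: pH_zero)
    have "rl i j \<in> I_lam" unfolding I_lam_def by (rule idl_base) (use that in blast)
    then have b: "pA (rl i j) = \<zero>\<^bsub>AA\<^esub>" by (simp add: pA_zero)
    show ?thesis unfolding DD_def Delta_rl[OF that] PP_add PP_tt a b by simp
  qed
  assume f: "f \<in> A_ideal \<chi> g blk R lam"
  have "I_lam = genideal (F_alg \<chi>) (\<iota> ` R \<union> {rl i j |i j. blk j < blk i})" by (simp add: I_lam_def genideal_idl)
  also have "\<dots> \<subseteq> ?K" by (rule F.genideal_minimal[OF K]) (use 1 2 in auto)
  finally show ?thesis using f unfolding A_ideal_eq by blast
qed

definition rho where "rho = A_coaction \<chi> g blk R lam"

lemma rho_induced: "rho = induced DD"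
  unfolding rho_def A_coaction_def induced_coproduct_def Let_def F_coproduct DD_def PP_def ..

lemma rho_pA: "rho (pA f) = DD f"
  unfolding rho_induced
  by (rule QA.induced_eq[OF ah_lm[OF DD_hom] HA.tensor_kmodule DD_I_lam]) auto

lemma rho_hom: "rho \<in> algebra_hom AA TT"
  unfolding rho_induced by (rule QA.induced_hom[OF DD_hom HA.tensor_kalgebra DD_I_lam])

lemma counit_I0: "f \<in> H0_ideal \<chi> g blk R \<Longrightarrow> F_counit f = 0"
proof -
  have long_ee: "ee (\<iota> z) = 0" if "long z" for z
  proof -
    have k: "keys z \<subseteq> {v. 2 \<le> length v}" using that by (simp add: long_def)
    show ?thesis by (rule plin_eqI[OF plin_compose[OF ee_plin \<iota>_plin] plin_null _ k]) auto
  qed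
  let ?V = "{x. ee x = 0}"
  have "Z.I_lam \<subseteq> ?V"
    unfolding Z.I_lam_def idl_def
  proof (rule pm.span_minimal, rule subsetI)
    show "pm.subspace ?V" by (rule pm.subspaceI) (simp_all add: plin_add[OF ee_plin] plin_scale[OF ee_plin] plin_zero[OF ee_plin])
    fix x assume "x \<in> {mn u a \<star> r \<star> mn v b |u a v b r. r \<in> \<iota> ` R \<union> {Z.rl i j |i j. blk j < blk i}}"
    then obtain u a r v b where x: "x = mn u a \<star> r \<star> mn v b" and r: "r \<in> \<iota> ` R \<union> {Z.rl i j |i j. blk j < blk i}" by blast
    have "ee r = 0"
      using r long_ee R_anagram by (auto simp: Z.rl_def plin_diff[OF ee_plin], auto simp: ee_def)
    then show "x \<in> ?V" unfolding x by (simp add: ee_mult star_lin)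
  qed
  then show "f \<in> H0_ideal \<chi> g blk R \<Longrightarrow> F_counit f = 0"
    unfolding H0_ideal_eq counit_ee by auto
qed

lemma H0_counit_pH: "H0_counit (pH f) = F_counit f"
proof -
  have "F_counit ` (pH f) = {F_counit f}"
  proof (rule QH.coset_const)
    fix x y assume "x \<ominus>\<^bsub>F_alg \<chi>\<^esub> y \<in> H0_ideal \<chi> g blk R"
    then have "x - y \<in> H0_ideal \<chi> g blk R" by (simp add: a_minus_def)
    from counit_I0[OF this] counit_add[of "x - y" y] show "F_counit x = F_counit y" by simp
  qed simp
  then show ?thesis by (simp add: H0_counit_def induced_def)
qed

end

section \<open>Coassociativity and counit in the quotients\<close>

context lifting_datum
begin

lemma A_ideal_zero: "A_ideal \<chi> g blk R (\<lambda>_. 0) = H0_ideal \<chi> g blk R"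
  by (simp add: A_ideal_def H0_ideal_def ext_by_zero_def)

sublocale H2: bialg HH HH by unfold_locales

abbreviation "HHT \<equiv> tensor HH HH"
abbreviation "ptH \<equiv> pure_tensor HH HH"

definition PH where "PH = free_lift HHT (\<lambda>(b, c). ptH (pH (single b 1)) (pH (single c 1)))"

definition dH where "dH = H0_coproduct \<chi> g blk R"

text \<open>\<open>H^0\<close> is \<open>A(0)\<close> and its coproduct is the coaction there, so
  formulas for the coaction specialise to the coproduct.\<close>

lemma dH_coaction: "dH = A_coaction \<chi> g blk R (\<lambda>_. 0)"
  by (simp add: dH_def H0_coproduct_def A_coaction_def A_ideal_zero)

lemma dH_pH: "dH (pH f) = PH (Delta f)"
proof -
  interpret H: lifting_datum \<chi> g blk N L R Rc "\<lambda>_. 0" by (rule lifting_datum_axioms)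
  show "dH (pH f) = PH (Delta f)"
    using H.rho_pA[of f] unfolding H.rho_def H.DD_def H.PP_def dH_coaction PH_def A_ideal_zero .
qed

lemma PH_lift:
  assumes "kmodule (P :: ('k, 'p) module)" "H2.bilin P \<beta>" "T \<in> linear_maps (twisted_algebra UNIV m t e) P"
    and "\<And>b c. (b, c) \<in> B \<Longrightarrow> T (single (b, c) 1) = \<beta> (pH (single b 1), pH (single c 1))"
    and "keys y \<subseteq> B"
  shows "tensor_lift P \<beta> (PH y) = T y"
proof -
  interpret H: lifting_datum \<chi> g blk N L R Rc "\<lambda>_. 0" by (rule lifting_datum_axioms)
  show ?thesis
    by (rule H.PP_lift[unfolded H.PP_def A_ideal_zero, folded PH_def, OF assms])
qed

text \<open>A formula valid for all representatives makes \<open>\<beta>\<close> bilinear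
  automatically; \<open>PP_lift\<close> remains for maps that are known on normal representatives
  only.\<close>

lemma PP_lift_rep:
  assumes "kmodule (P :: ('k, 'p) module)" "T \<in> linear_maps (twisted_algebra UNIV m t e) P"
    and eq: "\<And>f h. \<beta> (pH f, pA h) = T (tt f h)"
  shows "tensor_lift P \<beta> (PP y) = T y"
proof (rule PP_lift[OF assms(1) _ assms(2) _ subset_UNIV])
  have T: "T (x + y) = T x \<oplus>\<^bsub>P\<^esub> T y" "T (scale c x) = c \<odot>\<^bsub>P\<^esub> T x" "T x \<in> carrier P" for x y c
    using lm_add[OF assms(2), where x = x and y = y] lm_smul[OF assms(2), where x = x and c = c]
      lm_closed[OF assms(2), where x = x] by simp_all
  show "HA.bilin P \<beta>"
    unfolding HA.bilin_def
    by (intro conjI ballI linear_mapsI; elim HH_cases AA_cases; simp add: eq pA_simps pH_simps tt_lin T)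
qed (use eq in simp)

lemma PH_lift_rep:
  assumes "kmodule (P :: ('k, 'p) module)" "T \<in> linear_maps (twisted_algebra UNIV m t e) P"
    and eq: "\<And>f h. \<beta> (pH f, pH h) = T (tt f h)"
  shows "tensor_lift P \<beta> (PH y) = T y"
proof (rule PH_lift[OF assms(1) _ assms(2) _ subset_UNIV])
  have T: "T (x + y) = T x \<oplus>\<^bsub>P\<^esub> T y" "T (scale c x) = c \<odot>\<^bsub>P\<^esub> T x" "T x \<in> carrier P" for x y c
    using lm_add[OF assms(2), where x = x and y = y] lm_smul[OF assms(2), where x = x and c = c]
      lm_closed[OF assms(2), where x = x] by simp_all
  show "H2.bilin P \<beta>"
    unfolding H2.bilin_def
    by (intro conjI ballI linear_mapsI; elim HH_cases; simp add: eq pH_simps tt_lin T)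
qed (use eq in simp)

sublocale H3: bimod HH TT by unfold_locales

abbreviation "TTT \<equiv> tensor HH TT"
abbreviation "pt3 \<equiv> pure_tensor HH TT"

definition P3 where "P3 = free_lift TTT (\<lambda>(b, y). pt3 (pH (single b 1)) (PP (single y 1)))"

lemma P3_lm: "P3 \<in> linear_maps (twisted_algebra UNIV m t e) TTT"
  unfolding P3_def by (rule free_lift_lm[OF H3.tensor_kmodule]) (auto intro: PP_closed)

lemma P3_simps: "P3 (x + y) = P3 x \<oplus>\<^bsub>TTT\<^esub> P3 y" "P3 (scale c x) = c \<odot>\<^bsub>TTT\<^esub> P3 x" "P3 x \<in> carrier TTT"
  using lm_add[OF P3_lm, where x = x and y = y] lm_smul[OF P3_lm, where x = x and c = c]
    lm_closed[OF P3_lm, where x = x] by simp_all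

lemma P3_tt: "P3 (tt f y) = pt3 (pH f) (PP y)"
proof (rule lm_eqI_keys[where S = "\<lambda>f. P3 (tt f y)" and T = "\<lambda>f. pt3 (pH f) (PP y)" and B = UNIV and m = undefined and t = undefined and e = undefined, OF _ _ H3.tensor_kmodule])
  show "(\<lambda>f. P3 (tt f y)) \<in> linear_maps (twisted_algebra UNIV undefined undefined undefined) TTT"
    by (rule linear_mapsI) (simp_all add: tt_lin P3_simps)
  show "(\<lambda>f. pt3 (pH f) (PP y)) \<in> linear_maps (twisted_algebra UNIV undefined undefined undefined) TTT"
    by (rule lm_compose[OF plin_pH[OF plin_id] H3.pt_lm_left]) (rule PP_closed)
  fix b
  show "P3 (tt (single b 1) y) = pt3 (pH (single b 1)) (PP y)"
  proof (rule lm_eqI_keys[where B = UNIV and m = undefined and t = undefined and e = undefined, OF _ _ H3.tensor_kmodule _ subset_UNIV])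
    show "(\<lambda>y. P3 (tt (single b 1) y)) \<in> linear_maps (twisted_algebra UNIV undefined undefined undefined) TTT"
      by (rule linear_mapsI) (simp_all add: tt_lin P3_simps)
    show "(\<lambda>y. pt3 (pH (single b 1)) (PP y)) \<in> linear_maps (twisted_algebra UNIV undefined undefined undefined) TTT"
      by (rule lm_compose[OF PP_lm H3.pt_lm_right]) auto
    fix c
    show "P3 (tt (single b 1) (single c 1)) = pt3 (pH (single b 1)) (PP (single c 1))"
      unfolding P3_def tt_single mult_1
      by (subst free_lift_single[OF H3.tensor_kmodule]) (simp_all add: PP_closed)
  qed
qed simp

lemma plin_P3: "plin T \<Longrightarrow> (\<lambda>y. P3 (T y)) \<in> linear_maps (twisted_algebra UNIV m t e) TTT"
  by (rule linear_mapsI) (simp_all add: P3_simps plin_add plin_scale)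

text \<open>Both sides are images under \<open>P3\<close> of the two iterated coproducts in
  \<open>F\<close>, where \<open>coassoc\<close> applies.\<close>

lemma coaction_coassoc:
  "tensor_lift TTT (\<lambda>(a, b). tensor_lift TTT (\<lambda>(a', a''). pt3 a' (pt a'' b)) (dH a)) (rho (pA f))
    = tensor_lift TTT (\<lambda>(a, b). pt3 a (rho b)) (rho (pA f))"
proof -
  have in1: "tensor_lift TTT (\<lambda>(a', a''). pt3 a' (pt a'' (pA h))) (dH (pH f)) = P3 (co1 (tt f h))" for f h
    unfolding dH_pH co1_tt
  proof (rule PH_lift_rep[OF H3.tensor_kmodule plin_P3[OF tr_left], of _ h])
    show "(case (pH f, pH f') of (a', a'') \<Rightarrow> pt3 a' (pt a'' (pA h))) = P3 (tr (tt f f') h)" for f f'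
      by (simp add: tr_tt P3_tt PP_tt)
  qed
  have "tensor_lift TTT (\<lambda>(a, b). tensor_lift TTT (\<lambda>(a', a''). pt3 a' (pt a'' b)) (dH a)) (PP y) = P3 (co1 y)" for y
    by (rule PP_lift_rep[OF H3.tensor_kmodule plin_P3[OF co1_plin]]) (simp add: in1)
  moreover have "tensor_lift TTT (\<lambda>(a, b). pt3 a (rho b)) (PP y) = P3 (co2 y)" for y
    by (rule PP_lift_rep[OF H3.tensor_kmodule plin_P3[OF co2_plin]]) (simp add: co2_tt P3_tt rho_pA DD_def)
  ultimately show ?thesis by (simp add: rho_pA DD_def coassoc)
qed

lemma counit_tt1: "lin (\<lambda>(b, c). single c (F_counit (single b (1::'k)))) (tt f (h :: 'i list \<times> 'g \<Rightarrow>\<^sub>0 'k)) = scale (F_counit f) h"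
  for f :: "'i list \<times> 'g \<Rightarrow>\<^sub>0 'k"
proof (rule plin_eq[where S = "\<lambda>f. lin (\<lambda>(b, c). single c (F_counit (single b 1))) (tt f h)" and T = "\<lambda>f. scale (F_counit f) h"])
  show "plin (\<lambda>f. lin (\<lambda>(b, c). single c (F_counit (single b 1))) (tt f h))"
    by (rule plin_compose[OF lin_plin tt_left])
  show "plin (\<lambda>f :: 'i list \<times> 'g \<Rightarrow>\<^sub>0 'k. scale (F_counit f) h)"
    by (rule plinI) (simp_all only: counit_add counit_scale pm.scale_left_distrib pm.scale_scale)
  fix b
  show "lin (\<lambda>(b, c). single c (F_counit (single b (1::'k)))) (tt (single b 1) h) = scale (F_counit (single b 1)) h"
    by (rule plin_eq[OF plin_compose[OF lin_plin tt_right] plin_const_scale[OF plin_id]]) simp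
qed

lemma counit_tt2: "lin (\<lambda>(b, c). single b (F_counit (single c (1::'k)))) (tt f (h :: 'i list \<times> 'g \<Rightarrow>\<^sub>0 'k)) = scale (F_counit h) f"
  for f :: "'i list \<times> 'g \<Rightarrow>\<^sub>0 'k"
proof (rule plin_eq[where S = "\<lambda>f. lin (\<lambda>(b, c). single b (F_counit (single c 1))) (tt f h)" and T = "\<lambda>f. scale (F_counit h) f"])
  show "plin (\<lambda>f. lin (\<lambda>(b, c). single b (F_counit (single c 1))) (tt f h))"
    by (rule plin_compose[OF lin_plin tt_left])
  show "plin (scale (F_counit h))" by (rule plin_const_scale[OF plin_id])
  fix b
  show "lin (\<lambda>(b, c). single b (F_counit (single c (1::'k)))) (tt (single b 1) h) = scale (F_counit h) (single b 1)"
  proof (rule plin_eq[OF plin_compose[OF lin_plin tt_right]])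
    show "plin (\<lambda>h :: 'i list \<times> 'g \<Rightarrow>\<^sub>0 'k. scale (F_counit h) (single b 1))"
      by (rule plinI) (simp_all only: counit_add counit_scale pm.scale_left_distrib pm.scale_scale)
  qed simp
qed

lemma coaction_counit: "tensor_lift AA (\<lambda>(a, b). H0_counit a \<odot>\<^bsub>AA\<^esub> b) (rho (pA f)) = pA f"
proof -
  have "tensor_lift AA (\<lambda>(a, b). H0_counit a \<odot>\<^bsub>AA\<^esub> b) (PP y) = pA (lin (\<lambda>(b, c). single c (F_counit (single b 1))) y)" for y
    by (rule PP_lift_rep[OF QA.quot_kmodule plin_pA[OF lin_plin]]) (simp only: prod.case counit_tt1 H0_counit_pH pA_simps)
  then show ?thesis by (simp only: rho_pA DD_def counit_left)
qed

lemma coproduct_counit: "tensor_lift HH (\<lambda>(a, b). H0_counit b \<odot>\<^bsub>HH\<^esub> a) (dH (pH f)) = pH f"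
proof -
  have "tensor_lift HH (\<lambda>(a, b). H0_counit b \<odot>\<^bsub>HH\<^esub> a) (PH y) = pH (lin (\<lambda>(b, c). single b (F_counit (single c 1))) y)" for y
    by (rule PH_lift_rep[OF QH.quot_kmodule plin_pH[OF lin_plin]]) (simp only: prod.case counit_tt2 H0_counit_pH pH_simps)
  then show ?thesis by (simp only: dH_pH counit_right)
qed

lemma comodule: "comodule_algebra HH dH H0_counit AA rho"
  unfolding comodule_algebra_def
proof (intro conjI ballI)
  fix x assume "x \<in> carrier AA"
  then obtain f where x: "x = pA f" by (rule AA_cases)
  show "tensor_lift TTT (\<lambda>(a, b). tensor_lift TTT (\<lambda>(a', a''). pt3 a' (pt a'' b)) (dH a)) (rho x)
    = tensor_lift TTT (\<lambda>(a, b). pt3 a (rho b)) (rho x)"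
    unfolding x by (rule coaction_coassoc)
  show "tensor_lift AA (\<lambda>(a, b). H0_counit a \<odot>\<^bsub>AA\<^esub> b) (rho x) = x"
    unfolding x by (rule coaction_counit)
qed (fact AA.kalg rho_hom)+

section \<open>The section\<close>

lemma S_idl:
  assumes "\<And>z. z \<in> G \<Longrightarrow> S (\<iota> z) \<in> I_R" "x \<in> idl (\<iota> ` G)"
  shows "S x \<in> I_R"
  using assms(2) unfolding idl_def
proof (rule plin_span[OF S_plin])
  fix y assume "y \<in> {mn u a \<star> r \<star> mn v b |u a v b r. r \<in> \<iota> ` G}"
  then obtain u a z v b where y: "y = mn u a \<star> \<iota> z \<star> mn v b" and z: "z \<in> G" by blast
  show "S y \<in> I_R" unfolding y S_mult
    using assms(1)[OF z] unfolding I_R_def by (intro idl_left idl_right)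
qed (simp add: I_R_def idl_subspace)

text \<open>Apply \<open>M2\<close> to the skew primitivity of \<open>z\<close>. The coproduct
  contributes \<open>\<epsilon>(z) = 0\<close>, so \<open>- S z - S(g\<^sub>w) z\<close> equals the
  image of the error term. This lies in \<open>I_R\<close>: a left tensor factor from the previous
  stage is handled by induction, a right one directly. As \<open>z\<close> lies in
  \<open>I_R\<close>, so does \<open>S z\<close>.\<close>

lemma S_chain: "h \<le> L \<Longrightarrow> z \<in> Rc h \<Longrightarrow> S (\<iota> z) \<in> I_R"
proof (induction h arbitrary: z)
  case 0
  then show ?case by (simp add: chain_0)
next
  case (Suc h)
  have sub: "Rc h \<subseteq> R" and zR: "z \<in> R" using chain_R[of h] chain_R[of "Suc h"] Suc.prems by auto
  obtain w where w: "anagram w z" and lz: "long z" using R_anagram[OF zR] by blast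
  have IR: "pm.subspace I_R" unfolding I_R_def by (rule idl_subspace)
  have z_in: "\<iota> z \<in> I_R" unfolding I_R_def by (rule idl_base) (use zR in simp)
  have "M2 (Delta (\<iota> z) - tt (\<iota> z) (mn [] 0) - tt (mn [] (word_degree g w)) (\<iota> z)) \<in> I_R"
    using R_primitive[OF Suc.prems w] unfolding W2_def
  proof (rule plin_span[OF M2_plin _ _ IR])
    fix s assume "s \<in> {tt f f' |f f'. f \<in> idl (\<iota> ` Rc h) \<or> f' \<in> idl (\<iota> ` Rc h)}"
    then obtain f f' where s: "s = tt f f'" and f: "f \<in> idl (\<iota> ` Rc h) \<or> f' \<in> idl (\<iota> ` Rc h)" by blast
    from f show "M2 s \<in> I_R"
    proof
      assume f: "f \<in> idl (\<iota> ` Rc h)"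
      have "S f \<in> I_R"
        by (rule S_idl[OF Suc.IH f]) (use Suc.prems(1) in simp)
      then show ?thesis unfolding s M2_tt I_R_def by (rule idl_right)
    next
      assume "f' \<in> idl (\<iota> ` Rc h)"
      then have "f' \<in> idl (\<iota> ` R)" by (rule subsetD[OF idl_mono[OF image_mono[OF sub]]])
      then show ?thesis unfolding s M2_tt I_R_def by (rule idl_left)
    qed
  qed
  moreover have "ee (\<iota> z) = 0"
  proof -
    have k: "keys z \<subseteq> {v. 2 \<le> length v}" using lz by (simp add: long_def)
    show ?thesis by (rule plin_eqI[OF plin_compose[OF ee_plin \<iota>_plin] plin_null _ k]) auto
  qed
  ultimately have "- S (\<iota> z) - S (mn [] (word_degree g w)) \<star> \<iota> z \<in> I_R"
    unfolding plin_diff[OF M2_plin] M2_tt antipode_left star_one by simp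
  moreover have "S (mn [] (word_degree g w)) \<star> \<iota> z \<in> I_R"
    using z_in unfolding I_R_def by (rule idl_left)
  ultimately have "- S (\<iota> z) - S (mn [] (word_degree g w)) \<star> \<iota> z + S (mn [] (word_degree g w)) \<star> \<iota> z \<in> I_R"
    by (rule pm.subspace_add[OF IR])
  then have "- S (\<iota> z) \<in> I_R" by simp
  from pm.subspace_neg[OF IR this] show ?case by simp
qed

lemma S_I_R: "x \<in> I_R \<Longrightarrow> S x \<in> I_R"
  by (rule S_idl[of R]) (use S_chain[of L] chain_L in \<open>auto simp: I_R_def\<close>)

text \<open>A linear map on normal words descends to \<open>H\<^sup>0\<close> as soon as it respects the ideal generated by \<open>\<R>\<close> alone,
  because normal words meet the defining ideal of \<open>H\<^sup>0\<close> inside that ideal.\<close>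

definition ext where "ext T = induced (\<lambda>f. pA (T (Z.nf f)))"

text \<open>\<open>Z.nf\<close> changes \<open>n\<close> only by an element of the ideal of
  \<open>H^0\<close>, and normal elements of that ideal lie in \<open>K\<close>.\<close>

lemma Znf_I_R: 
  assumes "n \<in> H0_ideal \<chi> g blk R" shows "Z.nf n \<in> I_R"
proof -
  have Zs: "pm.subspace Z.I_lam" unfolding Z.I_lam_def by (rule idl_subspace)
  have "n \<in> Z.I_lam" "n - Z.nf n \<in> Z.I_lam" using assms Z.I'_I_lam Z.nf_cong by (auto simp: H0_ideal_eq)
  then have "n - (n - Z.nf n) \<in> Z.I_lam" by (rule pm.subspace_diff[OF Zs])
  then have "Z.nf n \<in> Z.I_lam" by simp
  then show ?thesis using Z.I_lam_NN[OF _ Z.nf_NN] Z.K_I_R by blast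
qed

lemma
  assumes "plin T" "\<And>x. x \<in> I_R \<Longrightarrow> T x \<in> I_R"
  shows ext_lm: "ext T \<in> linear_maps HH AA" and ext_pH: "f \<in> NN UNIV \<Longrightarrow> ext T (pH f) = pA (T f)"
proof -
  have lm: "(\<lambda>f. pA (T (Z.nf f))) \<in> linear_maps (F_alg \<chi>) AA"
    using plin_pA[OF plin_compose[OF assms(1) Z.nf_plin], of UNIV mF tF "([], 0)"] by (simp only: F_alg_def)
  have z: "pA (T (Z.nf n)) = \<zero>\<^bsub>AA\<^esub>" if "n \<in> H0_ideal \<chi> g blk R" for n
    unfolding pA_zero using I_R_I_lam assms(2)[OF Znf_I_R[OF that]] by blast
  show "ext T \<in> linear_maps HH AA"
    unfolding ext_def by (rule QH.induced_lm[OF lm QA.quot_kmodule z])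
  show "f \<in> NN UNIV \<Longrightarrow> ext T (pH f) = pA (T f)"
    unfolding ext_def by (subst QH.induced_eq[OF lm QA.quot_kmodule z]) (simp_all add: Z.nf_id)
qed

lemma HH_normal:
  assumes "x \<in> carrier HH" obtains n where "n \<in> NN UNIV" "x = pH n"
proof -
  obtain f where f: "x = pH f" using assms by (rule HH_cases)
  have "pH f = pH (Z.nf f)" unfolding pH_eq using Z.nf_cong Z.I'_I_lam by blast
  with f Z.nf_NN that show ?thesis by blast
qed

text \<open>Left multiplication by \<open>dx i\<close> puts \<open>i\<close> in front of one of the
  two factors; for a sorted word \<open>i # w\<close> the block of \<open>i\<close> is minimal among
  all the letters, so both factors stay sorted.\<close>

lemma Delta_NN:
  assumes "n \<in> NN UNIV" shows "keys (Delta n) \<subseteq> nrm UNIV \<times> nrm UNIV"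
proof -
  have *: "keys (cw w a) \<subseteq> nrm (set w) \<times> nrm (set w)" if "sorted (map blk w)" for w a
    using that
  proof (induction w)
    case (Cons i w)
    then have k: "keys (cw w a) \<subseteq> nrm (set w) \<times> nrm (set w)" by simp
    have "dx i \<bullet> cw w a \<in> {f. keys f \<subseteq> nrm (set (i # w)) \<times> nrm (set (i # w))}"
    proof (rule plin_in[OF tmul_right keys_subspace k])
      fix b assume "b \<in> nrm (set w) \<times> nrm (set w)"
      then obtain u a v c where b: "b = ((u, a), (v, c))" "sorted (map blk u)" "sorted (map blk v)" "set u \<subseteq> set w" "set v \<subseteq> set w"
        by (auto simp: nrm_def)
      have "dx i \<bullet> single b 1 = single ((i # u, a), (v, c)) 1 + single ((u, g i + a), (i # v, c)) (word_char \<chi> u (g i))"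
        by (simp add: b(1) plin_add[OF tmul_left])
      moreover have "single ((i # u, a), (v, c)) 1 \<in> {f. keys f \<subseteq> nrm (set (i # w)) \<times> nrm (set (i # w))}"
        "single ((u, g i + a), (i # v, c)) (word_char \<chi> u (g i)) \<in> {f. keys f \<subseteq> nrm (set (i # w)) \<times> nrm (set (i # w))}"
        using b Cons.prems by (auto simp: nrm_def)
      ultimately show "dx i \<bullet> single b 1 \<in> {f. keys f \<subseteq> nrm (set (i # w)) \<times> nrm (set (i # w))}"
        using pm.subspace_add[OF keys_subspace] by metis
    qed
    then show ?case by simp
  qed (auto simp: nrm_def)
  have n: "keys n \<subseteq> nrm UNIV" using assms by simp
  have "Delta n \<in> {f. keys f \<subseteq> nrm UNIV \<times> nrm UNIV}"
  proof (rule plin_in[OF Delta_plin keys_subspace n])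
    fix b assume "b \<in> nrm UNIV"
    then obtain w a where b: "b = (w, a)" "sorted (map blk w)" by (auto simp: nrm_def)
    then show "Delta (single b 1) \<in> {f. keys f \<subseteq> nrm UNIV \<times> nrm UNIV}"
      using *[OF b(2), of a] by (auto simp: nrm_def)
  qed
  then show ?thesis by simp
qed

context
  fixes \<phi>
  assumes phi_lm: "\<phi> \<in> linear_maps HH AA" and phi_pH: "\<And>n. n \<in> NN UNIV \<Longrightarrow> \<phi> (pH n) = pA n"
begin

lemma phi_colinear:
  assumes n: "n \<in> NN UNIV"
  shows "rho (\<phi> (pH n)) = tensor_lift TT (\<lambda>(a, b). pt a (\<phi> b)) (dH (pH n))"
proof -
  have "tensor_lift TT (\<lambda>(a, b). pt a (\<phi> b)) (PH (Delta n)) = PP (Delta n)"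
  proof (rule PH_lift[OF HA.tensor_kmodule _ PP_lm _ Delta_NN[OF n]])
    show "H2.bilin TT (\<lambda>(a, b). pt a (\<phi> b))"
      unfolding H2.bilin_def
      by (intro conjI ballI; simp; intro HA.pt_lm_left lm_compose[OF phi_lm HA.pt_lm_right] lm_closed[OF phi_lm])
  qed (auto simp: PP_single phi_pH)
  then show ?thesis by (simp only: dH_pH phi_pH[OF n] rho_pA DD_def)
qed

text \<open>Stated for any linear \<open>\<phi>\<close> that fixes normal representatives. It is
  applied to \<open>phi_map\<close> and, at \<open>\<lambda> = 0\<close>, to the identity of
  \<open>H^0\<close>, where the convolution inverse is the antipode.\<close>

lemma phi_section: "is_section HH dH H0_counit AA rho \<phi>"
proof -
  have psi_lm: "ext S \<in> linear_maps HH AA" by (rule ext_lm[OF S_plin]) (rule S_I_R)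
  have psi_pH: "ext S (pH n) = pA (S n)" if "n \<in> NN UNIV" for n
    by (rule ext_pH[OF S_plin _ that]) (rule S_I_R)
  have bil: "H2.bilin AA (\<lambda>(a, b). \<alpha> a \<otimes>\<^bsub>AA\<^esub> \<gamma> b)" if "\<alpha> \<in> linear_maps HH AA" "\<gamma> \<in> linear_maps HH AA" for \<alpha> \<gamma>
    unfolding H2.bilin_def
    by (intro conjI ballI linear_mapsI;
        simp add: lm_closed[OF that(1)] lm_closed[OF that(2)] lm_add[OF that(1)] lm_add[OF that(2)]
          lm_smul[OF that(1)] lm_smul[OF that(2)] AA.l_distr AA.r_distr AA.smul_mult_left AA.smul_mult_right)
  have ee: "pA (ee n) = H0_counit (pH n) \<odot>\<^bsub>AA\<^esub> \<one>\<^bsub>AA\<^esub>" for n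
    by (simp only: ee_counit H0_counit_pH pA_simps)
  have conv: "convolution dH AA \<phi> (ext S) (pH n) = pA (ee n) \<and> convolution dH AA (ext S) \<phi> (pH n) = pA (ee n)"
    if n: "n \<in> NN UNIV" for n
  proof
    have "tensor_lift AA (\<lambda>(a, b). \<phi> a \<otimes>\<^bsub>AA\<^esub> ext S b) (PH (Delta n)) = pA (M1 (Delta n))"
      by (rule PH_lift[OF QA.quot_kmodule bil[OF phi_lm psi_lm] plin_pA[OF M1_plin] _ Delta_NN[OF n]])
        (auto simp: M1_def phi_pH psi_pH pA_simps)
    then show "convolution dH AA \<phi> (ext S) (pH n) = pA (ee n)"
      by (simp only: convolution_def dH_pH antipode_right)
    have "tensor_lift AA (\<lambda>(a, b). ext S a \<otimes>\<^bsub>AA\<^esub> \<phi> b) (PH (Delta n)) = pA (M2 (Delta n))"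
      by (rule PH_lift[OF QA.quot_kmodule bil[OF psi_lm phi_lm] plin_pA[OF M2_plin] _ Delta_NN[OF n]])
        (auto simp: M2_def phi_pH psi_pH pA_simps)
    then show "convolution dH AA (ext S) \<phi> (pH n) = pA (ee n)"
      by (simp only: convolution_def dH_pH antipode_left)
  qed
  show ?thesis
    unfolding is_section_def convolution_invertible_def
  proof (intro conjI bexI[of _ "ext S"] ballI)
    fix h assume "h \<in> carrier HH"
    then obtain n where n: "n \<in> NN UNIV" "h = pH n" by (rule HH_normal)
    show "convolution dH AA \<phi> (ext S) h = H0_counit h \<odot>\<^bsub>AA\<^esub> \<one>\<^bsub>AA\<^esub>"
      "convolution dH AA (ext S) \<phi> h = H0_counit h \<odot>\<^bsub>AA\<^esub> \<one>\<^bsub>AA\<^esub>"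
      using conv[OF n(1)] by (simp_all only: n(2) ee)
    show "rho (\<phi> h) = tensor_lift TT (\<lambda>(a, b). pt a (\<phi> b)) (dH h)"
      unfolding n(2) by (rule phi_colinear[OF n(1)])
  next
    show "\<phi> \<one>\<^bsub>HH\<^esub> = \<one>\<^bsub>AA\<^esub>" unfolding pA_simps pH_simps by (rule phi_pH) (simp add: nrm_def)
  qed (fact phi_lm psi_lm)+
qed

text \<open>For a coinvariant \<open>x = \<phi> h\<close>, colinearity gives \<open>\<Delta> h = 1 \<otimes> h\<close>, whence \<open>h = \<epsilon>(h) 1\<close>.\<close>

lemma coinvariants:
  assumes bij: "bij_betw \<phi> (carrier HH) (carrier AA)"
  shows "bij_betw (\<lambda>c. c \<odot>\<^bsub>AA\<^esub> \<one>\<^bsub>AA\<^esub>) UNIV {a \<in> carrier AA. rho a = pt \<one>\<^bsub>HH\<^esub> a}"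
proof -
  have one: "\<phi> \<one>\<^bsub>HH\<^esub> = \<one>\<^bsub>AA\<^esub>" unfolding pA_simps pH_simps by (rule phi_pH) (simp add: nrm_def)
  have phi_c: "\<phi> (c \<odot>\<^bsub>HH\<^esub> \<one>\<^bsub>HH\<^esub>) = c \<odot>\<^bsub>AA\<^esub> \<one>\<^bsub>AA\<^esub>" for c
    by (simp add: lm_smul[OF phi_lm] one)
  have cnt: "H0_counit (c \<odot>\<^bsub>HH\<^esub> \<one>\<^bsub>HH\<^esub>) = c" for c
    unfolding pH_simps H0_counit_pH counit_scale counit_mn by simp
  \<comment> \<open>\<open>k\<close> embeds into \<open>A(\<lambda>)\<close> because it embeds into
    \<open>H^0\<close>, where the counit recovers the scalar, and \<open>\<phi>\<close> is
    injective.\<close>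
  have inj: "c = d" if "c \<odot>\<^bsub>AA\<^esub> \<one>\<^bsub>AA\<^esub> = d \<odot>\<^bsub>AA\<^esub> \<one>\<^bsub>AA\<^esub>" for c d
  proof -
    from that have "\<phi> (c \<odot>\<^bsub>HH\<^esub> \<one>\<^bsub>HH\<^esub>) = \<phi> (d \<odot>\<^bsub>HH\<^esub> \<one>\<^bsub>HH\<^esub>)" by (simp only: phi_c)
    then have "c \<odot>\<^bsub>HH\<^esub> \<one>\<^bsub>HH\<^esub> = d \<odot>\<^bsub>HH\<^esub> \<one>\<^bsub>HH\<^esub>"
      by (rule inj_onD[OF bij_betw_imp_inj_on[OF bij]]) simp_all
    then show "c = d" using cnt by metis
  qed
  have s1: "rho (c \<odot>\<^bsub>AA\<^esub> \<one>\<^bsub>AA\<^esub>) = pt \<one>\<^bsub>HH\<^esub> (c \<odot>\<^bsub>AA\<^esub> \<one>\<^bsub>AA\<^esub>)" for c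
  proof -
    have "rho (c \<odot>\<^bsub>AA\<^esub> \<one>\<^bsub>AA\<^esub>) = c \<odot>\<^bsub>TT\<^esub> pt \<one>\<^bsub>HH\<^esub> \<one>\<^bsub>AA\<^esub>"
      by (simp add: ah_smul[OF rho_hom] ah_one[OF rho_hom] HA.pt_one)
    then show ?thesis by (simp add: HA.pt_smul_right)
  qed
  have s2: "\<exists>c. a = c \<odot>\<^bsub>AA\<^esub> \<one>\<^bsub>AA\<^esub>" if a: "a \<in> carrier AA" "rho a = pt \<one>\<^bsub>HH\<^esub> a" for a
  proof -
    obtain h where h: "h \<in> carrier HH" "a = \<phi> h" using a bij unfolding bij_betw_def by blast
    then obtain n where n: "n \<in> NN UNIV" "h = pH n" by (auto elim: HH_normal)
    define \<theta> where "\<theta> = inv_into (carrier HH) \<phi>"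
    have th: "\<theta> (\<phi> x) = x" if "x \<in> carrier HH" for x
      unfolding \<theta>_def using bij that by (simp add: bij_betw_def)
    have th_lm: "\<theta> \<in> linear_maps AA HH"
      unfolding \<theta>_def by (rule lm_inv[OF phi_lm bij HH.kmodule_axioms])
    \<comment> \<open>Both sides of \<open>rho a = 1 \<otimes> a\<close> are evaluated by applying
      \<open>\<epsilon> \<circ> \<theta>\<close> to the right factor. The left side gives
      \<open>h\<close> by the counit law, since \<open>\<theta>\<close> undoes \<open>\<phi>\<close>
      on normal words; the right side gives \<open>\<epsilon>(h) 1\<close>.\<close>
    let ?B = "\<lambda>(a, b). H0_counit (\<theta> b) \<odot>\<^bsub>HH\<^esub> a"
    have e_add: "H0_counit (x \<oplus>\<^bsub>HH\<^esub> y) = H0_counit x + H0_counit y" "H0_counit (c \<odot>\<^bsub>HH\<^esub> x) = c * H0_counit x"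
      if "x \<in> carrier HH" "y \<in> carrier HH" for x y c
      using that by (auto elim!: HH_cases simp: pH_simps H0_counit_pH counit_add counit_scale)
    have bil: "HA.bilin HH ?B"
      unfolding HA.bilin_def
      by (intro conjI ballI linear_mapsI;
          simp add: e_add lm_closed[OF th_lm] lm_add[OF th_lm] lm_smul[OF th_lm] HH.smul_rdistr HH.smul_ldistr mult.commute
           flip: HH.smul_assoc)
    have "tensor_lift HH ?B (PP y) = pH (lin (\<lambda>(b, c). single b (F_counit (single c 1))) y)"
      if "keys y \<subseteq> nrm UNIV \<times> nrm UNIV" for y
    proof (rule PP_lift[OF QH.quot_kmodule bil plin_pH[OF lin_plin] _ that])
      fix b c assume bc: "(b, c) \<in> nrm UNIV \<times> nrm UNIV"
      then have "\<theta> (pA (single c 1)) = pH (single c 1)"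
        using th[of "pH (single c 1)"] by (simp add: phi_pH)
      then show "pH (lin (\<lambda>(b, c). single b (F_counit (single c 1))) (single (b, c) 1)) =
        ?B (pH (single b 1), pA (single c 1))"
        by (simp add: H0_counit_pH pH_simps)
    qed
    from this[OF Delta_NN[OF n(1)]] have "tensor_lift HH ?B (rho a) = h"
      unfolding h(2) n(2) phi_pH[OF n(1)] rho_pA DD_def counit_right .
    moreover have "tensor_lift HH ?B (rho a) = H0_counit h \<odot>\<^bsub>HH\<^esub> \<one>\<^bsub>HH\<^esub>"
    proof -
      have "tensor_lift HH ?B (rho a) = H0_counit (\<theta> a) \<odot>\<^bsub>HH\<^esub> \<one>\<^bsub>HH\<^esub>"
        unfolding a(2) using HA.tensor_lift_pure[OF QH.quot_kmodule bil HH.one_closed a(1)] by simp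
      then show ?thesis by (simp only: h(2) th[OF h(1)])
    qed
    ultimately have "a = H0_counit h \<odot>\<^bsub>AA\<^esub> \<one>\<^bsub>AA\<^esub>" using h(2) phi_c by metis
    then show ?thesis by blast
  qed
  show ?thesis
  proof (rule bij_betw_imageI)
    show "inj_on (\<lambda>c. c \<odot>\<^bsub>AA\<^esub> \<one>\<^bsub>AA\<^esub>) UNIV" by (rule inj_onI) (rule inj)
    show "(\<lambda>c. c \<odot>\<^bsub>AA\<^esub> \<one>\<^bsub>AA\<^esub>) ` UNIV = {a \<in> carrier AA. rho a = pt \<one>\<^bsub>HH\<^esub> a}"
      using s1 s2 AA.smul_closed[OF AA.one_closed] by blast
  qed
qed

end

end

section \<open>The map \<open>e(\<lambda>)\<close>\<close>

text \<open>As \<open>rs\<close> is distinct, the entry at \<open>j\<close> occurs exactly once in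
  the product, so the product is linear in it.\<close>

lemma fold_lm:
  assumes "kalgebra A" "distinct rs" "j \<in> set rs" "\<And>r. r \<in> set rs \<Longrightarrow> y r \<in> carrier (M r)"
    and c: "\<And>r. r \<in> set rs \<Longrightarrow> c r \<in> linear_maps (M r) A"
  shows "(\<lambda>a. foldr (\<lambda>r s. c r ((y(j := a)) r) \<otimes>\<^bsub>A\<^esub> s) rs \<one>\<^bsub>A\<^esub>) \<in> linear_maps (M j) A"
proof -
  interpret A: kalgebra A by fact
  have const: "foldr (\<lambda>r s. c r ((y(j := a)) r) \<otimes>\<^bsub>A\<^esub> s) rs' \<one>\<^bsub>A\<^esub> = foldr (\<lambda>r s. c r (y r) \<otimes>\<^bsub>A\<^esub> s) rs' \<one>\<^bsub>A\<^esub>"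
    if "j \<notin> set rs'" for rs' a
    using that by (induction rs') auto
  have cl: "foldr (\<lambda>r s. c r (y r) \<otimes>\<^bsub>A\<^esub> s) rs' \<one>\<^bsub>A\<^esub> \<in> carrier A" if "set rs' \<subseteq> set rs" for rs'
    using that by (induction rs') (auto intro: lm_closed[OF c] assms)
  have "(\<lambda>a. foldr (\<lambda>r s. c r ((y(j := a)) r) \<otimes>\<^bsub>A\<^esub> s) rs' \<one>\<^bsub>A\<^esub>) \<in> linear_maps (M j) A"
    if "set rs' \<subseteq> set rs" "distinct rs'" "j \<in> set rs'" for rs'
    using that
  proof (induction rs')
    case (Cons r rs')
    show ?case
    proof (cases "r = j")
      case True
      then have j: "j \<notin> set rs'" using Cons.prems by auto
      have x: "foldr (\<lambda>r s. c r (y r) \<otimes>\<^bsub>A\<^esub> s) rs' \<one>\<^bsub>A\<^esub> \<in> carrier A" using cl Cons.prems by auto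
      have cj: "c j \<in> linear_maps (M j) A" using c assms(3) by blast
      show ?thesis
        unfolding foldr.simps comp_apply const[OF j] True fun_upd_same
        by (rule linear_mapsI)
          (simp_all add: lm_closed[OF cj] lm_add[OF cj] lm_smul[OF cj] x A.l_distr A.smul_mult_left)
    next
      case False
      have IH: "(\<lambda>a. foldr (\<lambda>r s. c r ((y(j := a)) r) \<otimes>\<^bsub>A\<^esub> s) rs' \<one>\<^bsub>A\<^esub>) \<in> linear_maps (M j) A"
        using Cons False by auto
      have x: "c r (y r) \<in> carrier A" using Cons.prems assms(4) lm_closed[OF c] by auto
      have f: "(y(j := a)) r = y r" for a using False by simp
      show ?thesis
        unfolding foldr.simps comp_apply f
        by (rule linear_mapsI) (simp_all only: lm_closed[OF IH] lm_add[OF IH] lm_smul[OF IH] x A.r_distr A.smul_mult_right A.m_closed)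
    qed
  qed simp
  from this[of rs] show ?thesis using assms(2,3) by simp
qed

lemma fold_closed:
  assumes "kalgebra A" "\<And>r. r \<in> set rs \<Longrightarrow> c r \<in> carrier A"
  shows "foldr (\<lambda>r s. c r \<otimes>\<^bsub>A\<^esub> s) rs \<one>\<^bsub>A\<^esub> \<in> carrier A"
proof -
  interpret A: kalgebra A by fact
  show ?thesis using assms(2) by (induction rs) auto
qed

text \<open>With \<open>m = 1\<close> and \<open>n = Suc N\<close> this recovers a normal word from
  its block components, which is why multiplication inverts the splitting in
  \<open>yw\<close>.\<close>

lemma concat_filter_sorted:
  assumes "sorted (map f w)" "\<forall>i\<in>set w. f i < n"
  shows "concat (map (\<lambda>r. filter (\<lambda>i. f i = r) w) [m..<n]) = filter (\<lambda>i. m \<le> f i) w"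
  using assms(1,2)
proof (induction "n - m" arbitrary: m)
  case 0
  then show ?case by (auto simp: empty_filter_conv)
next
  case (Suc d)
  then have m: "m < n" by simp
  have "filter (\<lambda>i. f i = m) w @ filter (\<lambda>i. Suc m \<le> f i) w = filter (\<lambda>i. m \<le> f i) w"
    using assms(1)
  proof (induction w)
    case (Cons i w)
    show ?case
    proof (cases "f i \<le> m")
      case False
      then have "filter (\<lambda>i. f i = m) w = []" using Cons.prems by (auto simp: filter_empty_conv)
      then show ?thesis using Cons False by auto
    qed (use Cons in auto)
  qed simp
  then show ?case using Suc.hyps(1)[of "Suc m"] Suc.prems Suc.hyps(2) m by (simp add: upt_conv_Cons)
qed

context lifting_datum
begin

declare One_nat_def [simp del]

abbreviation "Tr r \<equiv> tensor_algebra {i. blk i = r} :: ('k, 'i list \<Rightarrow>\<^sub>0 'k) module"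
abbreviation "Jr r \<equiv> genideal (Tr r) (block_relations \<chi> g blk R r)"
abbreviation "Br r \<equiv> block_algebra \<chi> g blk R r"
abbreviation "GA \<equiv> group_algebra :: ('k, 'g \<Rightarrow>\<^sub>0 'k) module"

lemma Tr_simps [simp]: "carrier (Tr r) = {f. keys f \<subseteq> lists {i. blk i = r}}"
  "monoid.mult (Tr r) = tv" "ring.add (Tr r) = (+)" "ring.zero (Tr r) = 0" "monoid.one (Tr r) = wd []" "module.smult (Tr r) = scale"
  by (simp_all add: tensor_algebra_def monoid_algebra_def)

lemma block_relation_keys:
  assumes "z \<in> block_relations \<chi> g blk R r" shows "keys z \<subseteq> lists {i. blk i = r}"
proof -
  obtain w where w: "anagram w z" "\<forall>i\<in>set w. blk i = r"
    using assms braided_element_anagram unfolding block_relations_def by blast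
  show ?thesis
  proof
    fix v assume "v \<in> keys z"
    then have "set v = set w" using w(1) mset_eq_setD by (auto simp: anagram_def)
    then show "v \<in> lists {i. blk i = r}" using w(2) by auto
  qed
qed

lemma Jr_ideal: "ideal (Jr r) (Tr r)"
proof -
  interpret T: kalgebra "Tr r" by (rule tensor_algebra_kalgebra)
  show ?thesis using block_relation_keys by (intro T.genideal_ideal) auto
qed

lemma Br_quot: "Br r = quotient (Tr r) (Jr r)"
  by (simp add: block_algebra_def Let_def)

lemma Br_locale: "kquot_alg (Tr r) (Jr r)"
  by (rule kquot_alg.intro[OF tensor_algebra_kalgebra kquot_alg_axioms.intro[OF Jr_ideal]])

abbreviation "pB r f \<equiv> Jr r +>\<^bsub>Tr r\<^esub> f"

lemma Br_kmodule: "kmodule (Br r)"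
proof -
  interpret B: kquot_alg "Tr r" "Jr r" by (rule Br_locale)
  show ?thesis unfolding Br_quot by (rule B.quot_kmodule)
qed

lemma pB_lm: "(\<lambda>f. pB r f) \<in> linear_maps (Tr r) (Br r)"
proof -
  interpret B: kquot_alg "Tr r" "Jr r" by (rule Br_locale)
  show ?thesis unfolding Br_quot by (rule B.proj_lm)
qed

lemma pB_zero: "x \<in> Jr r \<Longrightarrow> pB r x = \<zero>\<^bsub>Br r\<^esub>"
proof -
  interpret B: kquot_alg "Tr r" "Jr r" by (rule Br_locale)
  show "x \<in> Jr r \<Longrightarrow> pB r x = \<zero>\<^bsub>Br r\<^esub>" unfolding Br_quot by (simp add: B.a_rcos_const B.quot_zero)
qed

definition can where "can = induced (\<lambda>y. pA (TV_to_F \<chi> y))"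

lemma can_lm: "can \<in> linear_maps (Br r) AA"
  and can_pB: "keys f \<subseteq> lists {i. blk i = r} \<Longrightarrow> can (pB r f) = pA (\<iota> f)"
proof -
  interpret B: kquot_alg "Tr r" "Jr r" by (rule Br_locale)
  have hom: "(\<lambda>y. pA (\<iota> y)) \<in> algebra_hom (Tr r) AA"
  proof (rule ahI)
    show "(\<lambda>y. pA (\<iota> y)) \<in> linear_maps (Tr r) AA"
      unfolding tensor_algebra_def monoid_algebra_def by (rule plin_pA[OF \<iota>_plin])
  qed (simp_all add: iota_tv pA_simps)
  have K: "ideal {y \<in> carrier (Tr r). pA (\<iota> y) = \<zero>\<^bsub>AA\<^esub>} (Tr r)"
    by (rule ah_kernel_ideal[OF hom tensor_algebra_kalgebra QA.quot_kalgebra])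
  have "\<iota> z \<in> I_lam" if "z \<in> R" for z
    unfolding I_lam_def by (rule idl_base) (use that in blast)
  then have "z \<in> {y \<in> carrier (Tr r). pA (\<iota> y) = \<zero>\<^bsub>AA\<^esub>}" if "z \<in> block_relations \<chi> g blk R r" for z
    using block_relation_keys[OF that] that by (simp add: pA_zero block_relations_def)
  then have "Jr r \<subseteq> {y \<in> carrier (Tr r). pA (\<iota> y) = \<zero>\<^bsub>AA\<^esub>}"
    by (intro B.genideal_minimal[OF K] subsetI)
  then have z: "pA (\<iota> n) = \<zero>\<^bsub>AA\<^esub>" if "n \<in> Jr r" for n using that by blast
  show "can \<in> linear_maps (Br r) AA"
    unfolding can_def TV_to_F Br_quot by (rule B.induced_lm[OF ah_lm[OF hom] QA.quot_kmodule z])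
  show "keys f \<subseteq> lists {i. blk i = r} \<Longrightarrow> can (pB r f) = pA (\<iota> f)"
    unfolding can_def TV_to_F by (rule B.induced_eq[OF ah_lm[OF hom] QA.quot_kmodule z]) auto
qed

lemma GA_kmodule: "kmodule GA"
  by (simp add: group_algebra_def monoid_algebra_def)

lemma GA_simps [simp]: "carrier GA = UNIV" "ring.add GA = (+)" "module.smult GA = scale" "ring.zero GA = 0"
  by (simp_all add: group_algebra_def monoid_algebra_def)

sublocale MT: multimod "{1..N}" "block_algebra \<chi> g blk R"
  by (rule multimod.intro) (auto simp: Br_kmodule)

abbreviation "MM \<equiv> multi_tensor {1..N} (block_algebra \<chi> g blk R)"
abbreviation "mgen \<equiv> MT.T.gen"

sublocale EE: bimod MM GA
  by (intro bimod.intro MT.TM.kmodule_axioms GA_kmodule)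

abbreviation "E \<equiv> tensor MM GA"
abbreviation "ptE \<equiv> pure_tensor MM GA"

lemma E_mod_eq: "E_mod \<chi> g blk N R = E" by (simp add: E_mod_def)

definition mu where "mu y = foldr (\<lambda>r s. can (y r) \<otimes>\<^bsub>AA\<^esub> s) [1..<Suc N] \<one>\<^bsub>AA\<^esub>"

lemma mu_lm: "y \<in> MT.Bs \<Longrightarrow> j \<in> {1..N} \<Longrightarrow> (\<lambda>a. mu (y(j := a))) \<in> linear_maps (Br j) AA"
  unfolding mu_def by (rule fold_lm[OF QA.quot_kalgebra, of _ _ _ "block_algebra \<chi> g blk R"]) (auto simp: can_lm PiE_iff)

lemma mu_closed: "y \<in> MT.Bs \<Longrightarrow> mu y \<in> carrier AA"
  unfolding mu_def by (rule fold_closed[OF QA.quot_kalgebra]) (auto intro!: lm_closed[OF can_lm] simp: PiE_iff)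

lemma lift_mu_lm: "tensor_lift AA mu \<in> linear_maps MM AA"
  by (rule MT.multi_lift_lm[OF QA.quot_kmodule mu_lm mu_closed])

lemma lift_mu_gen: "y \<in> MT.Bs \<Longrightarrow> tensor_lift AA mu (mgen y) = mu y"
  by (rule MT.multi_lift_gen[OF QA.quot_kmodule mu_lm mu_closed])

definition ge where "ge = lin (\<lambda>a. mn [] a)"

lemma Gamma_to_F: "Gamma_to_F \<chi> = ge"
  by (simp add: Gamma_to_F_def ge_def F_alg_def)

lemma ge_lm: "(\<lambda>z. pA (ge z)) \<in> linear_maps GA AA"
  unfolding group_algebra_def monoid_algebra_def ge_def by (rule plin_pA[OF lin_plin])

definition "eB = (\<lambda>(t, z). tensor_lift AA mu t \<otimes>\<^bsub>AA\<^esub> pA (ge z))"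

lemma e_map_eq: "e_map \<chi> g blk N R lam = tensor_lift AA eB"
  unfolding e_map_def Let_def A_alg_eq Gamma_to_F eB_def mu_def can_def ..

lemma eB_bilin: "EE.bilin AA eB"
  unfolding EE.bilin_def eB_def
  by (intro conjI ballI linear_mapsI;
      simp add: lm_closed[OF lift_mu_lm] lm_add[OF lift_mu_lm] lm_smul[OF lift_mu_lm]
        lm_add[OF ge_lm, simplified] lm_smul[OF ge_lm, simplified] AA.l_distr AA.r_distr AA.smul_mult_left AA.smul_mult_right)

lemmas e_lm = EE.tensor_lift_lm[OF QA.quot_kmodule eB_bilin, folded e_map_eq]
  and e_pure = EE.tensor_lift_pure[OF QA.quot_kmodule eB_bilin, folded e_map_eq]

definition yw where "yw w = (\<lambda>r\<in>{1..N}. pB r (wd (filter (\<lambda>i. blk i = r) w)))"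

lemma pB_closed: "keys f \<subseteq> lists {i. blk i = r} \<Longrightarrow> pB r f \<in> carrier (Br r)"
  using lm_closed[OF pB_lm, of f r] by simp

lemma yw_Bs: "yw w \<in> MT.Bs"
  unfolding yw_def by (auto intro!: pB_closed)

lemma blk_bounds: "1 \<le> blk i" "blk i \<le> N"
  using blk_range by (metis atLeastAtMost_iff rangeI)+

text \<open>\<open>Nu\<close> sends a normal word to the tensor of its block components; it is inverse to \<open>e(\<lambda>)\<close> on \<open>NN / K\<close>.\<close>

definition nu where "nu = (\<lambda>(w, a). ptE (mgen (yw w)) (single a 1))"
definition Nu where "Nu = free_lift E nu"

lemma nu_closed: "nu b \<in> carrier E"
  unfolding nu_def by (cases b) (auto intro!: MT.gen_closed yw_Bs)

lemma Nu_lm: "Nu \<in> linear_maps (twisted_algebra B m t e) E"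
  unfolding Nu_def by (rule free_lift_lm[OF EE.tensor_kmodule nu_closed])

lemma Nu_mn: "Nu (mn w a) = ptE (mgen (yw w)) (single a 1)"
  unfolding Nu_def using nu_closed[of "(w, a)"] by (simp add: EE.tensor_kmodule nu_def)

lemma Nu_simps: "Nu (x + y) = Nu x \<oplus>\<^bsub>E\<^esub> Nu y" "Nu (scale c x) = c \<odot>\<^bsub>E\<^esub> Nu x" "Nu x \<in> carrier E"
  using lm_add[OF Nu_lm[of UNIV], where x = x and y = y] lm_smul[OF Nu_lm[of UNIV], where x = x and c = c]
    lm_closed[OF Nu_lm[of UNIV], where x = x] by simp_all

lemma mu_yw:
  assumes "sorted (map blk w)" shows "mu (yw w) = pA (mn w 0)"
proof -
  have *: "foldr (\<lambda>r s. can (yw w r) \<otimes>\<^bsub>AA\<^esub> s) rs \<one>\<^bsub>AA\<^esub> = pA (mn (concat (map (\<lambda>r. filter (\<lambda>i. blk i = r) w) rs)) 0)"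
    if "set rs \<subseteq> {1..N}" for rs
    using that
  proof (induction rs)
    case Nil
    show ?case by (simp add: pA_simps)
  next
    case (Cons r rs)
    have "can (yw w r) = pA (mn (filter (\<lambda>i. blk i = r) w) 0)"
    proof -
      have "filter (\<lambda>i. blk i = r) w \<in> lists {i. blk i = r}" by auto
      then show ?thesis
        using Cons.prems can_pB[of "wd (filter (\<lambda>i. blk i = r) w)" r] by (simp add: yw_def)
    qed
    then show ?case using Cons by (simp add: pA_simps)
  qed
  have "concat (map (\<lambda>r. filter (\<lambda>i. blk i = r) w) [1..<Suc N]) = filter (\<lambda>i. 1 \<le> blk i) w"
    by (rule concat_filter_sorted[OF assms]) (simp add: blk_bounds le_imp_less_Suc)
  also have "\<dots> = w" by (simp add: blk_bounds)
  finally have c: "concat (map (\<lambda>r. filter (\<lambda>i. blk i = r) w) [1..<Suc N]) = w" .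
  have "set [1..<Suc N] \<subseteq> {1..N}" by auto
  from *[OF this] show ?thesis unfolding mu_def c .
qed

lemma e_Nu:
  assumes "n \<in> NN UNIV" shows "e_map \<chi> g blk N R lam (Nu n) = pA n"
proof -
  have k: "keys n \<subseteq> nrm UNIV" using assms by simp
  show ?thesis
  proof (rule lm_eqI_keys[OF lm_compose[OF Nu_lm e_lm] plin_pA[OF plin_id] QA.quot_kmodule _ k])
    fix b assume "b \<in> nrm UNIV"
    then obtain w a where b: "b = (w, a)" "sorted (map blk w)" by (auto simp: nrm_def)
    have "e_map \<chi> g blk N R lam (Nu (mn w a)) = eB (mgen (yw w), single a 1)"
      unfolding Nu_mn by (rule e_pure) (auto intro!: MT.gen_closed yw_Bs)
    also have "\<dots> = pA (mn w a)"
      by (simp add: eB_def lift_mu_gen[OF yw_Bs] mu_yw[OF b(2)] ge_def pA_simps)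
    finally show "e_map \<chi> g blk N R lam (Nu (single b 1)) = pA (single b 1)" unfolding b(1) .
  qed
qed

text \<open>Splitting \<open>p z s\<close> by blocks puts the letters of \<open>z\<close> into slot
  \<open>r\<close> only, between the letters of \<open>p\<close> and of \<open>s\<close> in that
  block. The entry of that slot lies in the ideal \<open>Jr r\<close>, so the tensor
  vanishes.\<close>

lemma Nu_K0: "x \<in> K0 \<Longrightarrow> Nu x = \<zero>\<^bsub>E\<^esub>"
proof -
  assume "x \<in> K0"
  then obtain p z s a w r where x: "x = mn p 0 \<star> \<iota> z \<star> mn s a" and z: "z \<in> R" "in_block w r z"
    unfolding K0_def by blast
  show ?thesis
  proof (cases "z = 0")
    \<comment> \<open>For \<open>z = 0\<close> the block given by \<open>in_block\<close> need not
      be the one for which \<open>z\<close> is a braided element. For nonzero \<open>z\<close>, a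
      word in its support is nonempty, and any of its letters determines both blocks.\<close>
    case True
    then have "x = scale 0 x" unfolding x by (simp add: plin_zero[OF \<iota>_plin] star_lin)
    then have "Nu x = 0 \<odot>\<^bsub>E\<^esub> Nu x" using Nu_simps(2) by metis
    then show ?thesis using Nu_simps(3) by simp
  next
    case False
    then obtain v where v: "v \<in> keys z" by (metis keys_eq_empty all_not_in_conv)
    obtain r' where r': "braided_element \<chi> g blk r' z" using braided z(1) by blast
    obtain w' where w': "anagram w' z" "\<forall>i\<in>set w'. blk i = r'" "long z" using braided_element_anagram[OF r'] by blast
    have "mset v = mset w" "mset v = mset w'" "2 \<le> length v"
      using v z(2) w' by (auto simp: in_block_def anagram_def long_def)
    then have "set v = set w" "set v = set w'" "v \<noteq> []"
      using mset_eq_setD[of v w] mset_eq_setD[of v w'] by auto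
    then obtain i where "i \<in> set w" "i \<in> set w'" by (cases v) auto
    then have r: "r' = r" "blk i = r" using w'(2) z(2) by (auto simp: in_block_def)
    have rN: "r \<in> {1..N}" using r(2) blk_bounds by auto
    have zb: "z \<in> block_relations \<chi> g blk R r" using r' r z by (simp add: block_relations_def)
    have zk: "keys z \<subseteq> lists {i. blk i = r}" by (rule block_relation_keys[OF zb])
    let ?pr = "filter (\<lambda>i. blk i = r) p" and ?sr = "filter (\<lambda>i. blk i = r) s"
    let ?f = "\<lambda>z. tv (tv (wd ?pr) z) (wd ?sr)"
    interpret B: kquot_alg "Tr r" "Jr r" by (rule Br_locale)
    have "z \<in> Jr r" using B.genideal_self'[of z] B.genideal_self[of "block_relations \<chi> g blk R r"] zb block_relation_keys by auto
    moreover have "?pr \<in> lists {i. blk i = r}" "?sr \<in> lists {i. blk i = r}" by auto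
    ultimately have fz: "?f z \<in> Jr r"
      using ideal.I_l_closed[OF Jr_ideal, of z r "wd ?pr"] ideal.I_r_closed[OF Jr_ideal, of _ r "wd ?sr"] by simp
    have fk: "keys (?f y) \<subseteq> lists {i. blk i = r}" if "keys y \<subseteq> lists {i. blk i = r}" for y
      by (intro tmul_keys) (use that in auto)
    let ?Tz = "twisted_algebra (lists {i. blk i = r}) (@) (\<lambda>_ _. 1) [] :: ('k, 'i list \<Rightarrow>\<^sub>0 'k) module"
    have Tz: "Tr r = ?Tz" by (simp add: tensor_algebra_def monoid_algebra_def)
    have "Nu (mn p 0 \<star> \<iota> z \<star> mn s a) = ptE (mgen ((yw (p @ s))(r := pB r (?f z)))) (single a 1)"
    proof (rule lm_eqI_keys[where S = "\<lambda>z. Nu (mn p 0 \<star> \<iota> z \<star> mn s a)" and T = "\<lambda>z. ptE (mgen ((yw (p @ s))(r := pB r (?f z)))) (single a 1)",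
          OF _ _ EE.tensor_kmodule _ zk])
      show "(\<lambda>z. Nu (mn p 0 \<star> \<iota> z \<star> mn s a)) \<in> linear_maps ?Tz E"
        by (rule linear_mapsI)
          (simp_all add: Nu_simps star_lin plin_add[OF \<iota>_plin] plin_scale[OF \<iota>_plin])
      have "?f \<in> linear_maps ?Tz (Tr r)"
        by (rule linear_mapsI) (use fk in \<open>auto simp: plin_add[OF tmul_left] plin_add[OF tmul_right] plin_scale[OF tmul_left] plin_scale[OF tmul_right]\<close>)
      then show "(\<lambda>z. ptE (mgen ((yw (p @ s))(r := pB r (?f z)))) (single a 1)) \<in> linear_maps ?Tz E"
        by (rule lm_compose[OF lm_compose[OF lm_compose[OF _ pB_lm] MT.gen_lm[OF yw_Bs rN]] EE.pt_lm_left]) simp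
      fix v assume v: "v \<in> lists {i. blk i = r}"
      then have fv: "filter (\<lambda>i. blk i = r) v = v" by (auto simp: filter_id_conv)
      have fv': "filter (\<lambda>i. blk i = r') v = []" if "r' \<noteq> r" for r' using v that by (auto simp: filter_empty_conv)
      have "yw (p @ v @ s) = (yw (p @ s))(r := pB r (?f (wd v)))"
      proof
        fix r'
        show "yw (p @ v @ s) r' = ((yw (p @ s))(r := pB r (?f (wd v)))) r'"
          using rN fv fv' by (cases "r' = r") (auto simp: yw_def)
      qed
      moreover have "mn p 0 \<star> \<iota> (wd v) \<star> mn s a = mn (p @ v @ s) a" by simp
      ultimately show "Nu (mn p 0 \<star> \<iota> (wd v) \<star> mn s a) = ptE (mgen ((yw (p @ s))(r := pB r (?f (wd v))))) (single a 1)"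
        by (simp only: Nu_mn)
    qed
    also have "\<dots> = ptE (mgen ((yw (p @ s))(r := \<zero>\<^bsub>Br r\<^esub>))) (single a 1)"
      by (simp only: pB_zero[OF fz])
    also have "mgen ((yw (p @ s))(r := \<zero>\<^bsub>Br r\<^esub>)) = \<zero>\<^bsub>MM\<^esub>"
      by (rule lm_zero[OF MT.gen_lm[OF yw_Bs rN] Br_kmodule MT.TM.kmodule_axioms])
    finally show ?thesis unfolding x by (simp add: EE.pt_zero_left)
  qed
qed

lemma Nu_K: "x \<in> K \<Longrightarrow> Nu x = \<zero>\<^bsub>E\<^esub>"
proof -
  interpret F0: kmodule "twisted_algebra UNIV mF tF ([], 0) :: ('k, 'i list \<times> 'g \<Rightarrow>\<^sub>0 'k) module" by simp
  have V: "pm.subspace {x. Nu x = \<zero>\<^bsub>E\<^esub>}"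
    using lm_zero[OF Nu_lm F0.kmodule_axioms EE.tensor_kmodule]
    by (intro pm.subspaceI) (simp_all add: Nu_simps)
  have "K \<subseteq> {x. Nu x = \<zero>\<^bsub>E\<^esub>}"
    by (rule pm.span_minimal[OF _ V]) (use Nu_K0 in blast)
  then show "x \<in> K \<Longrightarrow> Nu x = \<zero>\<^bsub>E\<^esub>" by blast
qed

text \<open>\<open>E\<close> is spanned by tensors whose slots hold classes of words of the
  respective blocks, tensored with group elements, and each of these is the image of one normal
  monomial.\<close>

lemma Nu_surj: 
  assumes "x \<in> carrier E" shows "\<exists>n. n \<in> NN UNIV \<and> x = Nu n"
proof -
  define W where "W = Nu ` NN UNIV"
  have Wadd: "x \<oplus>\<^bsub>E\<^esub> y \<in> W" if xy: "x \<in> W" "y \<in> W" for x y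
  proof -
    obtain n m where n: "n \<in> NN UNIV" "x = Nu n" "m \<in> NN UNIV" "y = Nu m" using xy unfolding W_def by blast
    then have "n + m \<in> NN UNIV" by (intro pm.subspace_add[OF NN_subspace])
    then show ?thesis unfolding W_def n Nu_simps(1)[symmetric] by blast
  qed
  have Wsm: "c \<odot>\<^bsub>E\<^esub> x \<in> W" if xy: "x \<in> W" for x c
  proof -
    obtain n where n: "n \<in> NN UNIV" "x = Nu n" using xy unfolding W_def by blast
    then have "scale c n \<in> NN UNIV" by (intro pm.subspace_scale[OF NN_subspace])
    then show ?thesis unfolding W_def n Nu_simps(2)[symmetric] by blast
  qed
  have Wz: "\<zero>\<^bsub>E\<^esub> \<in> W"
    using Wsm[of "Nu 0" 0] Nu_simps(3)[of 0] unfolding W_def by simp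
  let ?V = "{t \<in> carrier MM. \<forall>a. ptE t (single a 1) \<in> W}"
  have "carrier MM \<subseteq> ?V"
  proof (rule MT.multi_span)
    show "submodule ?V ring_of_type_algebra MM"
      by (rule MT.TM.submoduleI') (auto simp: EE.pt_add_left EE.pt_smul_left Wadd Wsm Wz)
    let ?G = "\<lambda>r. {pB r (wd u) | u. u \<in> lists {i. blk i = r}}"
    fix r assume "r \<in> {1..N}"
    interpret B: kquot_alg "Tr r" "Jr r" by (rule Br_locale)
    interpret Bm: kmodule "Br r" by (rule Br_kmodule)
    show G: "?G r \<subseteq> carrier (Br r)" by (auto intro!: pB_closed)
    have sub: "submodule (gen_submodule (Br r) (?G r)) ring_of_type_algebra (Br r)"
      by (rule gen_submodule_submodule[OF Br_kmodule G])
    show "carrier (Br r) \<subseteq> gen_submodule (Br r) (?G r)"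
    proof
      fix C assume "C \<in> carrier (Br r)"
      then obtain f where f: "keys f \<subseteq> lists {i. blk i = r}" "C = pB r f"
        unfolding Br_quot by (auto simp: B.quot_carrier)
      from f(1) have "pB r f \<in> gen_submodule (Br r) (?G r)"
      proof (induction rule: keys_induct)
        case zero
        have "pB r 0 = \<zero>\<^bsub>Br r\<^esub>" using lm_zero[OF pB_lm B.kmodule_axioms Br_kmodule] by simp
        then show ?case using Bm.submodule_zero[OF sub] by simp
      next
        case (single u c)
        have "pB r (single u c) = c \<odot>\<^bsub>Br r\<^esub> pB r (wd u)"
          using lm_smul[OF pB_lm, of "wd u" r c] single by simp
        moreover have "pB r (wd u) \<in> gen_submodule (Br r) (?G r)" by (rule gen_submodule_base) (use single in blast)
        ultimately show ?case using Bm.submodule_smul[OF sub] by simp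
      next
        case (add f h)
        have "pB r (f + h) = pB r f \<oplus>\<^bsub>Br r\<^esub> pB r h" using lm_add[OF pB_lm, of f r h] add by simp
        then show ?case using Bm.submodule_add[OF sub] add by simp
      qed
      then show "C \<in> gen_submodule (Br r) (?G r)" unfolding f(2) .
    qed
  next
    fix y assume y: "y \<in> (\<Pi>\<^sub>E r\<in>{1..N}. {pB r (wd u) | u. u \<in> lists {i. blk i = r}})"
    then have "\<forall>r\<in>{1..N}. \<exists>u. y r = pB r (wd u) \<and> u \<in> lists {i. blk i = r}" by (auto simp: PiE_iff)
    then obtain u where u: "\<And>r. r \<in> {1..N} \<Longrightarrow> y r = pB r (wd (u r))" "\<And>r. r \<in> {1..N} \<Longrightarrow> u r \<in> lists {i. blk i = r}"
      by metis
    \<comment> \<open>The word with the prescribed block components; listing the blocks in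
      increasing order makes it normal.\<close>
    define w where "w = concat (map u [1..<Suc N])"
    have fil: "filter (\<lambda>i. blk i = r) (concat (map u rs)) = (if r \<in> set rs then u r else [])"
      if "set rs \<subseteq> {1..N}" "distinct rs" for rs r
      using that
    proof (induction rs)
      case (Cons r' rs)
      have l: "\<forall>i\<in>set (u r'). blk i = r'" using u(2)[of r'] Cons.prems by auto
      have "filter (\<lambda>i. blk i = r) (u r') = (if r = r' then u r' else [])"
        using l by (auto simp: filter_id_conv filter_empty_conv)
      then show ?case using Cons by auto
    qed simp
    have srt: "sorted (map blk (concat (map u [m..<n])))" if "1 \<le> m" "n \<le> Suc N" for m n
      using that
    proof (induction "n - m" arbitrary: m)
      case (Suc d)
      then have mn: "m < n" by simp
      have e: "concat (map u [m..<n]) = u m @ concat (map u [Suc m..<n])" using mn by (simp add: upt_conv_Cons)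
      have l: "\<forall>i\<in>set (u m). blk i = m" using u(2)[of m] Suc.prems mn by auto
      then have 1: "sorted (map blk (u m))" by (induction "u m" rule: list.induct) (auto simp: sorted_iff_nth_mono)
      have 2: "sorted (map blk (concat (map u [Suc m..<n])))" using Suc by auto
      have 3: "\<forall>i\<in>set (concat (map u [Suc m..<n])). m \<le> blk i"
      proof
        fix i assume "i \<in> set (concat (map u [Suc m..<n]))"
        then obtain r where "r \<in> {Suc m..<n}" "i \<in> set (u r)" by auto
        then show "m \<le> blk i" using u(2)[of r] Suc.prems by auto
      qed
      show ?case unfolding e using 1 2 3 l by (auto simp: sorted_append)
    qed simp
    have sw: "sorted (map blk w)" unfolding w_def by (rule srt) auto
    have "yw w = y"
    proof
      fix r
      show "yw w r = y r"
      proof (cases "r \<in> {1..N}")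
        case True
        then have "filter (\<lambda>i. blk i = r) w = u r" unfolding w_def by (subst fil) auto
        then show ?thesis using True u(1) by (simp add: yw_def)
      next
        case False
        then show ?thesis using y by (auto simp: yw_def PiE_iff extensional_def)
      qed
    qed
    then have "ptE (mgen y) (single a 1) \<in> W" for a
      using Nu_mn[of w a] sw unfolding W_def by (intro image_eqI[of _ _ "mn w a"]) (auto simp: nrm_def)
    moreover have "mgen y \<in> carrier MM" using yw_Bs[of w] \<open>yw w = y\<close> by auto
    ultimately show "mgen y \<in> ?V" by blast
  qed
  then have t1: "ptE t (single a 1) \<in> W" if "t \<in> carrier MM" for t a using that by blast
  have pure: "ptE t z \<in> W" if t: "t \<in> carrier MM" for t z
  proof -
    have "keys z \<subseteq> UNIV" by simp
    then show ?thesis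
    proof (induction rule: keys_induct)
      case zero
      then show ?case using EE.pt_zero_right[OF t] Wz by simp
    next
      case (single a c)
      have "ptE t (single a c) = c \<odot>\<^bsub>E\<^esub> ptE t (single a 1)"
        using EE.pt_smul_right[OF t, of "single a 1" c] by simp
      then show ?case using Wsm t1[OF t] by simp
    next
      case (add f h)
      then show ?case using EE.pt_add_right[OF t, of f h] Wadd by simp
    qed
  qed
  have "x \<in> W" using assms by (induction rule: EE.tensor_induct) (auto intro: pure Wadd)
  then show ?thesis unfolding W_def by blast
qed

text \<open>By \<open>Nu_surj\<close> the elements of \<open>E\<close> have normal representatives,
  on which \<open>e_Nu\<close> evaluates the map. Injectivity then says that a normal element of the
  ideal is killed by \<open>Nu\<close>, which follows from \<open>I_lam_NN\<close> and
  \<open>Nu_K\<close>; surjectivity is the existence of normal forms.\<close>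

theorem e_bij: "bij_betw (e_map \<chi> g blk N R lam) (carrier E) (carrier AA)"
proof (rule bij_betw_imageI)
  let ?e = "e_map \<chi> g blk N R lam"
  show "inj_on ?e (carrier E)"
  proof (rule inj_onI)
    fix x y assume x: "x \<in> carrier E" and y: "y \<in> carrier E" and eq: "?e x = ?e y"
    obtain n where n: "n \<in> NN UNIV" "x = Nu n" using Nu_surj[OF x] by blast
    obtain m where m: "m \<in> NN UNIV" "y = Nu m" using Nu_surj[OF y] by blast
    have "pA n = pA m" using eq e_Nu[OF n(1)] e_Nu[OF m(1)] by (simp only: n(2) m(2))
    then have "n - m \<in> I_lam" by (simp only: pA_eq)
    moreover have "n - m \<in> NN UNIV" by (rule pm.subspace_diff[OF NN_subspace n(1) m(1)])
    ultimately have "Nu (n - m) = \<zero>\<^bsub>E\<^esub>" by (intro Nu_K I_lam_NN)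
    then have "Nu (n - m + m) = \<zero>\<^bsub>E\<^esub> \<oplus>\<^bsub>E\<^esub> Nu m" by (simp only: Nu_simps)
    then have "Nu n = Nu m" using Nu_simps(3)[of m] by simp
    then show "x = y" using n m by simp
  qed
  show "?e ` carrier E = carrier AA"
  proof
    show "?e ` carrier E \<subseteq> carrier AA" using lm_closed[OF e_lm] by blast
    show "carrier AA \<subseteq> ?e ` carrier E"
    proof
      fix x assume "x \<in> carrier AA"
      then obtain f where f: "x = pA f" by (rule AA_cases)
      have "pA f = pA (nf f)" unfolding pA_eq using nf_cong I'_I_lam by blast
      then have "x = ?e (Nu (nf f))" using e_Nu[OF nf_NN] f by simp
      then show "x \<in> ?e ` carrier E" using Nu_simps(3) by blast
    qed
  qed
qed

end

section \<open>The Hopf algebra \<open>H^0\<close> and the cleft object\<close>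

context lifting_datum
begin

abbreviation "phi \<equiv> phi_map \<chi> g blk N R lam"

lemma
  shows e_zero_bij: "bij_betw (e_map \<chi> g blk N R (\<lambda>_. 0)) (carrier E) (carrier HH)"
    and e_zero_lm: "e_map \<chi> g blk N R (\<lambda>_. 0) \<in> linear_maps E HH"
    and e_zero_Nu: "n \<in> NN UNIV \<Longrightarrow> e_map \<chi> g blk N R (\<lambda>_. 0) (Nu n) = pH n"
proof -
  interpret H: lifting_datum \<chi> g blk N L R Rc "\<lambda>_. 0" by (rule lifting_datum_axioms)
  show "bij_betw (e_map \<chi> g blk N R (\<lambda>_. 0)) (carrier E) (carrier HH)"
    using H.e_bij unfolding A_ideal_zero .
  show "e_map \<chi> g blk N R (\<lambda>_. 0) \<in> linear_maps E HH"
    using H.e_lm unfolding A_ideal_zero .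
  show "n \<in> NN UNIV \<Longrightarrow> e_map \<chi> g blk N R (\<lambda>_. 0) (Nu n) = pH n"
    using H.e_Nu[of n] unfolding A_ideal_zero .
qed

lemma phi_map_lm: "phi \<in> linear_maps HH AA"
  and phi_map_bij: "bij_betw phi (carrier HH) (carrier AA)"
  and phi_map_pH: "n \<in> NN UNIV \<Longrightarrow> phi (pH n) = pA n"
proof -
  show "phi \<in> linear_maps HH AA"
    unfolding phi_map_def E_mod_eq comp_def
    by (rule lm_compose[OF lm_inv[OF e_zero_lm e_zero_bij EE.tensor_kmodule] e_lm])
  show "bij_betw phi (carrier HH) (carrier AA)"
    unfolding phi_map_def E_mod_eq
    by (rule bij_betw_trans[OF bij_betw_inv_into[OF e_zero_bij] e_bij])
  assume n: "n \<in> NN UNIV"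
  have "inv_into (carrier E) (e_map \<chi> g blk N R (\<lambda>_. 0)) (pH n) = Nu n"
    unfolding e_zero_Nu[OF n, symmetric]
    by (rule inv_into_f_f[OF bij_betw_imp_inj_on[OF e_zero_bij] Nu_simps(3)])
  then show "phi (pH n) = pA n" by (simp add: phi_map_def E_mod_eq e_Nu[OF n])
qed

lemma phi_map_section: "is_section HH dH H0_counit AA rho phi"
  by (rule phi_section[OF phi_map_lm phi_map_pH])

lemma counit_hom: "H0_counit \<in> ring_hom HH ring_of_type_algebra"
  and counit_smul: "h \<in> carrier HH \<Longrightarrow> H0_counit (c \<odot>\<^bsub>HH\<^esub> h) = c * H0_counit h"
proof -
  show "H0_counit \<in> ring_hom HH ring_of_type_algebra"
    by (rule ring_hom_memI)
      (auto elim!: HH_cases simp: pH_simps H0_counit_pH counit_add counit_mult counit_mn)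
  show "h \<in> carrier HH \<Longrightarrow> H0_counit (c \<odot>\<^bsub>HH\<^esub> h) = c * H0_counit h"
    by (auto elim!: HH_cases simp: pH_simps H0_counit_pH counit_scale)
qed

text \<open>At \<open>\<lambda> = 0\<close> the comodule axioms become coassociativity and the left
  counit law of \<open>H^0\<close>, and the identity is a section, which provides the antipode. For
  the Hopf algebra axioms this leaves the right counit law and the properties of the counit as an
  algebra map.\<close>

lemma
  shows comodule_zero: "comodule_algebra HH dH H0_counit HH dH"
    and section_zero: "is_section HH dH H0_counit HH dH (\<lambda>h. h)"
proof -
  interpret H: lifting_datum \<chi> g blk N L R Rc "\<lambda>_. 0" by (rule lifting_datum_axioms)
  show "comodule_algebra HH dH H0_counit HH dH"
    using H.comodule unfolding H.rho_def A_ideal_zero dH_coaction[symmetric] .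
  have "(\<lambda>h. h) \<in> linear_maps HH HH" by (rule linear_mapsI) simp_all
  from H.phi_section[unfolded H.rho_def A_ideal_zero dH_coaction[symmetric], OF this]
  show "is_section HH dH H0_counit HH dH (\<lambda>h. h)" by simp
qed

lemma hopf: "hopf_algebra HH dH H0_counit"
proof -
  have "tensor_lift HH (\<lambda>(a, b). H0_counit b \<odot>\<^bsub>HH\<^esub> a) (dH h) = h" if "h \<in> carrier HH" for h
    using that by (auto elim!: HH_cases simp: coproduct_counit)
  moreover have "convolution_invertible HH dH H0_counit HH (\<lambda>h. h)"
    using section_zero unfolding is_section_def by blast
  ultimately show ?thesis
    using comodule_zero counit_hom counit_smul
    unfolding hopf_algebra_def comodule_algebra_def by blast
qed

lemma cleft: "cleft_object HH dH H0_counit AA rho"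
  unfolding cleft_object_def
  using hopf comodule phi_map_section coinvariants[OF phi_map_lm phi_map_pH phi_map_bij] by blast

end

theorem proposition2p5:
  fixes \<chi> :: "'i::finite \<Rightarrow> 'g::ab_group_add \<Rightarrow> 'k::comm_ring_1"
    and g :: "'i \<Rightarrow> 'g"
    and blk :: "'i \<Rightarrow> nat"
    and N L :: nat
    and R :: "('i list \<Rightarrow>\<^sub>0 'k) set"
    and Rc :: "nat \<Rightarrow> ('i list \<Rightarrow>\<^sub>0 'k) set"
    and lam :: "'i \<times> 'i \<Rightarrow> 'k"
  assumes "\<And>i. is_character (\<chi> i)"
    and "range blk = {1..N}"
    and "\<And>i j. blk i \<noteq> blk j \<Longrightarrow> \<chi> j (g i) * \<chi> i (g j) = 1"
    and "\<And>z. z \<in> R \<Longrightarrow> \<exists>r. braided_element \<chi> g blk r z"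
    and "Rc 0 = {}" and "Rc L = R"
    and "\<And>h. h < L \<Longrightarrow> Rc h \<subseteq> Rc (Suc h)"
    and "\<And>h z. 0 < h \<Longrightarrow> h \<le> L \<Longrightarrow> z \<in> Rc h \<Longrightarrow>
           primitive_modulo \<chi> g (genideal (tensor_algebra UNIV) (Rc (h - 1))) z"
  shows "bij_betw (e_map \<chi> g blk N R lam)
           (carrier (E_mod \<chi> g blk N R)) (carrier (A_alg \<chi> g blk R lam)) \<and>
         bij_betw (e_map \<chi> g blk N R (\<lambda>_. 0))
           (carrier (E_mod \<chi> g blk N R)) (carrier (H0_alg \<chi> g blk R)) \<and>
         is_section (H0_alg \<chi> g blk R) (H0_coproduct \<chi> g blk R) H0_counit
           (A_alg \<chi> g blk R lam) (A_coaction \<chi> g blk R lam) (phi_map \<chi> g blk N R lam) \<and>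
         cleft_object (H0_alg \<chi> g blk R) (H0_coproduct \<chi> g blk R) H0_counit
           (A_alg \<chi> g blk R lam) (A_coaction \<chi> g blk R lam)"
proof -
  interpret lifting_datum \<chi> g blk N L R Rc lam
    by (rule lifting_datum.intro) (fact assms)+
  show ?thesis
    using e_bij e_zero_bij phi_map_section cleft
    unfolding A_alg_eq H0_alg_eq E_mod_eq dH_def rho_def by blast
qed

end
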